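(* Let $$\mathcal A=\begin{pmatrix}A&B^T\\-B&0\end{pmatrix},\quad \mathcal M_U=\begin{pmatrix}H_{\bm w}^{-1}&B^T\\0&H_p^{-1}\end{pmatrix}^{-1},\quad \mathcal M_D=\begin{pmatrix}H_{\bm w}&0\\0&H_p\end{pmatrix},$$ where $H_{\bm w}:\bm W_h'\to\bm W_h$ and $H_p:Q_h'\to Q_h$ are symmetric positive definite. Suppose that for all $\bm r\in\bm W_h'$ and $q\in Q_h'$ $$c_{1,\bm w}(H_{\bm w}\bm r,\bm r)\le(A^{-1}\bm r,\bm r)\le c_{2,\bm w}(H_{\bm w}\bm r,\bm r),$$ $$c_{1,p}(H_pq,q)\le((BD_A^{-1}B^T)^{-1}q,q)\le c_{2,p}(H_pq,q),$$ with constants $c_{1,\bm w},c_{2,\bm w},c_{1,p},c_{2,p}>0$ independent of discretization and physical parameters, and that $\|I-H_{\bm w}A\|_A\le\rho$ for some $0\le\rho<1$. Then there exist constants $\xi_1,\xi_2>0$ independent of discretization and physical parameters such that for any $\bm x'=\mathcal M_U^{-1}\bm x$ with $\bm x=(\bm w_h,p_h)\in\bm W_h\times Q_h$, $\bm x\ne\bm 0$, $$\xi_1\le\frac{(\mathcal A\mathcal M_U\bm x',\bm x')_{\mathcal M_D}}{(\bm x',\bm x')_{\mathcal M_D}}\qquad\text{and}\qquad\frac{\|\mathcal A\mathcal M_U\bm x'\|_{\mathcal M_D}}{\|\bm x'\|_{\mathcal M_D}}\le\xi_2.$$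
   Context: **Geometry.** Let $n\in\{2,3\}$. A fractured porous medium of rectangular type (fractures are line segments if $n=2$, flat surfaces if $n=3$) is decomposed by the fractures into $n$-dimensional subdomains $\Omega_i^n$, $i\in I^n$; fractures and their intersections are lower-dimensional subdomains $\Omega_i^d$, $i\in I^d$, $0\le d<n$. For $0\le d\le n-1$ and $i\in I^d$, $\Gamma_{ij}^d$ ($j\in J_i^d$) are the interfaces between $\Omega_i^d$ and the adjacent $(d+1)$-dimensional subdomains. Set $\Omega^d=\bigcup_i\Omega_i^d$, $\Gamma^d=\bigcup_i\bigcup_j\Gamma_{ij}^d$, $\Omega=\bigcup_{d=0}^n\Omega^d$, $\Gamma=\bigcup_{d=0}^{n-1}\Gamma^d$. The boundary splits disjointly as $\partial\Omega=\partial\Omega_D\cup\partial\Omega_N$ with $\partial\Omega_D$ of positive measure; $\partial\Omega_N^d$ is the part of $\partial\Omega_N$ on $\partial\Omega^d$; $\bm\nu$ is the outward unit normal. **Physical parameters.** The permeability $K$ (on $\Omega$) and normal permeability $K_{\bm\nu}$ (on $\Gamma$) are symmetric positive definite tensors bounded above and below; $\gamma>0$ on $\Gamma$ (distance from $\Gamma_{ij}^d$ to $\Omega_i^d$; the aperture for $d=n-1$). All are assumed constant on each subdomain/interface. **Spaces.** $\bm V^d=\{\bm v\in (L^2(\Omega^d))^d:\nabla\cdot\bm v\in L^2(\Omega^d),\ \bm v\cdot\bm\nu=0 \text{ on }\partial\Omega_N^d\}$ for $1\le d\le n$; $\bm V_0^d=\{\bm v\in\bm V^d:\bm v\cdot\bm\nu=0\text{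 on }\Gamma^{d-1}\}$; $\Lambda^d=L^2(\Gamma^d)$ for $0\le d\le n-1$; $Q^d=L^2(\Omega^d)$ for $0\le d\le n$. On shape-regular simplicial triangulations $\mathcal T^d_\Omega$ of $\Omega^d$ and $\mathcal T^d_\Gamma$ of $\Gamma^d$ (maximal mesh size $h$), $\bm V_h^d\subset\bm V^d$ and $\bm V_{0h}^d\subset\bm V_0^d$ are lowest-order Raviart–Thomas spaces $\mathbb{RT}_0(\mathcal T_\Omega^d)$, $\Lambda_h^d=\mathbb P_0(\mathcal T_\Gamma^d)$ and $Q_h^d=\mathbb P_0(\mathcal T_\Omega^d)$ (piecewise constants). Put $\bm V_{0h}=\bigoplus_{d=1}^n\bm V_{0h}^d$, $\Lambda_h=\bigoplus_{d=0}^{n-1}\Lambda_h^d$, $Q_h=\bigoplus_{d=0}^nQ_h^d$, $\bm W_h=\bm V_{0h}\times\Lambda_h$. **Discrete extension.** $\widehat\Pi_h^d:\Lambda_h^d\to\bm V_h^{d+1}\cdot\bm\nu|_{\Gamma^d}$ is the $L^2$-projection, $(\widehat\Pi_h^d\mu-\mu,\bm v\cdot\bm\nu)_{L^2(\Gamma^d)}=0$ for all $\bm v\in\bm V_h^{d+1}$. $R_h^d:\Lambda_h^d\to\bm V_h^{d+1}$ is defined by $R_h^d\lambda\cdot\bm\nu=\widehat\Pi_h^d\lambda$ on $\Gamma^d$ and $0$ elsewhere (all other facet normal components vanish); $R_h=\bigoplus_{d=0}^{n-1}R_h^d$. **Forms.** $(\cdot,\cdot)_\Omega$, $(\cdot,\cdot)_\Gamma$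 are the sums of the $L^2$ inner products over all subdomains, respectively interfaces, with the convention that flux components for $d=0$ and mortar components for $d=n$ are zero. The jump is $\llbracket\lambda\rrbracket|_{\Omega_i^d}=-\sum_{j\in J_i^d}\lambda_{ij}^d$, and $\bm D\cdot[\bm u,\lambda]=\nabla\cdot\bm u+\llbracket\lambda\rrbracket$. For $\bm w_h=[\bm u_{0h},\lambda_h]$, $\bm r_h=[\bm v_{0h},\mu_h]\in\bm W_h$, $q_h\in Q_h$: $$a(\bm w_h,\bm r_h)=(K^{-1}(\bm u_{0h}+R_h\lambda_h),\bm v_{0h}+R_h\mu_h)_\Omega+(\gamma K_{\bm\nu}^{-1}\lambda_h,\mu_h)_\Gamma,$$ $$b(\bm r_h,q_h)=-(q_h,\bm D\cdot[\bm v_{0h}+R_h\mu_h,\mu_h])_\Omega,$$ $$a^D(\bm w_h,\bm r_h)=(K^{-1}(\bm u_{0h}+R_h\lambda_h),\bm v_{0h}+R_h\mu_h)_{D,\Omega}+(\gamma K_{\bm\nu}^{-1}\lambda_h,\mu_h)_\Gamma,$$ where $$(K^{-1}\bm u,\bm v)_{D,\Omega}=\sum_{d=0}^n\sum_{T\in\mathcal T_\Omega^d}\sum_{f\in\partial T}(\bm u\cdot\bm\nu_f)(\bm v\cdot\bm\nu_f)(K^{-1}\bm\phi_f,\bm\phi_f)_T.$$ Here $f$ runs over the faces of the element $T$, $\bm\nu_f$ is the unit outer normal of $f$, and $\bm\phi_f\in\mathbb{RT}_0(T)$ is the basis function of face $f$ (so $\bm v|_T=\sum_f(\bm v\cdot\bm\nu_f)\bm\phi_f$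 for $\bm v\in\mathbb{RT}_0(T)$). **Operators.** With primes for dual spaces and $\langle\cdot,\cdot\rangle$ (or $(\cdot,\cdot)$) for duality pairings: $A:\bm W_h\to\bm W_h'$, $\langle A\bm w_h,\bm r_h\rangle=a(\bm w_h,\bm r_h)$; $D_A:\bm W_h\to\bm W_h'$, $\langle D_A\bm w_h,\bm r_h\rangle=a^D(\bm w_h,\bm r_h)$; $B:\bm W_h\to Q_h'$, $\langle B\bm r_h,q_h\rangle=b(\bm r_h,q_h)$, with transpose $B^T:Q_h\to\bm W_h'$. $\|\bm w_h\|_A^2=\langle A\bm w_h,\bm w_h\rangle$, and $\|I-H_{\bm w}A\|_A$ is the operator norm on $\bm W_h$ induced by $\|\cdot\|_A$. For a symmetric positive definite $\mathcal M:(\bm W_h\times Q_h)'\to\bm W_h\times Q_h$, the inner product on the dual space is $(\bm x',\bm y')_{\mathcal M}=\langle\bm x',\mathcal M\bm y'\rangle$ and $\|\bm x'\|_{\mathcal M}^2=(\bm x',\bm x')_{\mathcal M}$. **Convention.** "Independent of discretization and physical parameters" means independent of $h$, $K$, $K_{\bm\nu}$, $\gamma$; dependence on the shape regularity of the mesh (and on $\rho$ and the spectral-equivalence constants) is allowed.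
   Formalization: The ratio of the upper to the lower bound of K on each subdomain is bounded by a fixed θ, and ξ1, ξ2 may depend on θ (not on the size or jumps of K); full independence of K is false for unbounded anisotropy, where the diagonal form a^D is not uniformly equivalent to a. *)

theory Defs
  imports "HOL-Analysis.Analysis" "HOL-Library.Function_Algebras"
begin

text \<open>Pointwise real vector space structure on functions, completing the additive instances of
  \<^theory>\<open>HOL-Library.Function_Algebras\<close>. All discrete spaces below are subspaces of function spaces.\<close>

instantiation "fun" :: (type, real_vector) real_vector
begin

definition scaleR_fun :: "real \<Rightarrow> ('a \<Rightarrow> 'b) \<Rightarrow> 'a \<Rightarrow> 'b"
  where "scaleR_fun c f = (\<lambda>x. c *\<^sub>R f x)"

instance
  by standard (auto simp: scaleR_fun_def fun_eq_iff algebra_simps)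

end


section \<open>Flat sets: tangent space, surface measure, surface divergence\<close>

definition tangent :: "'a::euclidean_space set \<Rightarrow> 'a set"
  where "tangent S = {x - y | x y. x \<in> affine hull S \<and> y \<in> affine hull S}"

definition orthobasis :: "'a::euclidean_space set \<Rightarrow> 'a set"
  where "orthobasis S = (SOME B. B \<subseteq> tangent S \<and> pairwise orthogonal B \<and> (\<forall>e\<in>B. norm e = 1) \<and>
           independent B \<and> span B = tangent S)"

text \<open>The \<open>d\<close>-dimensional Lebesgue measure carried by the \<open>d\<close>-dimensional affine hull of \<open>S\<close>: the image of
  the product Lebesgue measure under an isometric parametrisation. It does not depend on the chosen
  base point and orthonormal basis; it is \<^const>\<open>lborel\<close> (on Borel sets) if \<open>S\<close> is full-dimensional and the
  unit point mass if \<open>S\<close> is a single point.\<close>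

definition flat_measure :: "'a::euclidean_space set \<Rightarrow> 'a measure"
  where "flat_measure S =
    distr (PiM (orthobasis S) (\<lambda>_. lborel)) borel
      (\<lambda>t. (SOME p. p \<in> affine hull S) + (\<Sum>e\<in>orthobasis S. t e *\<^sub>R e))"

definition surface_div :: "'a::euclidean_space set \<Rightarrow> ('a \<Rightarrow> 'a) \<Rightarrow> 'a \<Rightarrow> real"
  where "surface_div S v x = (\<Sum>e\<in>orthobasis S. frechet_derivative v (at x) e \<bullet> e)"


section \<open>Fractured porous media\<close>

text \<open>\<open>subdom M d\<close> is the set of the \<open>d\<close>-dimensional subdomains (each one serves as its own index),
  \<open>bdD\<close> and \<open>bdN\<close> are the Dirichlet and the Neumann part of the boundary.\<close>

record 'a medium =
  subdom :: "nat \<Rightarrow> 'a set set"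
  bdD :: "'a set"
  bdN :: "'a set"

definition subdomains :: "'a::euclidean_space medium \<Rightarrow> 'a set set"
  where "subdomains M = (\<Union>d\<le>DIM('a). subdom M d)"

definition medium_dom :: "'a::euclidean_space medium \<Rightarrow> 'a set"
  where "medium_dom M = \<Union>(subdomains M)"

text \<open>Subdomains are relatively open in their flat hulls, so neither the tips of immersed fractures nor
  the end points of immersed intersection lines belong to the medium; they are part of its frontier,
  where they may be assigned to either boundary part.
  A subdomain may lie on both sides of a fracture. The boundary consists of flat pieces, hence
  it has positive surface measure iff it meets some hyperplane in positive measure.\<close>

definition fractured_medium :: "'a::euclidean_space medium \<Rightarrow> bool"
  where "fractured_medium M \<longleftrightarrow>
    (\<forall>d. finite (subdom M d)) \<and> (\<forall>d>DIM('a). subdom M d = {}) \<and> subdom M (DIM('a)) \<noteq> {} \<and>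
    (\<forall>d. \<forall>S\<in>subdom M d. S \<noteq> {} \<and> connected S \<and> bounded S \<and> aff_dim S = int d \<and>
        openin (top_of_set (affine hull S)) S) \<and>
    (\<forall>S\<in>subdomains M. \<forall>S'\<in>subdomains M. S \<noteq> S' \<longrightarrow> S \<inter> S' = {}) \<and>
    open (medium_dom M) \<and>
    (\<forall>d. \<forall>S\<in>subdom M d. closure S - S \<subseteq> frontier (medium_dom M) \<union> (\<Union>d'<d. \<Union>(subdom M d'))) \<and>
    (\<forall>d<DIM('a). \<forall>L\<in>subdom M d. L \<subseteq> closure (\<Union>(subdom M (Suc d)))) \<and>
    bdD M \<union> bdN M = frontier (medium_dom M) \<and> bdD M \<inter> bdN M = {} \<and>
    (\<exists>H. affine H \<and> aff_dim H = int DIM('a) - 1 \<and> emeasure (flat_measure H) (bdD M \<inter> H) > 0)"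

text \<open>An interface \<open>(L, S, \<nu>)\<close>: the side of the \<open>d\<close>-dimensional subdomain \<open>L\<close> on which the adjacent
  \<open>(d+1)\<close>-dimensional subdomain \<open>S\<close> lies, with the unit normal \<open>\<nu>\<close> pointing out of \<open>S\<close>. As a point set it is
  identified with \<open>L\<close>. If \<open>S\<close> lies on both sides of \<open>L\<close>, there are two interfaces.\<close>

type_synonym 'a iface = "'a set \<times> 'a set \<times> 'a"

definition ifaces :: "'a::euclidean_space medium \<Rightarrow> 'a iface set"
  where "ifaces M = {(L, S, \<nu>). (\<exists>d<DIM('a). L \<in> subdom M d \<and> S \<in> subdom M (Suc d)) \<and>
    L \<subseteq> closure S \<and> norm \<nu> = 1 \<and> \<nu> \<in> tangent S \<and> (\<forall>\<tau>\<in>tangent L. \<nu> \<bullet> \<tau> = 0) \<and>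
    (\<forall>x\<in>L. \<exists>\<epsilon>>0. \<forall>y\<in>affine hull S. dist x y < \<epsilon> \<and> (y - x) \<bullet> \<nu> < 0 \<longrightarrow> y \<in> S)}"


section \<open>Triangulations\<close>

record 'a mesh =
  tri :: "'a set \<Rightarrow> 'a set set"
  mortar_tri :: "'a iface \<Rightarrow> 'a set set"

text \<open>Face-to-face triangulation of the closure of \<open>S\<close>. Simplices only need to match inside \<open>S\<close>: on the two
  sides of a fracture the triangulations are independent, even if both sides belong to the same \<open>S\<close>.\<close>

definition triangulates :: "'a::euclidean_space set set \<Rightarrow> 'a set \<Rightarrow> bool"
  where "triangulates \<T> S \<longleftrightarrow> finite \<T> \<and> \<Union>\<T> = closure S \<and>
    (\<forall>T\<in>\<T>. aff_dim S simplex T \<and> rel_interior T \<subseteq> S) \<and>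
    (\<forall>T\<in>\<T>. \<forall>T'\<in>\<T>. T \<inter> T' \<inter> S \<noteq> {} \<longrightarrow> (T \<inter> T') face_of T)"

definition shape_regular :: "real \<Rightarrow> 'a::euclidean_space set \<Rightarrow> bool"
  where "shape_regular \<sigma> T \<longleftrightarrow>
    (\<exists>r>0. \<exists>c\<in>T. cball c r \<inter> affine hull T \<subseteq> T \<and> diameter T \<le> \<sigma> * r)"

text \<open>The facets of the triangulations resolve the interfaces and the boundary parts.\<close>

definition admissible_mesh :: "'a::euclidean_space medium \<Rightarrow> real \<Rightarrow> 'a mesh \<Rightarrow> bool"
  where "admissible_mesh M \<sigma> X \<longleftrightarrow>
    (\<forall>S\<in>subdomains M. triangulates (tri X S) S \<and> (\<forall>T\<in>tri X S. shape_regular \<sigma> T)) \<and>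
    (\<forall>(L, S, \<nu>)\<in>ifaces M. triangulates (mortar_tri X (L, S, \<nu>)) L \<and>
        (\<forall>T\<in>mortar_tri X (L, S, \<nu>). shape_regular \<sigma> T)) \<and>
    (\<forall>d. \<forall>S\<in>subdom M (Suc d). \<forall>T\<in>tri X S. \<forall>f. f facet_of T \<longrightarrow>
        rel_interior f \<subseteq> S \<or> (\<exists>L\<in>subdom M d. rel_interior f \<subseteq> L) \<or>
        rel_interior f \<subseteq> bdD M \<or> rel_interior f \<subseteq> bdN M)"

type_synonym 'a cell = "'a set \<times> 'a set"
type_synonym 'a mcell = "'a iface \<times> 'a set"

definition cells :: "'a::euclidean_space medium \<Rightarrow> 'a mesh \<Rightarrow> 'a cell set"
  where "cells M X = (SIGMA S:subdomains M. tri X S)"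

definition mcells :: "'a::euclidean_space medium \<Rightarrow> 'a mesh \<Rightarrow> 'a mcell set"
  where "mcells M X = (SIGMA g:ifaces M. mortar_tri X g)"

definition outer_normal :: "'a::euclidean_space set \<Rightarrow> 'a set \<Rightarrow> 'a"
  where "outer_normal T f =
    (THE \<nu>. norm \<nu> = 1 \<and> \<nu> \<in> tangent T \<and> (\<forall>x\<in>f. \<forall>y\<in>T. (y - x) \<bullet> \<nu> \<le> 0))"

definition on_iface :: "'a::euclidean_space iface \<Rightarrow> 'a cell \<Rightarrow> 'a set \<Rightarrow> bool"
  where "on_iface g c f \<longleftrightarrow> (case (g, c) of ((L, S, \<nu>), (S', T)) \<Rightarrow>
    S' = S \<and> rel_interior f \<subseteq> L \<and> outer_normal T f = \<nu>)"


section \<open>Finite element spaces\<close>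

text \<open>Direct sums over the dimensions and the subdomains or interfaces are families indexed by all cells.
  A piecewise polynomial is the family of its polynomials on the cells, extended by zero to indices which
  are not cells. On a simplex whose dimension is smaller than that of the space, Raviart-Thomas fields are tangential.\<close>

definition RT0 :: "'a::euclidean_space set \<Rightarrow> ('a \<Rightarrow> 'a) set"
  where "RT0 T = {v. \<exists>a\<in>tangent T. \<exists>b. \<exists>c\<in>T. v = (\<lambda>x. a + b *\<^sub>R (x - c))}"

text \<open>The value of the normal component on a facet, on which it is constant.\<close>

definition nflux :: "('a::euclidean_space \<Rightarrow> 'a) \<Rightarrow> 'a set \<Rightarrow> 'a set \<Rightarrow> real"
  where "nflux v T f = (THE s. \<forall>x\<in>f. v x \<bullet> outer_normal T f = s)"

definition RT0_basis :: "'a::euclidean_space set \<Rightarrow> 'a set \<Rightarrow> 'a \<Rightarrow> 'a"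
  where "RT0_basis T f = (THE v. v \<in> RT0 T \<and>
    (\<forall>g. g facet_of T \<longrightarrow> (\<forall>x\<in>g. v x \<bullet> outer_normal T g = (if g = f then 1 else 0))))"

text \<open>For piecewise Raviart-Thomas fields, having a square integrable divergence means that the normal
  components on the two sides of every facet inside a subdomain cancel. Nothing is imposed on
  facets lying on interfaces, even if the same subdomain lies on both sides.\<close>

definition Vh :: "'a::euclidean_space medium \<Rightarrow> 'a mesh \<Rightarrow> ('a cell \<Rightarrow> 'a \<Rightarrow> 'a) set"
  where "Vh M X = {v.
    (\<forall>S T. (S, T) \<in> cells M X \<and> aff_dim S \<ge> 1 \<longrightarrow> v (S, T) \<in> RT0 T) \<and>
    (\<forall>S T. (S, T) \<notin> cells M X \<or> aff_dim S = 0 \<longrightarrow> v (S, T) = 0) \<and>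
    (\<forall>S T T' f. (S, T) \<in> cells M X \<and> (S, T') \<in> cells M X \<and> T \<noteq> T' \<and>
        f facet_of T \<and> f facet_of T' \<and> rel_interior f \<subseteq> S \<longrightarrow>
        (\<forall>x\<in>f. v (S, T) x \<bullet> outer_normal T f + v (S, T') x \<bullet> outer_normal T' f = 0)) \<and>
    (\<forall>S T f. (S, T) \<in> cells M X \<and> f facet_of T \<and> rel_interior f \<subseteq> bdN M \<longrightarrow>
        (\<forall>x\<in>f. v (S, T) x \<bullet> outer_normal T f = 0))}"

definition V0h :: "'a::euclidean_space medium \<Rightarrow> 'a mesh \<Rightarrow> ('a cell \<Rightarrow> 'a \<Rightarrow> 'a) set"
  where "V0h M X = {v\<in>Vh M X. \<forall>S T f. \<forall>g\<in>ifaces M.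
    (S, T) \<in> cells M X \<and> f facet_of T \<and> on_iface g (S, T) f \<longrightarrow>
      (\<forall>x\<in>f. v (S, T) x \<bullet> outer_normal T f = 0)}"

definition Lamh :: "'a::euclidean_space medium \<Rightarrow> 'a mesh \<Rightarrow> ('a mcell \<Rightarrow> real) set"
  where "Lamh M X = {\<mu>. \<forall>m. m \<notin> mcells M X \<longrightarrow> \<mu> m = 0}"

definition Qh :: "'a::euclidean_space medium \<Rightarrow> 'a mesh \<Rightarrow> ('a cell \<Rightarrow> real) set"
  where "Qh M X = {q. \<forall>c. c \<notin> cells M X \<longrightarrow> q c = 0}"

type_synonym 'a flux = "('a cell \<Rightarrow> 'a \<Rightarrow> 'a) \<times> ('a mcell \<Rightarrow> real)"

definition Wh :: "'a::euclidean_space medium \<Rightarrow> 'a mesh \<Rightarrow> 'a flux set"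
  where "Wh M X = V0h M X \<times> Lamh M X"

text \<open>The piecewise constant functions on a subdomain or interface (defined up to null sets) given
  by their values on the simplices.\<close>

definition pw_const :: "'a::euclidean_space set set \<Rightarrow> ('a set \<Rightarrow> real) \<Rightarrow> 'a \<Rightarrow> real"
  where "pw_const \<T> c x = (\<Sum>T\<in>\<T>. c T * indicator (rel_interior T) x)"

definition cell_fun :: "'a::euclidean_space mesh \<Rightarrow> ('a cell \<Rightarrow> real) \<Rightarrow> 'a set \<Rightarrow> 'a \<Rightarrow> real"
  where "cell_fun X q S = pw_const (tri X S) (\<lambda>T. q (S, T))"

definition mortar_fun :: "'a::euclidean_space mesh \<Rightarrow> ('a mcell \<Rightarrow> real) \<Rightarrow> 'a iface \<Rightarrow> 'a \<Rightarrow> real"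
  where "mortar_fun X \<mu> g = pw_const (mortar_tri X g) (\<lambda>t. \<mu> (g, t))"


section \<open>Discrete extension operator\<close>

definition ip_Gamma :: "'a::euclidean_space medium \<Rightarrow> ('a iface \<Rightarrow> 'a \<Rightarrow> real) \<Rightarrow> ('a iface \<Rightarrow> 'a \<Rightarrow> real) \<Rightarrow> real"
  where "ip_Gamma M \<phi> \<psi> = (\<Sum>g\<in>ifaces M. LINT x:fst g|flat_measure (fst g). \<phi> g x * \<psi> g x)"

definition normal_trace ::
    "'a::euclidean_space medium \<Rightarrow> 'a mesh \<Rightarrow> ('a cell \<Rightarrow> 'a \<Rightarrow> 'a) \<Rightarrow> 'a iface \<Rightarrow> 'a \<Rightarrow> real"
  where "normal_trace M X v g x = (if g \<in> ifaces M then
    (\<Sum>((S, T), f)\<in>{(c, f). c \<in> cells M X \<and> f facet_of snd c \<and> on_iface g c f}.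
       nflux (v (S, T)) T f * indicator (rel_interior f) x) else 0)"

definition Pi_h ::
    "'a::euclidean_space medium \<Rightarrow> 'a mesh \<Rightarrow> ('a mcell \<Rightarrow> real) \<Rightarrow> 'a iface \<Rightarrow> 'a \<Rightarrow> real"
  where "Pi_h M X \<mu> = (THE t. t \<in> normal_trace M X ` Vh M X \<and>
    (\<forall>v\<in>Vh M X. ip_Gamma M (\<lambda>g x. t g x - mortar_fun X \<mu> g x) (normal_trace M X v) = 0))"

definition R_h ::
    "'a::euclidean_space medium \<Rightarrow> 'a mesh \<Rightarrow> ('a mcell \<Rightarrow> real) \<Rightarrow> 'a cell \<Rightarrow> 'a \<Rightarrow> 'a"
  where "R_h M X \<mu> = (THE v. v \<in> Vh M X \<and> normal_trace M X v = Pi_h M X \<mu> \<and>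
    (\<forall>S T f. (S, T) \<in> cells M X \<and> f facet_of T \<and> \<not> (\<exists>g\<in>ifaces M. on_iface g (S, T) f) \<longrightarrow>
       nflux (v (S, T)) T f = 0))"


section \<open>Physical parameters and bilinear forms\<close>

text \<open>\<open>perm P S\<close> acts on the tangent space of \<open>S\<close>. The normal direction of an interface is
  one-dimensional, so the normal permeability is a positive number.\<close>

record 'a params =
  perm :: "'a set \<Rightarrow> 'a \<Rightarrow> 'a"
  nperm :: "'a iface \<Rightarrow> real"
  gap :: "'a iface \<Rightarrow> real"

text \<open>On every subdomain the lower and the upper bound of the permeability tensor differ at most by the
  factor \<open>\<theta>\<close>; its magnitude is arbitrary and may vary arbitrarily from subdomain to subdomain.
  A bound of this kind cannot be dropped: the diagonal form \<open>form_aD\<close> is not equivalent to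
  \<open>form_a\<close> uniformly in the anisotropy of the permeability.\<close>

definition admissible_params :: "'a::euclidean_space medium \<Rightarrow> real \<Rightarrow> 'a params \<Rightarrow> bool"
  where "admissible_params M \<theta> P \<longleftrightarrow>
    (\<forall>S\<in>subdomains M. linear (perm P S) \<and> perm P S ` tangent S \<subseteq> tangent S \<and>
       (\<forall>x\<in>tangent S. \<forall>y\<in>tangent S. perm P S x \<bullet> y = x \<bullet> perm P S y) \<and>
       (\<exists>k>0. \<forall>x\<in>tangent S. k * (norm x)\<^sup>2 \<le> perm P S x \<bullet> x \<and> perm P S x \<bullet> x \<le> \<theta> * k * (norm x)\<^sup>2)) \<and>
    (\<forall>g\<in>ifaces M. nperm P g > 0 \<and> gap P g > 0)"

definition perm_inv :: "'a::euclidean_space params \<Rightarrow> 'a set \<Rightarrow> 'a \<Rightarrow> 'a"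
  where "perm_inv P S = inv_into (tangent S) (perm P S)"

definition ipK :: "'a::euclidean_space medium \<Rightarrow> 'a mesh \<Rightarrow> 'a params \<Rightarrow>
    ('a cell \<Rightarrow> 'a \<Rightarrow> 'a) \<Rightarrow> ('a cell \<Rightarrow> 'a \<Rightarrow> 'a) \<Rightarrow> real"
  where "ipK M X P u v = (\<Sum>(S, T)\<in>cells M X.
    LINT x:T|flat_measure S. perm_inv P S (u (S, T) x) \<bullet> v (S, T) x)"

definition ipKD :: "'a::euclidean_space medium \<Rightarrow> 'a mesh \<Rightarrow> 'a params \<Rightarrow>
    ('a cell \<Rightarrow> 'a \<Rightarrow> 'a) \<Rightarrow> ('a cell \<Rightarrow> 'a \<Rightarrow> 'a) \<Rightarrow> real"
  where "ipKD M X P u v = (\<Sum>(S, T)\<in>cells M X. \<Sum>f\<in>{f. f facet_of T}.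
    nflux (u (S, T)) T f * nflux (v (S, T)) T f *
    (LINT x:T|flat_measure S. perm_inv P S (RT0_basis T f x) \<bullet> RT0_basis T f x))"

definition ip_mortar :: "'a::euclidean_space medium \<Rightarrow> 'a mesh \<Rightarrow> 'a params \<Rightarrow>
    ('a mcell \<Rightarrow> real) \<Rightarrow> ('a mcell \<Rightarrow> real) \<Rightarrow> real"
  where "ip_mortar M X P l \<mu> =
    ip_Gamma M (\<lambda>g x. gap P g * inverse (nperm P g) * mortar_fun X l g x) (mortar_fun X \<mu>)"

definition form_a :: "'a::euclidean_space medium \<Rightarrow> 'a mesh \<Rightarrow> 'a params \<Rightarrow> 'a flux \<Rightarrow> 'a flux \<Rightarrow> real"
  where "form_a M X P w r =
    ipK M X P (fst w + R_h M X (snd w)) (fst r + R_h M X (snd r)) + ip_mortar M X P (snd w) (snd r)"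

definition form_aD :: "'a::euclidean_space medium \<Rightarrow> 'a mesh \<Rightarrow> 'a params \<Rightarrow> 'a flux \<Rightarrow> 'a flux \<Rightarrow> real"
  where "form_aD M X P w r =
    ipKD M X P (fst w + R_h M X (snd w)) (fst r + R_h M X (snd r)) + ip_mortar M X P (snd w) (snd r)"

definition jump :: "'a::euclidean_space medium \<Rightarrow> 'a mesh \<Rightarrow> ('a mcell \<Rightarrow> real) \<Rightarrow> 'a set \<Rightarrow> 'a \<Rightarrow> real"
  where "jump M X l S x = - (\<Sum>g\<in>{g\<in>ifaces M. fst g = S}. mortar_fun X l g x)"

definition mixed_div :: "'a::euclidean_space medium \<Rightarrow> 'a mesh \<Rightarrow>
    ('a cell \<Rightarrow> 'a \<Rightarrow> 'a) \<Rightarrow> ('a mcell \<Rightarrow> real) \<Rightarrow> 'a set \<Rightarrow> 'a \<Rightarrow> real"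
  where "mixed_div M X u l S x =
    (\<Sum>T\<in>tri X S. surface_div S (u (S, T)) x * indicator (rel_interior T) x) + jump M X l S x"

definition form_b :: "'a::euclidean_space medium \<Rightarrow> 'a mesh \<Rightarrow> 'a flux \<Rightarrow> ('a cell \<Rightarrow> real) \<Rightarrow> real"
  where "form_b M X r q = - (\<Sum>S\<in>subdomains M. LINT x:S|flat_measure S.
    cell_fun X q S x * mixed_div M X (fst r + R_h M X (snd r)) (snd r) S x)"


section \<open>Operators between subspaces and their duals\<close>

text \<open>The dual of a (finite-dimensional) subspace \<open>V\<close>: linear functionals on \<open>V\<close>, extended by zero outside \<open>V\<close>
  so that they are equal iff they agree on \<open>V\<close>. The pairing of \<open>\<phi>\<close> with \<open>x\<close> is \<open>\<phi> x\<close>, and the dual of a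
  product is the product of the duals.\<close>

definition dual :: "'v::real_vector set \<Rightarrow> ('v \<Rightarrow> real) set"
  where "dual V = {\<phi>. (\<forall>x\<in>V. \<forall>y\<in>V. \<phi> (x + y) = \<phi> x + \<phi> y) \<and>
    (\<forall>c. \<forall>x\<in>V. \<phi> (c *\<^sub>R x) = c * \<phi> x) \<and> (\<forall>x. x \<notin> V \<longrightarrow> \<phi> x = 0)}"

definition spd_op :: "'v::real_vector set \<Rightarrow> (('v \<Rightarrow> real) \<Rightarrow> 'v) \<Rightarrow> bool"
  where "spd_op V H \<longleftrightarrow> H ` dual V \<subseteq> V \<and>
    (\<forall>\<phi>\<in>dual V. \<forall>\<psi>\<in>dual V. H (\<phi> + \<psi>) = H \<phi> + H \<psi>) \<and>
    (\<forall>c. \<forall>\<phi>\<in>dual V. H (c *\<^sub>R \<phi>) = c *\<^sub>R H \<phi>) \<and>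
    (\<forall>\<phi>\<in>dual V. \<forall>\<psi>\<in>dual V. \<phi> (H \<psi>) = \<psi> (H \<phi>)) \<and>
    (\<forall>\<phi>\<in>dual V. \<phi> \<noteq> 0 \<longrightarrow> \<phi> (H \<phi>) > 0)"

definition form_op :: "'v set \<Rightarrow> ('u \<Rightarrow> 'v \<Rightarrow> real) \<Rightarrow> 'u \<Rightarrow> 'v \<Rightarrow> real"
  where "form_op V a x = (\<lambda>y. if y \<in> V then a x y else 0)"

definition A_op :: "'a::euclidean_space medium \<Rightarrow> 'a mesh \<Rightarrow> 'a params \<Rightarrow> 'a flux \<Rightarrow> 'a flux \<Rightarrow> real"
  where "A_op M X P = form_op (Wh M X) (form_a M X P)"

definition DA_op :: "'a::euclidean_space medium \<Rightarrow> 'a mesh \<Rightarrow> 'a params \<Rightarrow> 'a flux \<Rightarrow> 'a flux \<Rightarrow> real"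
  where "DA_op M X P = form_op (Wh M X) (form_aD M X P)"

definition B_op :: "'a::euclidean_space medium \<Rightarrow> 'a mesh \<Rightarrow> 'a flux \<Rightarrow> ('a cell \<Rightarrow> real) \<Rightarrow> real"
  where "B_op M X = form_op (Qh M X) (form_b M X)"

definition BT_op :: "'a::euclidean_space medium \<Rightarrow> 'a mesh \<Rightarrow> ('a cell \<Rightarrow> real) \<Rightarrow> 'a flux \<Rightarrow> real"
  where "BT_op M X = form_op (Wh M X) (\<lambda>q r. form_b M X r q)"

definition A_inv :: "'a::euclidean_space medium \<Rightarrow> 'a mesh \<Rightarrow> 'a params \<Rightarrow> ('a flux \<Rightarrow> real) \<Rightarrow> 'a flux"
  where "A_inv M X P = inv_into (Wh M X) (A_op M X P)"

definition DA_inv :: "'a::euclidean_space medium \<Rightarrow> 'a mesh \<Rightarrow> 'a params \<Rightarrow> ('a flux \<Rightarrow> real) \<Rightarrow> 'a flux"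
  where "DA_inv M X P = inv_into (Wh M X) (DA_op M X P)"

definition Schur_inv ::
    "'a::euclidean_space medium \<Rightarrow> 'a mesh \<Rightarrow> 'a params \<Rightarrow> (('a cell \<Rightarrow> real) \<Rightarrow> real) \<Rightarrow> 'a cell \<Rightarrow> real"
  where "Schur_inv M X P = inv_into (Qh M X) (\<lambda>q. B_op M X (DA_inv M X P (BT_op M X q)))"

definition A_norm :: "'a::euclidean_space medium \<Rightarrow> 'a mesh \<Rightarrow> 'a params \<Rightarrow> 'a flux \<Rightarrow> real"
  where "A_norm M X P w = sqrt (A_op M X P w w)"

text \<open>The quotient is \<open>0\<close> for \<open>w = 0\<close>, as in \<^const>\<open>onorm\<close>.\<close>

definition A_onorm :: "'a::euclidean_space medium \<Rightarrow> 'a mesh \<Rightarrow> 'a params \<Rightarrow> ('a flux \<Rightarrow> 'a flux) \<Rightarrow> real"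
  where "A_onorm M X P E = (SUP w\<in>Wh M X. A_norm M X P (E w) / A_norm M X P w)"

type_synonym 'a state = "'a flux \<times> ('a cell \<Rightarrow> real)"
type_synonym 'a dstate = "('a flux \<Rightarrow> real) \<times> (('a cell \<Rightarrow> real) \<Rightarrow> real)"

definition calA :: "'a::euclidean_space medium \<Rightarrow> 'a mesh \<Rightarrow> 'a params \<Rightarrow> 'a state \<Rightarrow> 'a dstate"
  where "calA M X P x = (A_op M X P (fst x) + BT_op M X (snd x), - B_op M X (fst x))"

definition MU_inv :: "'a::euclidean_space medium \<Rightarrow> 'a mesh \<Rightarrow> (('a flux \<Rightarrow> real) \<Rightarrow> 'a flux) \<Rightarrow>
    ((('a cell \<Rightarrow> real) \<Rightarrow> real) \<Rightarrow> 'a cell \<Rightarrow> real) \<Rightarrow> 'a state \<Rightarrow> 'a dstate"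
  where "MU_inv M X Hw Hp x =
    (inv_into (dual (Wh M X)) Hw (fst x) + BT_op M X (snd x), inv_into (dual (Qh M X)) Hp (snd x))"

definition MU :: "'a::euclidean_space medium \<Rightarrow> 'a mesh \<Rightarrow> (('a flux \<Rightarrow> real) \<Rightarrow> 'a flux) \<Rightarrow>
    ((('a cell \<Rightarrow> real) \<Rightarrow> real) \<Rightarrow> 'a cell \<Rightarrow> real) \<Rightarrow> 'a dstate \<Rightarrow> 'a state"
  where "MU M X Hw Hp = inv_into (Wh M X \<times> Qh M X) (MU_inv M X Hw Hp)"

definition MD :: "(('a flux \<Rightarrow> real) \<Rightarrow> 'a flux) \<Rightarrow>
    ((('a cell \<Rightarrow> real) \<Rightarrow> real) \<Rightarrow> 'a cell \<Rightarrow> real) \<Rightarrow> 'a dstate \<Rightarrow> 'a state"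
  where "MD Hw Hp x' = (Hw (fst x'), Hp (snd x'))"

definition op_inner :: "('a dstate \<Rightarrow> 'a state) \<Rightarrow> 'a dstate \<Rightarrow> 'a dstate \<Rightarrow> real"
  where "op_inner N x' y' = fst x' (fst (N y')) + snd x' (snd (N y'))"

definition op_norm :: "('a dstate \<Rightarrow> 'a state) \<Rightarrow> 'a dstate \<Rightarrow> real"
  where "op_norm N x' = sqrt (op_inner N x' x')"

end

theory Submission
  imports Defs
begin

text \<open>The operators act on finite-dimensional spaces, and everything reduces to comparing a few quadratic
  quantities. Let \<open>x = (u, p)\<close> and \<open>g = B\<^sup>T p\<close>, so that \<open>x' = (Hw\<^sup>-\<^sup>1 u + g, Hp\<^sup>-\<^sup>1 p)\<close> and the preconditioned
  operator maps \<open>x'\<close> to \<open>(A u + g, - B u)\<close>. Put \<open>E = \<langle>A u, u\<rangle>\<close> and \<open>G = \<langle>g, Hw g\<rangle>\<close>. In the inner product of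
  the image with \<open>x'\<close> the two pairings of \<open>B u\<close> with \<open>p\<close> cancel, and what remains is
  \<open>E + \<langle>A u, Hw g\<rangle> + G\<close>. The contraction bound gives \<open>\<langle>A u, Hw A u\<rangle> \<le> (1 + \<rho>) E \<le> 2 E\<close>, whence by
  Cauchy--Schwarz the mixed term is at most \<open>3/4 (E + G)\<close> and the inner product is at least \<open>(E + G) / 4\<close>.

  It remains to see that the square of the norm of \<open>x'\<close> is equivalent to \<open>E + G\<close> and, up to a constant, bounds that of
  the image.
  The spectral equivalence of \<open>Hw\<close> with \<open>A\<^sup>-\<^sup>1\<close> handles the first components. For the second ones, \<open>Hp\<^sup>-\<^sup>1\<close>
  is equivalent to the Schur complement \<open>B D\<^sub>A\<^sup>-\<^sup>1 B\<^sup>T\<close>, whereas \<open>G\<close> is equivalent to \<open>\<langle>B A\<^sup>-\<^sup>1 B\<^sup>T p, p\<rangle>\<close>; the two match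
  because the form \<open>a\<close> and its diagonal version \<open>a\<^sup>D\<close> bound each other. The spectral equivalences
  themselves force \<open>A\<close> and the Schur complement to be bijective (\<open>A_surj\<close>, \<open>definite\<close>). This part is
  carried out for abstract forms in the locale \<open>saddle_point\<close> and ends in \<open>field_of_values\<close>.

  The equivalence of \<open>a\<close> and \<open>a\<^sup>D\<close> is local. On a simplex with \<open>m\<close> facets, \<open>a \<le> m a\<^sup>D\<close> is the Cauchy--Schwarz inequality
  for the expansion in the basis functions (\<open>mass_le_diagonal\<close>). Conversely (\<open>diagonal_le_mass\<close>), shape regularity bounds
  the basis functions by \<open>\<sigma>\<close>, and the flux through a facet is the value at a point of an affine function, whose
  square times the measure of the simplex is bounded by the integral of the square
  (\<open>affine_value_le_integral\<close>); the bounds on the permeability carry this over to the weighted integral, at the price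
  of the factor \<open>\<theta>\<close>. Hence the constants of the equivalence depend on the dimension, \<open>\<sigma>\<close> and \<open>\<theta>\<close> only.

  To apply the abstract result, the forms must be bilinear, and this rests on the discrete extension being
  linear, that is, uniquely determined (\<open>extends_unique\<close>, \<open>extends_exists\<close>). The relative interiors of the facets on one
  interface are disjoint (\<open>iface_facets_disjoint\<close>), so the normal traces are the functions which are constant
  on these facets, and the \<open>L\<^sup>2\<close>-projection takes the mean value on each of them.\<close>


section \<open>Forms and functionals on finite-dimensional subspaces\<close>

locale psd_form =
  fixes V :: "'v::real_vector set" and a :: "'v \<Rightarrow> 'v \<Rightarrow> real"
  assumes subspace_V: "subspace V"
    and sym: "x \<in> V \<Longrightarrow> y \<in> V \<Longrightarrow> a x y = a y x"
    and add_left: "x \<in> V \<Longrightarrow> y \<in> V \<Longrightarrow> z \<in> V \<Longrightarrow> a (x + y) z = a x z + a y z"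
    and scale_left: "x \<in> V \<Longrightarrow> y \<in> V \<Longrightarrow> a (c *\<^sub>R x) y = c * a x y"
    and nonneg: "x \<in> V \<Longrightarrow> 0 \<le> a x x"
begin

lemma V_simps [simp, intro]:
  "0 \<in> V" "x \<in> V \<Longrightarrow> y \<in> V \<Longrightarrow> x + y \<in> V" "x \<in> V \<Longrightarrow> c *\<^sub>R x \<in> V"
  "x \<in> V \<Longrightarrow> y \<in> V \<Longrightarrow> x - y \<in> V" "x \<in> V \<Longrightarrow> - x \<in> V"
  using subspace_V by (auto simp: subspace_0 subspace_add subspace_scale subspace_diff subspace_neg)

lemma add_right: "x \<in> V \<Longrightarrow> y \<in> V \<Longrightarrow> z \<in> V \<Longrightarrow> a z (x + y) = a z x + a z y"
  using add_left[of x y z] sym by auto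

lemma scale_right: "x \<in> V \<Longrightarrow> y \<in> V \<Longrightarrow> a y (c *\<^sub>R x) = c * a y x"
  using scale_left[of x y c] sym by auto

lemma zero_left: "x \<in> V \<Longrightarrow> a 0 x = 0"
  using scale_left[of x x 0] by simp

lemma minus_left: "x \<in> V \<Longrightarrow> y \<in> V \<Longrightarrow> a (- x) y = - a x y"
  using scale_left[of x y "-1"] by simp

lemma minus_right: "x \<in> V \<Longrightarrow> y \<in> V \<Longrightarrow> a y (- x) = - a y x"
  using scale_right[of x y "-1"] by simp

lemma diff_left: "x \<in> V \<Longrightarrow> y \<in> V \<Longrightarrow> z \<in> V \<Longrightarrow> a (x - y) z = a x z - a y z"
  using add_left[of x "- y" z] minus_left[of y z] by simp

lemma diff_right: "x \<in> V \<Longrightarrow> y \<in> V \<Longrightarrow> z \<in> V \<Longrightarrow> a z (x - y) = a z x - a z y"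
  using diff_left[of x y z] sym by auto

text \<open>The form may be degenerate, hence the case distinction: the discriminant argument needs \<open>a y y \<noteq> 0\<close>, and for
  \<open>a y y = 0\<close> the affine function \<open>t \<mapsto> a (x + t y) (x + t y)\<close> is bounded below only if its slope vanishes.\<close>

lemma Cauchy_Schwarz:
  assumes "x \<in> V" "y \<in> V"
  shows "(a x y)\<^sup>2 \<le> a x x * a y y"
proof -
  have q: "0 \<le> a x x - 2 * t * a x y + t\<^sup>2 * a y y" for t
  proof -
    have "0 \<le> a (x - t *\<^sub>R y) (x - t *\<^sub>R y)"
      using assms by (intro nonneg) auto
    also have "\<dots> = a x x - 2 * t * a x y + t\<^sup>2 * a y y"
      using assms sym[of y x]
      by (simp add: diff_left diff_right scale_left scale_right power2_eq_square algebra_simps)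
    finally show ?thesis .
  qed
  show ?thesis
  proof (cases "a y y = 0")
    case True
    have "a x y = 0"
    proof (rule ccontr)
      assume "a x y \<noteq> 0"
      then show False
        using q[of "(a x x + 1) / (2 * a x y)"] True by (simp add: field_simps)
    qed
    then show ?thesis using True by simp
  next
    case False
    then have pos: "a y y > 0" using nonneg[OF assms(2)] by simp
    then show ?thesis
      using q[of "a x y / a y y"] by (simp add: field_simps power2_eq_square)
  qed
qed

lemma add_self_le:
  assumes "x \<in> V" "y \<in> V"
  shows "a (x + y) (x + y) \<le> 2 * a x x + 2 * a y y"
proof -
  have "0 \<le> a (x - y) (x - y)" using assms by (intro nonneg) auto
  then show ?thesis
    using assms sym[of x y] by (simp add: add_left add_right diff_left diff_right)
qed

lemma form_op_in_dual: "x \<in> V \<Longrightarrow> form_op V a x \<in> dual V"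
  by (auto simp: form_op_def dual_def add_right scale_right)

lemma form_op_apply: "y \<in> V \<Longrightarrow> form_op V a x y = a x y"
  by (simp add: form_op_def)

lemma form_op_linear:
  "x \<in> V \<Longrightarrow> y \<in> V \<Longrightarrow> form_op V a (x + y) = form_op V a x + form_op V a y"
  "x \<in> V \<Longrightarrow> form_op V a (c *\<^sub>R x) = c *\<^sub>R form_op V a x"
  by (auto simp: form_op_def fun_eq_iff add_left scale_left scaleR_fun_def)

end

lemma subspace_dual: "subspace (dual V)"
  unfolding subspace_def dual_def by (auto simp: scaleR_fun_def algebra_simps)

lemma psd_form_spd_op:
  assumes "spd_op V H"
  shows "psd_form (dual V) (\<lambda>\<phi> \<psi>. \<phi> (H \<psi>))"
proof
  show "subspace (dual V)" by (rule subspace_dual)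
  fix x y z :: "'a \<Rightarrow> real" and c :: real
  assume "x \<in> dual V" "y \<in> dual V"
  then show "x (H y) = y (H x)" using assms by (simp add: spd_op_def)
  show "(x + y) (H z) = x (H z) + y (H z)" by simp
  show "(c *\<^sub>R x) (H y) = c * x (H y)" by (simp add: scaleR_fun_def)
next
  fix x assume "x \<in> dual V"
  then show "0 \<le> x (H x)" using assms unfolding spd_op_def
    by (metis less_eq_real_def zero_fun_def)
qed

text \<open>Dimension counting in a form that does not presuppose a finite-dimensional ambient type: the exchange
  lemma, applied to the image of a basis of \<open>V\<close>.\<close>

lemma injective_endomorphism_surjective:
  fixes f :: "'v::real_vector \<Rightarrow> 'v"
  assumes V: "subspace V" "V \<subseteq> span F" "finite F"
    and f: "f ` V \<subseteq> V"
    and add: "\<And>x y. x \<in> V \<Longrightarrow> y \<in> V \<Longrightarrow> f (x + y) = f x + f y"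
    and scale: "\<And>c x. x \<in> V \<Longrightarrow> f (c *\<^sub>R x) = c *\<^sub>R f x"
    and inj: "\<And>x. x \<in> V \<Longrightarrow> f x = 0 \<Longrightarrow> x = 0"
  shows "f ` V = V"
proof
  show "f ` V \<subseteq> V" by fact
  obtain B where B: "B \<subseteq> V" "independent B" "V \<subseteq> span B"
    using maximal_independent_subset by blast
  have finB: "finite B"
    using independent_span_bound[OF V(3) B(2)] B(1) V(2) by blast
  have VB: "V = span B"
    using B V(1) span_minimal by blast
  obtain g where g: "linear g" "\<And>x. x \<in> B \<Longrightarrow> g x = f x"
    using linear_independent_extend[OF B(2), of f] by blast
  have f0: "f 0 = 0" using scale[of 0 0] VB by (simp add: span_zero)
  have gf: "g x = f x" if "x \<in> V" for x
  proof -
    have "x \<in> span B" using that VB by simp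
    then have "x \<in> V \<and> g x = f x"
    proof (induction rule: span_induct_alt)
      case base then show ?case using f0 g(1) V(1) by (simp add: linear_0 subspace_0)
    next
      case (step c x y)
      then have "x \<in> V" "y \<in> V" using B(1) by auto
      then show ?case
        using step g add[of "c *\<^sub>R x" y] scale[of x c] V(1)
        by (simp add: linear_add linear_scale subspace_scale subspace_add)
    qed
    then show ?thesis by simp
  qed
  have injg: "inj_on g (span B)"
    using inj gf VB by (auto simp: linear_injective_on_subspace_0[OF g(1) subspace_span])
  have ind: "independent (g ` B)"
    using linear_independent_injective_image[OF g(1) B(2)] injg by blast
  have card: "card (g ` B) = card B"
    using injg by (meson card_image inj_on_subset span_superset)
  have "g ` B \<subseteq> span B" using gf f B(1) VB by fastforce
  from exchange_lemma[OF finB ind this] obtain T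
    where T: "card T = card B" "finite T" "g ` B \<subseteq> T" "T \<subseteq> g ` B \<union> B" "g ` B \<subseteq> span T"
    by blast
  have "B \<subseteq> span (g ` B)"
  proof
    fix x assume x: "x \<in> B"
    show "x \<in> span (g ` B)"
    proof (rule ccontr)
      assume nx: "x \<notin> span (g ` B)"
      then have "independent (insert x (g ` B))" "x \<notin> g ` B"
        using ind by (auto simp: independent_insert intro: span_base)
      moreover have "insert x (g ` B) \<subseteq> span B"
        using x \<open>g ` B \<subseteq> span B\<close> by (auto intro: span_base)
      ultimately have "card (insert x (g ` B)) \<le> card B"
        using independent_span_bound[OF finB] by blast
      then show False using card \<open>x \<notin> g ` B\<close> finB by simp
    qed
  qed
  then have "V \<subseteq> span (g ` B)" using VB by (simp add: span_minimal)
  also have "\<dots> = g ` span B" using g(1) linear_span_image by blast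
  also have "\<dots> = f ` V" using gf VB by auto
  finally show "V \<subseteq> f ` V" .
qed

section \<open>Spectrally equivalent preconditioners\<close>

text \<open>The finite set \<open>F\<close> only records that \<open>V\<close> has finite dimension; the ambient types are types of functions of
  infinite dimension.\<close>

locale preconditioned_form = psd_form V a for V :: "'v::real_vector set" and a +
  fixes H :: "('v \<Rightarrow> real) \<Rightarrow> 'v" and c1 c2 :: real and F :: "'v set"
  assumes finite_F: "finite F" and V_span: "V \<subseteq> span F"
    and spd: "spd_op V H" and c1: "c1 > 0" and c2: "c2 > 0"
    and spectral: "\<And>r. r \<in> dual V \<Longrightarrow>
      c1 * r (H r) \<le> r (inv_into V (form_op V a) r) \<and> r (inv_into V (form_op V a) r) \<le> c2 * r (H r)"
begin

abbreviation "A \<equiv> form_op V a"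

sublocale H: psd_form "dual V" "\<lambda>\<phi> \<psi>. \<phi> (H \<psi>)"
  by (rule psd_form_spd_op) (rule spd)

lemma H_in: "\<phi> \<in> dual V \<Longrightarrow> H \<phi> \<in> V"
  using spd by (auto simp: spd_op_def)

lemma H_pos: "\<phi> \<in> dual V \<Longrightarrow> \<phi> \<noteq> 0 \<Longrightarrow> \<phi> (H \<phi>) > 0"
  using spd by (auto simp: spd_op_def)

lemma H_add: "\<phi> \<in> dual V \<Longrightarrow> \<psi> \<in> dual V \<Longrightarrow> H (\<phi> + \<psi>) = H \<phi> + H \<psi>"
  and H_scale: "\<phi> \<in> dual V \<Longrightarrow> H (c *\<^sub>R \<phi>) = c *\<^sub>R H \<phi>"
  using spd by (auto simp: spd_op_def)

text \<open>The spectral equivalence alone forces \<open>A\<close> to be onto: \<^const>\<open>inv_into\<close> sends all functionals outside the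
  range to one and the same default value, which cannot pair positively with both \<open>r\<close> and \<open>- r\<close>.\<close>

lemma A_surj:
  assumes r: "r \<in> dual V"
  shows "r \<in> A ` V"
proof (rule ccontr)
  assume nr: "r \<notin> A ` V"
  have nr': "- r \<notin> A ` V"
  proof
    assume "- r \<in> A ` V"
    then obtain w where w: "w \<in> V" "- r = A w" by blast
    have "A (- w) = - A w" using form_op_linear(2)[OF w(1), of "-1"] by simp
    also have "\<dots> = r" unfolding w(2)[symmetric] by simp
    finally have "r = A (- w)" by simp
    then show False using nr w(1) V_simps(5) by blast
  qed
  have same: "inv_into V A (- r) = inv_into V A r"
  proof -
    have "(\<lambda>y. y \<in> V \<and> A y = r) = (\<lambda>y. y \<in> V \<and> A y = - r)"
      using nr nr' by (intro ext) (metis imageI)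
    then show ?thesis by (simp add: inv_into_def)
  qed
  have "A 0 = 0" using form_op_linear(2)[of 0 0] by simp
  then have "r \<noteq> 0" using nr V_simps(1) by force
  moreover have r': "- r \<in> dual V" using r by auto
  ultimately have "0 < c1 * r (H r)" "0 < c1 * (- r) (H (- r))"
    using H_pos[OF r] H_pos[OF r'] c1 by (simp_all only: mult_pos_pos neg_equal_0_iff_equal not_False_eq_True)
  then show False using spectral[OF r] spectral[OF r'] same by auto
qed

text \<open>A vector \<open>w\<close> in the kernel of the form would be annihilated by all of \<open>A ` V = dual V\<close>, but some functional takes the value
  \<open>1\<close> at \<open>w\<close> if \<open>w \<noteq> 0\<close>.\<close>

lemma definite:
  assumes w: "w \<in> V" and 0: "a w w = 0"
  shows "w = 0"
proof (rule ccontr)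
  assume "w \<noteq> 0"
  then have "independent {w}" by simp
  from linear_independent_extend[OF this, of "\<lambda>_. 1::real"]
  obtain g :: "'v \<Rightarrow> real" where g: "linear g" "g w = 1" by auto
  define r where "r = (\<lambda>x. if x \<in> V then g x else 0)"
  have "r \<in> dual V" using g(1) by (auto simp: r_def dual_def linear_add linear_scale)
  then obtain u where u: "u \<in> V" "r = A u" using A_surj by blast
  have "(a u w)\<^sup>2 \<le> 0" using Cauchy_Schwarz[OF u(1) w] 0 by simp
  then have "r w = 0" using u w by (simp add: form_op_apply)
  then show False using g(2) w by (simp add: r_def)
qed

lemma A_inj: "inj_on A V"
proof (rule inj_onI)
  fix x y assume xy: "x \<in> V" "y \<in> V" "A x = A y"
  have "a x (x - y) = a y (x - y)"
    using fun_cong[OF xy(3), of "x - y"] xy(1,2) by (simp only: form_op_apply V_simps)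
  then have "a (x - y) (x - y) = 0"
    using xy by (simp add: diff_left)
  then show "x = y" using definite[of "x - y"] xy by simp
qed

lemma A_inverse:
  assumes "r \<in> dual V"
  obtains u where "u \<in> V" "r = A u" "inv_into V A r = u"
  using A_surj[OF assms] inv_into_f_f[OF A_inj] by blast

lemma H_zero_imp: "\<phi> \<in> dual V \<Longrightarrow> H \<phi> = 0 \<Longrightarrow> \<phi> = 0"
proof (rule ccontr)
  assume *: "\<phi> \<in> dual V" "H \<phi> = 0" "\<phi> \<noteq> 0"
  have "\<phi> 0 = 0" using *(1) unfolding dual_def
    by (metis (mono_tags, lifting) V_simps(1) mem_Collect_eq mult_zero_left scale_zero_left)
  then show False using H_pos[OF *(1,3)] *(2) by simp
qed

lemma H_inj: "inj_on H (dual V)"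
proof (rule inj_onI)
  fix x y assume xy: "x \<in> dual V" "y \<in> dual V" "H x = H y"
  have "H (x + (-1) *\<^sub>R y) = 0"
    using xy H_add[of x "(-1) *\<^sub>R y"] H_scale[of y "-1"] subspace_scale[OF subspace_dual, of y V "-1"]
    by simp
  then have "x + (-1) *\<^sub>R y = 0"
    using xy by (intro H_zero_imp H.V_simps) auto
  then show "x = y" by simp
qed

text \<open>\<open>H \<circ> A\<close> is an injective endomorphism of \<open>V\<close>, so the range of \<open>H\<close> is all of \<open>V\<close>.\<close>

lemma H_surj:
  assumes "w \<in> V"
  shows "\<exists>\<phi>\<in>dual V. H \<phi> = w"
proof -
  have "(\<lambda>w. H (A w)) ` V = V"
  proof (rule injective_endomorphism_surjective[OF subspace_V V_span finite_F])
    show "(\<lambda>w. H (A w)) ` V \<subseteq> V" using H_in form_op_in_dual by auto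
    show "H (A (x + y)) = H (A x) + H (A y)" if "x \<in> V" "y \<in> V" for x y
      using that by (simp add: form_op_linear H_add form_op_in_dual)
    show "H (A (c *\<^sub>R x)) = c *\<^sub>R H (A x)" if "x \<in> V" for x c
      using that by (simp add: form_op_linear H_scale form_op_in_dual)
    show "x = 0" if x: "x \<in> V" "H (A x) = 0" for x
    proof -
      have "A x = 0" using x H_zero_imp form_op_in_dual by blast
      then have "a x x = 0" using x(1) by (metis form_op_apply zero_fun_def)
      then show ?thesis using definite x by blast
    qed
  qed
  then show ?thesis using assms form_op_in_dual by (metis (no_types, lifting) imageE)
qed

definition Hi :: "'v \<Rightarrow> 'v \<Rightarrow> real"
  where "Hi = inv_into (dual V) H"

lemma Hi_in: "w \<in> V \<Longrightarrow> Hi w \<in> dual V" and H_Hi: "w \<in> V \<Longrightarrow> H (Hi w) = w"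
  unfolding Hi_def using H_surj[of w]
    inv_into_into[of w H "dual V"] f_inv_into_f[of w H "dual V"] by blast+

lemma Hi_nonneg: "w \<in> V \<Longrightarrow> 0 \<le> Hi w w"
  using H.nonneg[OF Hi_in] H_Hi by force

text \<open>The spectral bounds, stated for \<open>A\<^sup>-\<^sup>1\<close> against \<open>H\<close>, turned into bounds for \<open>A\<close> against \<open>H\<^sup>-\<^sup>1\<close>
  (each by one use of Cauchy--Schwarz) and into bounds on the range of \<open>A\<close>.\<close>

lemma Hi_le:
  assumes w: "w \<in> V"
  shows "Hi w w \<le> c2 * a w w"
proof -
  \<comment> \<open>with \<open>v = A\<^sup>-\<^sup>1 H\<^sup>-\<^sup>1 w\<close> the left-hand side is \<open>a v w\<close>\<close>
  obtain v where v: "v \<in> V" "Hi w = A v" "inv_into V A (Hi w) = v"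
    by (rule A_inverse[OF Hi_in[OF w]])
  have "a v v \<le> c2 * Hi w w"
    using spectral[OF Hi_in[OF w]] v H_Hi[OF w] by (simp add: form_op_apply)
  then have "(a v w)\<^sup>2 \<le> c2 * Hi w w * a w w"
    using Cauchy_Schwarz[OF v(1) w] mult_right_mono[OF _ nonneg[OF w]] by force
  moreover have "a v w = Hi w w" using v w by (simp add: form_op_apply)
  ultimately have *: "Hi w w * Hi w w \<le> Hi w w * (c2 * a w w)"
    by (simp add: power2_eq_square ac_simps)
  show ?thesis
  proof (cases "Hi w w = 0")
    case True then show ?thesis using c2 nonneg[OF w] by simp
  next
    case False
    then have "Hi w w > 0" using Hi_nonneg[OF w] by simp
    then show ?thesis using * mult_le_cancel_left_pos by blast
  qed
qed

lemma A_H_le: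
  assumes w: "w \<in> V"
  shows "c1 * A w (H (A w)) \<le> a w w"
proof -
  have "inv_into V A (A w) = w" using w A_inj by simp
  then show "c1 * A w (H (A w)) \<le> a w w"
    using spectral[OF form_op_in_dual[OF w]] w by (simp add: form_op_apply)
qed

lemma le_Hi:
  assumes w: "w \<in> V"
  shows "c1 * a w w \<le> Hi w w"
proof -
  have "(A w (H (Hi w)))\<^sup>2 \<le> A w (H (A w)) * Hi w (H (Hi w))"
    using H.Cauchy_Schwarz[OF form_op_in_dual[OF w] Hi_in[OF w]] .
  then have "(a w w)\<^sup>2 \<le> A w (H (A w)) * Hi w w"
    using w by (simp add: H_Hi form_op_apply)
  then have "c1 * (a w w)\<^sup>2 \<le> c1 * A w (H (A w)) * Hi w w" using c1 by simp
  also have "\<dots> \<le> a w w * Hi w w"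
    using A_H_le[OF w] Hi_nonneg[OF w] by (simp add: mult_right_mono)
  finally have *: "a w w * (c1 * a w w) \<le> a w w * Hi w w"
    by (simp add: power2_eq_square ac_simps)
  show ?thesis
  proof (cases "a w w = 0")
    case True then show ?thesis using Hi_nonneg[OF w] by simp
  next
    case False
    then have "a w w > 0" using nonneg[OF w] by simp
    then show ?thesis using * mult_le_cancel_left_pos by blast
  qed
qed

text \<open>The supremum bounds each single quotient because the quotients are bounded, which follows from the lower
  spectral bound. Then \<open>\<langle>A w, H A w\<rangle> = a w w - a w (w - H A w)\<close>, and Cauchy--Schwarz estimates the last term by \<open>\<rho> a w w\<close>.\<close>

lemma A_H_le_of_contraction:
  assumes \<rho>: "(SUP w\<in>V. sqrt (A (w - H (A w)) (w - H (A w))) / sqrt (A w w)) \<le> \<rho>" and w: "w \<in> V"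
  shows "A w (H (A w)) \<le> (1 + \<rho>) * a w w"
proof -
  let ?E = "\<lambda>w. w - H (A w)"
  have E: "?E v \<in> V" if "v \<in> V" for v using that H_in form_op_in_dual by auto
  define K where "K = 2 + 2 / c1\<^sup>2"
  have bound: "a (?E v) (?E v) \<le> K * a v v" if v: "v \<in> V" for v
  proof -
    let ?y = "H (A v)"
    have y: "?y \<in> V" using v H_in form_op_in_dual by auto
    have "Hi ?y = A v" using H_inj v by (simp add: Hi_def form_op_in_dual)
    then have "c1 * a ?y ?y \<le> A v ?y" using le_Hi[OF y] by simp
    then have "c1\<^sup>2 * a ?y ?y \<le> c1 * A v ?y" using c1 by (simp add: power2_eq_square)
    also have "\<dots> \<le> a v v" using A_H_le[OF v] .
    finally have "a ?y ?y \<le> a v v / c1\<^sup>2" using c1 by (simp add: field_simps)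
    moreover have "a (?E v) (?E v) \<le> 2 * a v v + 2 * a ?y ?y"
      using add_self_le[of v "- ?y"] v y by (simp add: minus_left minus_right)
    ultimately show ?thesis by (simp add: K_def algebra_simps)
  qed
  have quot: "sqrt (A (?E v) (?E v)) / sqrt (A v v) \<le> sqrt K" if v: "v \<in> V" for v
  proof (cases "a v v = 0")
    case True then show ?thesis using v by (simp add: form_op_apply K_def add_nonneg_nonneg)
  next
    case False
    then have "a v v > 0" using nonneg[OF v] by simp
    moreover have "sqrt (a (?E v) (?E v)) \<le> sqrt K * sqrt (a v v)"
      using bound[OF v] by (metis real_sqrt_le_iff real_sqrt_mult)
    ultimately show ?thesis using v E[OF v] by (simp add: form_op_apply field_simps)
  qed
  have "sqrt (A (?E w) (?E w)) / sqrt (A w w) \<le> \<rho>"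
    using quot w by (intro order_trans[OF cSUP_upper \<rho>]) (auto intro!: bdd_aboveI2)
  then have Q: "sqrt (a (?E w) (?E w)) \<le> \<rho> * sqrt (a w w)"
  proof (cases "a w w = 0")
    case True
    then have "a (?E w) (?E w) \<le> 0" using bound[OF w] by simp
    then show ?thesis using nonneg[OF E[OF w]] True by simp
  next
    case False
    then have "a w w > 0" using nonneg[OF w] by simp
    then show ?thesis
      using \<open>sqrt (A (?E w) (?E w)) / sqrt (A w w) \<le> \<rho>\<close> w E[OF w] by (simp add: form_op_apply field_simps)
  qed
  have "\<bar>a w (?E w)\<bar> \<le> sqrt (a w w * a (?E w) (?E w))"
    using Cauchy_Schwarz[OF w E[OF w]] by (metis real_sqrt_abs real_sqrt_le_iff)
  also have "\<dots> = sqrt (a w w) * sqrt (a (?E w) (?E w))" by (simp add: real_sqrt_mult)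
  also have "\<dots> \<le> sqrt (a w w) * (\<rho> * sqrt (a w w))" using Q nonneg[OF w] by (simp add: mult_left_mono)
  also have "\<dots> = \<rho> * a w w" using nonneg[OF w] by simp
  finally have "- (\<rho> * a w w) \<le> a w (?E w)" by linarith
  moreover have "A w (H (A w)) = a w w - a w (?E w)"
    using w H_in form_op_in_dual by (simp add: diff_right form_op_apply)
  ultimately show ?thesis by (simp add: algebra_simps)
qed

end

section \<open>The preconditioned saddle point operator\<close>

lemma le_of_power2_le_mult:
  fixes t y :: real
  assumes "t\<^sup>2 \<le> t * y" "0 \<le> y"
  shows "t \<le> y"
proof (cases "t > 0")
  case True
  then show ?thesis using assms(1) by (simp add: power2_eq_square)
qed (use assms in linarith)

lemma dual_add: "\<phi> \<in> dual V \<Longrightarrow> x \<in> V \<Longrightarrow> y \<in> V \<Longrightarrow> \<phi> (x + y) = \<phi> x + \<phi> y"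
  by (simp add: dual_def)

context preconditioned_form
begin

text \<open>Like \<open>H \<circ> A\<close>, the map \<open>H \<circ> D\<close> is an injective endomorphism of \<open>V\<close>.\<close>

lemma definite_form_bij:
  assumes "psd_form V d" and def: "\<And>x. x \<in> V \<Longrightarrow> d x x = 0 \<Longrightarrow> x = 0"
  shows "bij_betw (form_op V d) V (dual V)"
proof -
  interpret d: psd_form V d by fact
  let ?D = "form_op V d"
  have D_zero: "x = 0" if x: "x \<in> V" "?D x = 0" for x
  proof -
    have "d x x = 0" using x by (metis d.form_op_apply zero_fun_def)
    then show ?thesis using def x by blast
  qed
  have "(\<lambda>w. H (?D w)) ` V = V"
  proof (rule injective_endomorphism_surjective[OF subspace_V V_span finite_F])
    show "(\<lambda>w. H (?D w)) ` V \<subseteq> V" using H_in d.form_op_in_dual by auto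
    show "H (?D (x + y)) = H (?D x) + H (?D y)" if "x \<in> V" "y \<in> V" for x y
      using that by (simp add: d.form_op_linear H_add d.form_op_in_dual)
    show "H (?D (c *\<^sub>R x)) = c *\<^sub>R H (?D x)" if "x \<in> V" for x c
      using that by (simp add: d.form_op_linear H_scale d.form_op_in_dual)
    show "x = 0" if "x \<in> V" "H (?D x) = 0" for x
      using that D_zero H_zero_imp d.form_op_in_dual by blast
  qed
  then have HDV: "H \<phi> \<in> (\<lambda>w. H (?D w)) ` V" if "\<phi> \<in> dual V" for \<phi>
    using H_in that by simp
  have "?D ` V = dual V"
  proof
    show "dual V \<subseteq> ?D ` V"
    proof
      fix \<phi> assume \<phi>: "\<phi> \<in> dual V"
      then obtain w where "w \<in> V" "H \<phi> = H (?D w)" using HDV by blast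
      then show "\<phi> \<in> ?D ` V"
        using H_inj \<phi> d.form_op_in_dual by (metis image_eqI inj_onD)
    qed
  qed (use d.form_op_in_dual in blast)
  moreover have "inj_on ?D V"
  proof (rule inj_onI)
    fix x y assume xy: "x \<in> V" "y \<in> V" "?D x = ?D y"
    have "?D (x + (-1) *\<^sub>R y) = 0"
      using xy d.form_op_linear(1)[of x "(-1) *\<^sub>R y"] d.form_op_linear(2)[of y "-1"] V_simps(3)[of y "-1"]
      by simp
    then have "x + (-1) *\<^sub>R y = 0" using xy by (intro D_zero) auto
    then show "x = y" by simp
  qed
  ultimately show ?thesis by (simp add: bij_betw_def)
qed

end

text \<open>The form \<open>d\<close> replaces \<open>a\<close> in the Schur complement; the preconditioner \<open>Hp\<close> is tied to \<open>d\<close>, while \<open>Hw\<close> is tied to \<open>a\<close>.\<close>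

locale saddle_point =
  w: preconditioned_form V a Hw c1w c2w FV + d: psd_form V d
  for V :: "'v::real_vector set" and a Hw c1w c2w FV d +
  fixes Q :: "'q::real_vector set" and b :: "'v \<Rightarrow> 'q \<Rightarrow> real" and C1 C2 :: real
    and Hp c1p c2p FQ \<rho>
  assumes subspace_Q: "subspace Q" and finite_FQ: "finite FQ" and Q_span: "Q \<subseteq> span FQ"
    and b_add_left: "x \<in> V \<Longrightarrow> y \<in> V \<Longrightarrow> q \<in> Q \<Longrightarrow> b (x + y) q = b x q + b y q"
    and b_scale_left: "x \<in> V \<Longrightarrow> q \<in> Q \<Longrightarrow> b (c *\<^sub>R x) q = c * b x q"
    and b_add_right: "x \<in> V \<Longrightarrow> q \<in> Q \<Longrightarrow> p \<in> Q \<Longrightarrow> b x (q + p) = b x q + b x p"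
    and b_scale_right: "x \<in> V \<Longrightarrow> q \<in> Q \<Longrightarrow> b x (c *\<^sub>R q) = c * b x q"
    and C1: "C1 > 0" and a_le_d: "x \<in> V \<Longrightarrow> a x x \<le> C1 * d x x"
    and C2: "C2 > 0" and d_le_a: "x \<in> V \<Longrightarrow> d x x \<le> C2 * a x x"
    and spd_p: "spd_op Q Hp" and c1p: "c1p > 0" and c2p: "c2p > 0"
    and spectral_p: "\<And>r. r \<in> dual Q \<Longrightarrow>
      c1p * r (Hp r) \<le> r (inv_into Q (\<lambda>q. form_op Q b (inv_into V (form_op V d) (form_op V (\<lambda>q r. b r q) q))) r) \<and>
      r (inv_into Q (\<lambda>q. form_op Q b (inv_into V (form_op V d) (form_op V (\<lambda>q r. b r q) q))) r) \<le> c2p * r (Hp r)"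
    and contraction: "(SUP u\<in>V. sqrt (form_op V a (u - Hw (form_op V a u)) (u - Hw (form_op V a u))) /
      sqrt (form_op V a u u)) \<le> \<rho>"
    and \<rho>: "\<rho> \<le> 1"
begin

abbreviation "A \<equiv> form_op V a"
abbreviation "D \<equiv> form_op V d"
abbreviation "B \<equiv> form_op Q b"
abbreviation "BT \<equiv> form_op V (\<lambda>q r. b r q)"

definition Di :: "('v \<Rightarrow> real) \<Rightarrow> 'v"
  where "Di = inv_into V D"

lemma D_bij: "bij_betw D V (dual V)"
proof (rule w.definite_form_bij)
  show "psd_form V d" by (rule d.psd_form_axioms)
  fix x assume x: "x \<in> V" "d x x = 0"
  then have "a x x = 0" using a_le_d[of x] w.nonneg[of x] by simp
  then show "x = 0" using w.definite x by blast
qed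

lemma Di_in: "r \<in> dual V \<Longrightarrow> Di r \<in> V" and d_Di: "r \<in> dual V \<Longrightarrow> v \<in> V \<Longrightarrow> d (Di r) v = r v"
proof -
  assume r: "r \<in> dual V"
  then have img: "r \<in> D ` V" using D_bij by (simp add: bij_betw_def)
  then show "Di r \<in> V" unfolding Di_def by (rule inv_into_into)
  have "D (Di r) = r" unfolding Di_def using img by (rule f_inv_into_f)
  then show "d (Di r) v = r v" if "v \<in> V" using that by (metis d.form_op_apply)
qed

lemma BT_in: "q \<in> Q \<Longrightarrow> BT q \<in> dual V"
  by (auto simp: form_op_def dual_def b_add_left b_scale_left)

lemma BT_apply: "x \<in> V \<Longrightarrow> BT q x = b x q"
  by (simp add: form_op_def)

lemma B_in: "x \<in> V \<Longrightarrow> B x \<in> dual Q"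
  using subspace_Q
  by (auto simp: form_op_def dual_def b_add_right b_scale_right subspace_add subspace_scale)

definition schur :: "'q \<Rightarrow> 'q \<Rightarrow> real"
  where "schur q p = b (Di (BT q)) p"

text \<open>The symmetry of the Schur complement is visible in this form.\<close>

lemma schur_eq: "q \<in> Q \<Longrightarrow> p \<in> Q \<Longrightarrow> schur q p = d (Di (BT p)) (Di (BT q))"
  by (simp add: schur_def d_Di Di_in BT_in BT_apply)

lemma schur_sym: "q \<in> Q \<Longrightarrow> p \<in> Q \<Longrightarrow> schur q p = schur p q"
  by (simp add: schur_eq d.sym Di_in BT_in)

lemma psd_schur: "psd_form Q schur"
proof
  show "subspace Q" by (rule subspace_Q)
  fix x y z :: 'q and c :: real
  assume x: "x \<in> Q" and y: "y \<in> Q"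
  show "schur x y = schur y x" using schur_sym x y .
  have "c *\<^sub>R x \<in> Q" using x subspace_Q by (rule_tac subspace_scale)
  then show "schur (c *\<^sub>R x) y = c * schur x y"
    using x y by (simp add: schur_sym[of _ y]) (simp add: schur_def b_scale_right Di_in BT_in)
  assume z: "z \<in> Q"
  have "x + y \<in> Q" using x y subspace_Q by (rule_tac subspace_add)
  then show "schur (x + y) z = schur x z + schur y z"
    using x y z by (simp add: schur_sym[of _ z]) (simp add: schur_def b_add_right Di_in BT_in)
next
  fix x assume "x \<in> Q"
  then show "0 \<le> schur x x" by (simp add: schur_eq d.nonneg Di_in BT_in)
qed

lemma form_op_schur: "form_op Q schur = (\<lambda>q. B (inv_into V D (BT q)))"
  by (simp add: form_op_def schur_def Di_def fun_eq_iff)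

sublocale p: preconditioned_form Q schur Hp c1p c2p FQ
proof (intro preconditioned_form.intro preconditioned_form_axioms.intro psd_schur)
  show "c1p * r (Hp r) \<le> r (inv_into Q (form_op Q schur) r) \<and> r (inv_into Q (form_op Q schur) r) \<le> c2p * r (Hp r)"
    if "r \<in> dual Q" for r
    using spectral_p[OF that] by (simp add: form_op_schur)
qed (use finite_FQ Q_span spd_p c1p c2p in auto)

text \<open>The two norms of \<open>B\<^sup>T p\<close>, dual to \<open>A\<close> and to \<open>D\<close>, are compared by duality: an inequality between
  the forms gives the reverse inequality between the dual norms.\<close>

lemma schur_le_BT:
  assumes p: "p \<in> Q"
  shows "schur p p \<le> C1 * c2w * BT p (Hw (BT p))"
proof -
  let ?g = "BT p"
  have g: "?g \<in> dual V" by (rule BT_in) (rule p)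
  obtain u where u: "u \<in> V" "?g = A u" "inv_into V A ?g = u" by (rule w.A_inverse[OF g])
  let ?v = "Di ?g"
  have v: "?v \<in> V" using Di_in g .
  have s: "schur p p = d ?v ?v" using schur_eq p by blast
  have "d ?v ?v = ?g ?v" using d_Di g v by blast
  also have "\<dots> = a u ?v" using u(2) v by (simp add: w.form_op_apply)
  finally have dv: "d ?v ?v = a u ?v" .
  have "(d ?v ?v)\<^sup>2 \<le> a u u * a ?v ?v" unfolding dv by (rule w.Cauchy_Schwarz[OF u(1) v])
  also have "\<dots> \<le> a u u * (C1 * d ?v ?v)" using a_le_d v w.nonneg u(1) by (simp add: mult_left_mono)
  finally have "(d ?v ?v)\<^sup>2 \<le> d ?v ?v * (C1 * a u u)" by (simp add: ac_simps)
  then have "d ?v ?v \<le> C1 * a u u"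
    using C1 w.nonneg[OF u(1)] by (rule_tac le_of_power2_le_mult) auto
  also have "a u u = ?g (inv_into V A ?g)" using u by (simp add: w.form_op_apply)
  also have "C1 * \<dots> \<le> C1 * (c2w * ?g (Hw ?g))"
    using w.spectral[OF g] C1 by (intro mult_left_mono) auto
  finally show ?thesis using s by simp
qed

lemma BT_le_schur:
  assumes p: "p \<in> Q"
  shows "c1w * BT p (Hw (BT p)) \<le> C2 * schur p p"
proof -
  let ?g = "BT p"
  have g: "?g \<in> dual V" by (rule BT_in) (rule p)
  obtain u where u: "u \<in> V" "?g = A u" "inv_into V A ?g = u" by (rule w.A_inverse[OF g])
  let ?v = "Di ?g"
  have v: "?v \<in> V" using Di_in g .
  have au: "a u u = d ?v u" using u d_Di[OF g u(1)] by (metis w.form_op_apply)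
  have "(a u u)\<^sup>2 \<le> d ?v ?v * d u u" unfolding au by (rule d.Cauchy_Schwarz[OF v u(1)])
  also have "\<dots> \<le> d ?v ?v * (C2 * a u u)" using d_le_a d.nonneg v u(1) by (simp add: mult_left_mono)
  finally have "(a u u)\<^sup>2 \<le> a u u * (C2 * d ?v ?v)" by (simp add: ac_simps)
  then have "a u u \<le> C2 * d ?v ?v"
    using C2 d.nonneg[OF v] by (rule_tac le_of_power2_le_mult) auto
  moreover have "c1w * ?g (Hw ?g) \<le> a u u"
    using w.spectral[OF g] u by (simp add: w.form_op_apply)
  ultimately show ?thesis using schur_eq p by simp
qed

text \<open>Write \<open>B u\<close> as the Schur complement of some \<open>q\<close>. Then the energy of \<open>q\<close> is the \<open>d\<close>-product of \<open>D\<^sup>-\<^sup>1 B\<^sup>T q\<close> with \<open>u\<close>,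
  so by Cauchy--Schwarz it is at most the energy of \<open>u\<close>.\<close>

lemma B_bound:
  assumes u: "u \<in> V"
  shows "c1p * B u (Hp (B u)) \<le> C2 * a u u"
proof -
  have \<beta>: "B u \<in> dual Q" using B_in u .
  obtain q where q: "q \<in> Q" "B u = form_op Q schur q" "inv_into Q (form_op Q schur) (B u) = q"
    by (rule p.A_inverse[OF \<beta>])
  have s: "schur q q = b u q" using q by (metis form_op_def)
  also have "\<dots> = d (Di (BT q)) u" using u q d_Di[OF BT_in[OF q(1)] u] by (simp add: BT_apply)
  finally have "(schur q q)\<^sup>2 \<le> d (Di (BT q)) (Di (BT q)) * d u u"
    using d.Cauchy_Schwarz[OF Di_in[OF BT_in[OF q(1)]] u] by simp
  then have "schur q q \<le> d u u"
    using d.nonneg[OF u] q(1) by (rule_tac le_of_power2_le_mult) (simp_all add: schur_eq)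
  moreover have "c1p * B u (Hp (B u)) \<le> schur q q"
    using p.spectral[OF \<beta>, unfolded q(3)] q(1) s by (simp add: form_op_def[of Q b])
  ultimately show ?thesis using d_le_a[OF u] by simp
qed

text \<open>With \<open>E = a u u\<close> and \<open>G\<close> the squared \<open>Hw\<close>-norm of \<open>B\<^sup>T p\<close>, the denominator is bounded above and below
  and the numerators are bounded on the side in question by multiples of \<open>E + G\<close>. In the first numerator the two pairings of \<open>B u\<close> with \<open>p\<close> cancel, and only
  \<open>\<langle>A u, Hw B\<^sup>T p\<rangle>\<close> has no sign; its square is at most \<open>(1 + \<rho>) E G \<le> 2 E G\<close>, so that it
  is absorbed by \<open>E + G\<close>.\<close>

lemma numerator_lower:
  assumes u: "u \<in> V" and p: "p \<in> Q"
  shows "(a u u + BT p (Hw (BT p))) / 4 \<le>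
    (A u + BT p) (Hw (w.Hi u + BT p)) + (- B u) (Hp (p.Hi p))"
proof -
  let ?g = "BT p" and ?E = "a u u" and ?G = "BT p (Hw (BT p))"
  have g: "?g \<in> dual V" by (rule BT_in) (rule p)
  have Au: "A u \<in> dual V" using w.form_op_in_dual u .
  have E: "0 \<le> ?E" using w.nonneg u by blast
  have G: "0 \<le> ?G" using w.H.nonneg g by blast
  have "Hw (w.Hi u + ?g) = u + Hw ?g"
    using w.H_add[OF w.Hi_in[OF u] g] w.H_Hi[OF u] by simp
  then have "(A u + ?g) (Hw (w.Hi u + ?g)) = A u (u + Hw ?g) + ?g (u + Hw ?g)" by simp
  also have "\<dots> = ?E + A u (Hw ?g) + b u p + ?g (Hw ?g)"
  proof -
    have "A u (u + Hw ?g) = A u u + A u (Hw ?g)" "?g (u + Hw ?g) = ?g u + ?g (Hw ?g)"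
      using dual_add[OF Au u w.H_in[OF g]] dual_add[OF g u w.H_in[OF g]] by auto
    then show ?thesis using u by (simp add: w.form_op_apply BT_apply)
  qed
  moreover have "(- B u) (Hp (p.Hi p)) = - b u p" using p by (simp add: p.H_Hi form_op_def)
  ultimately have eq: "(A u + ?g) (Hw (w.Hi u + ?g)) + (- B u) (Hp (p.Hi p)) = ?E + A u (Hw ?g) + ?G"
    by simp
  have "(A u (Hw ?g))\<^sup>2 \<le> A u (Hw (A u)) * ?G" using w.H.Cauchy_Schwarz[OF Au g] .
  also have "\<dots> \<le> ((1 + \<rho>) * ?E) * ?G"
    using w.A_H_le_of_contraction[OF contraction u] G by (rule mult_right_mono)
  also have "\<dots> \<le> (2 * ?E) * ?G" using E G \<rho> by (intro mult_right_mono) auto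
  also have "\<dots> \<le> ((?E + ?G) * 3 / 4)\<^sup>2"
  proof -
    have "((?E + ?G) * 3 / 4)\<^sup>2 - (2 * ?E) * ?G = 9 / 16 * (?E - ?G)\<^sup>2 + ?E * ?G / 4"
      by (simp add: power2_eq_square field_simps)
    moreover have "0 \<le> 9 / 16 * (?E - ?G)\<^sup>2 + ?E * ?G / 4" using E G by simp
    ultimately show ?thesis by linarith
  qed
  finally have "\<bar>A u (Hw ?g)\<bar> \<le> (?E + ?G) * 3 / 4"
    using E G by (simp add: abs_le_square_iff[symmetric])
  then have "- A u (Hw ?g) \<le> (?E + ?G) * 3 / 4" by (rule abs_le_D2)
  then show ?thesis unfolding eq by (simp add: field_simps)
qed

lemma numerator_upper:
  assumes u: "u \<in> V" and p: "p \<in> Q"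
  shows "(A u + BT p) (Hw (A u + BT p)) + (- B u) (Hp (- B u)) \<le>
    (4 + C2 / c1p) * (a u u + BT p (Hw (BT p)))"
proof -
  let ?g = "BT p" and ?E = "a u u" and ?G = "BT p (Hw (BT p))"
  have g: "?g \<in> dual V" by (rule BT_in) (rule p)
  have Au: "A u \<in> dual V" using w.form_op_in_dual u .
  have E: "0 \<le> ?E" using w.nonneg u by blast
  have G: "0 \<le> ?G" using w.H.nonneg g by blast
  have "(A u + ?g) (Hw (A u + ?g)) \<le> 2 * A u (Hw (A u)) + 2 * ?G"
    using w.H.add_self_le[OF Au g] .
  moreover have "A u (Hw (A u)) \<le> 2 * ?E"
    using w.A_H_le_of_contraction[OF contraction u] mult_right_mono[of "1 + \<rho>" 2 ?E] E \<rho> by linarith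
  moreover have "(- B u) (Hp (- B u)) = B u (Hp (B u))"
    using p.H.minus_left[OF B_in[OF u] p.H.V_simps(5)[OF B_in[OF u]]] p.H.minus_right[OF B_in[OF u] B_in[OF u]]
    by simp
  moreover have "B u (Hp (B u)) \<le> C2 / c1p * ?E" using B_bound[OF u] c1p by (simp add: field_simps)
  moreover have "0 \<le> C2 / c1p * ?G" using C2 c1p G by simp
  ultimately show ?thesis using E G unfolding distrib_right distrib_left by linarith
qed

lemma denominator_upper:
  assumes u: "u \<in> V" and p: "p \<in> Q"
  shows "(w.Hi u + BT p) (Hw (w.Hi u + BT p)) + p.Hi p (Hp (p.Hi p)) \<le>
    (2 * c2w + 2 + c2p * C1 * c2w) * (a u u + BT p (Hw (BT p)))"
proof -
  let ?g = "BT p" and ?E = "a u u" and ?G = "BT p (Hw (BT p))"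
  have g: "?g \<in> dual V" by (rule BT_in) (rule p)
  have E: "0 \<le> ?E" using w.nonneg u by blast
  have G: "0 \<le> ?G" using w.H.nonneg g by blast
  have "(w.Hi u + ?g) (Hw (w.Hi u + ?g)) \<le> 2 * w.Hi u u + 2 * ?G"
    using w.H.add_self_le[OF w.Hi_in[OF u] g] by (simp add: w.H_Hi[OF u])
  moreover have "w.Hi u u \<le> c2w * ?E" using w.Hi_le[OF u] .
  moreover have "p.Hi p (Hp (p.Hi p)) \<le> c2p * C1 * c2w * ?G"
  proof -
    have "p.Hi p p \<le> c2p * schur p p" using p.Hi_le[OF p] .
    also have "\<dots> \<le> c2p * (C1 * c2w * ?G)" using schur_le_BT[OF p] c2p by simp
    finally show ?thesis using p.H_Hi[OF p] by simp
  qed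
  moreover have "0 \<le> c2p * C1 * c2w * ?E" "0 \<le> c2w * ?G" using c2p C1 w.c2 E G by simp_all
  ultimately show ?thesis using E unfolding distrib_right distrib_left by linarith
qed

text \<open>The functional \<open>Hw\<^sup>-\<^sup>1 u\<close> is recovered from \<open>Hw\<^sup>-\<^sup>1 u + B\<^sup>T p\<close> by subtracting \<open>B\<^sup>T p\<close>, whose norm is controlled by that
  of \<open>Hp\<^sup>-\<^sup>1 p\<close> through the Schur complement.\<close>

lemma denominator_lower:
  fixes \<kappa> :: real
  assumes u: "u \<in> V" and p: "p \<in> Q" and \<kappa>: "\<kappa> = C2 / (c1w * c1p)"
  shows "a u u + BT p (Hw (BT p)) \<le> (2 / c1w * (1 + \<kappa>) + \<kappa>) *
    ((w.Hi u + BT p) (Hw (w.Hi u + BT p)) + p.Hi p (Hp (p.Hi p)))"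
proof -
  let ?g = "BT p" and ?E = "a u u" and ?G = "BT p (Hw (BT p))"
  let ?x = "(w.Hi u + ?g) (Hw (w.Hi u + ?g))" and ?y = "p.Hi p (Hp (p.Hi p))"
  have g: "?g \<in> dual V" by (rule BT_in) (rule p)
  have h: "w.Hi u \<in> dual V" using w.Hi_in u .
  have pos: "0 \<le> ?x" "0 \<le> ?y" "0 < \<kappa>"
    using w.H.nonneg[OF w.H.V_simps(2)[OF h g]] p.H.nonneg[OF p.Hi_in[OF p]] \<kappa> C2 w.c1 c1p by simp_all
  have y: "?y = p.Hi p p" using p.H_Hi[OF p] by simp
  have "c1w * ?G * c1p \<le> C2 * schur p p * c1p" using BT_le_schur[OF p] c1p by simp
  also have "\<dots> = C2 * (c1p * schur p p)" by simp
  also have "\<dots> \<le> C2 * ?y" using p.le_Hi[OF p] C2 y by simp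
  finally have "?G * (c1w * c1p) \<le> C2 * ?y" by (simp only: ac_simps)
  then have "?G \<le> C2 * ?y / (c1w * c1p)" using w.c1 c1p by (simp add: pos_le_divide_eq)
  then have G: "?G \<le> \<kappa> * ?y" using \<kappa> by simp
  have "c1w * ?E \<le> w.Hi u (Hw (w.Hi u))" using w.le_Hi[OF u] w.H_Hi[OF u] by simp
  also have "\<dots> \<le> 2 * ?x + 2 * ?G"
  proof -
    have mg: "- ?g \<in> dual V" using g by auto
    have "(- ?g) (Hw (- ?g)) = ?G"
      using w.H.minus_left[OF g mg] w.H.minus_right[OF g g] by simp
    then show ?thesis
      using w.H.add_self_le[OF w.H.V_simps(2)[OF h g] mg] by simp
  qed
  finally have "?E \<le> 2 / c1w * (?x + ?G)" using w.c1 by (simp add: field_simps)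
  also have "\<dots> \<le> 2 / c1w * (?x + \<kappa> * ?y)" using G w.c1 by (intro mult_left_mono) auto
  also have "\<dots> \<le> 2 / c1w * ((1 + \<kappa>) * (?x + ?y))"
    using pos w.c1 mult_nonneg_nonneg[of \<kappa> ?x] by (intro mult_left_mono) (auto simp: algebra_simps)
  finally have "?E \<le> 2 / c1w * (1 + \<kappa>) * (?x + ?y)" by (simp only: mult.assoc)
  moreover have "?G \<le> \<kappa> * (?x + ?y)" using G mult_nonneg_nonneg[of \<kappa> ?x] pos by (simp add: distrib_left)
  ultimately show ?thesis by (simp add: distrib_right)
qed

lemma denominator_pos:
  assumes u: "u \<in> V" and p: "p \<in> Q" and nz: "u \<noteq> 0 \<or> p \<noteq> 0"
  shows "0 < (w.Hi u + BT p) (Hw (w.Hi u + BT p)) + p.Hi p (Hp (p.Hi p))"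
proof -
  have g: "BT p \<in> dual V" by (rule BT_in) (rule p)
  have x: "w.Hi u + BT p \<in> dual V" using w.Hi_in[OF u] g by auto
  have Hp0: "Hp 0 = 0" using p.H_scale[of 0 0] by simp
  have Hw0: "Hw 0 = 0" using w.H_scale[of 0 0] by simp
  show ?thesis
  proof (cases "p = 0")
    case True
    have "BT p = 0" using True b_scale_right[of _ 0 0] p by (auto simp: form_op_def fun_eq_iff)
    then have "w.Hi u + BT p \<noteq> 0" using nz True w.H_Hi[OF u] Hw0 by auto
    then show ?thesis
      using w.H_pos[OF x] p.H.nonneg[OF p.Hi_in[OF p]] by (rule_tac add_pos_nonneg)
  next
    case False
    then have "p.Hi p \<noteq> 0" using p.H_Hi[OF p] Hp0 by auto
    then show ?thesis
      using p.H_pos[OF p.Hi_in[OF p]] w.H.nonneg[OF x] by (rule_tac add_nonneg_pos)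
  qed
qed

lemma field_of_values:
  assumes u: "u \<in> V" and p: "p \<in> Q" and nz: "u \<noteq> 0 \<or> p \<noteq> 0"
  shows "1 / (4 * (2 * c2w + 2 + c2p * C1 * c2w)) \<le>
      ((A u + BT p) (Hw (w.Hi u + BT p)) + (- B u) (Hp (p.Hi p))) /
      ((w.Hi u + BT p) (Hw (w.Hi u + BT p)) + p.Hi p (Hp (p.Hi p)))" (is "1 / (4 * ?K) \<le> ?N / ?D")
    and "sqrt ((A u + BT p) (Hw (A u + BT p)) + (- B u) (Hp (- B u))) /
      sqrt ((w.Hi u + BT p) (Hw (w.Hi u + BT p)) + p.Hi p (Hp (p.Hi p))) \<le>
      sqrt ((4 + C2 / c1p) * (2 / c1w * (1 + C2 / (c1w * c1p)) + C2 / (c1w * c1p)))"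
      (is "sqrt ?M / sqrt ?D \<le> sqrt (?K1 * ?K2)")
proof -
  let ?S = "a u u + BT p (Hw (BT p))"
  have D: "0 < ?D" using denominator_pos[OF u p nz] .
  have K: "0 < ?K" using w.c2 c2p C1 by (simp add: add_pos_pos)
  have "?D \<le> 4 * ?K * ?N"
  proof -
    have "?D \<le> ?K * ?S" using denominator_upper[OF u p] .
    also have "\<dots> \<le> ?K * (4 * ?N)" using numerator_lower[OF u p] K by (intro mult_left_mono) auto
    finally show ?thesis by (simp only: ac_simps)
  qed
  then show "1 / (4 * ?K) \<le> ?N / ?D" using D K by (simp add: field_simps)
  have "?M \<le> ?K1 * ?S" using numerator_upper[OF u p] .
  also have "\<dots> \<le> ?K1 * (?K2 * ?D)"
    using denominator_lower[OF u p refl] C2 c1p by (intro mult_left_mono) (auto simp: add_nonneg_nonneg)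
  finally have "?M \<le> (?K1 * ?K2) * ?D" by (simp only: ac_simps)
  then have "sqrt ?M \<le> sqrt (?K1 * ?K2) * sqrt ?D"
    by (metis real_sqrt_le_iff real_sqrt_mult)
  then show "sqrt ?M / sqrt ?D \<le> sqrt (?K1 * ?K2)"
    using D by (simp add: pos_divide_le_eq)
qed

end

section \<open>Flat measures\<close>

lemma subspace_tangent: "S \<noteq> {} \<Longrightarrow> subspace (tangent S)"
  and tangent_eq_image: "p \<in> affine hull S \<Longrightarrow> tangent S = (\<lambda>x. x - p) ` (affine hull S)"
proof -
  have eq: "tangent S = (\<lambda>x. x - p) ` (affine hull S)" if p: "p \<in> affine hull S" for p
  proof
    show "tangent S \<subseteq> (\<lambda>x. x - p) ` (affine hull S)"
    proof
      fix z assume "z \<in> tangent S"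
      then obtain x y where xy: "z = x - y" "x \<in> affine hull S" "y \<in> affine hull S"
        by (auto simp: tangent_def)
      have "p + 1 *\<^sub>R (x - y) \<in> affine hull S"
        using mem_affine_3_minus[OF affine_affine_hull p xy(2,3), of 1] .
      then show "z \<in> (\<lambda>x. x - p) ` (affine hull S)" using xy(1) by (auto intro!: image_eqI[of _ _ "p + z"])
    qed
  qed (use p in \<open>auto simp: tangent_def\<close>)
  then show "p \<in> affine hull S \<Longrightarrow> tangent S = (\<lambda>x. x - p) ` (affine hull S)" .
  assume "S \<noteq> {}"
  then obtain p where "p \<in> affine hull S" using hull_inc by fastforce
  then show "subspace (tangent S)"
    using eq[of p] affine_diffs_subspace_subtract[OF affine_affine_hull] by (simp add: setcompr_eq_image)
qed

lemma tangent_cong: "affine hull S = affine hull T \<Longrightarrow> tangent S = tangent T"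
  by (simp add: tangent_def)

lemma tangent_mono: "affine hull S \<subseteq> affine hull T \<Longrightarrow> tangent S \<subseteq> tangent T"
  by (auto simp: tangent_def)

lemma diff_in_tangent: "x \<in> affine hull S \<Longrightarrow> y \<in> affine hull S \<Longrightarrow> x - y \<in> tangent S"
  by (auto simp: tangent_def)

lemma add_tangent: "x \<in> affine hull S \<Longrightarrow> v \<in> tangent S \<Longrightarrow> x + v \<in> affine hull S"
  using tangent_eq_image[of x S] by auto

lemma dim_tangent: "S \<noteq> {} \<Longrightarrow> int (dim (tangent S)) = aff_dim S"
proof -
  assume "S \<noteq> {}"
  then obtain p where p: "p \<in> affine hull S" using hull_inc by fastforce
  show ?thesis using aff_dim_dim_affine_diffs[OF affine_affine_hull p] tangent_eq_image[OF p] by simp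
qed

lemma orthobasis:
  assumes "S \<noteq> {}"
  shows "orthobasis S \<subseteq> tangent S" "pairwise orthogonal (orthobasis S)" "e \<in> orthobasis S \<Longrightarrow> norm e = 1"
    "independent (orthobasis S)" "span (orthobasis S) = tangent S" "finite (orthobasis S)"
    "card (orthobasis S) = dim (tangent S)"
proof -
  obtain B where "B \<subseteq> tangent S \<and> pairwise orthogonal B \<and> (\<forall>e\<in>B. norm e = 1) \<and> independent B \<and> span B = tangent S"
    using orthonormal_basis_subspace[OF subspace_tangent[OF assms]] by metis
  then have *: "orthobasis S \<subseteq> tangent S \<and> pairwise orthogonal (orthobasis S) \<and> (\<forall>e\<in>orthobasis S. norm e = 1) \<and>
      independent (orthobasis S) \<and> span (orthobasis S) = tangent S"
    unfolding orthobasis_def by (rule someI)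
  then show "orthobasis S \<subseteq> tangent S" "pairwise orthogonal (orthobasis S)" "e \<in> orthobasis S \<Longrightarrow> norm e = 1"
    "independent (orthobasis S)" "span (orthobasis S) = tangent S" by auto
  then show "finite (orthobasis S)" "card (orthobasis S) = dim (tangent S)"
    using dim_span_eq_card_independent[of "orthobasis S"] by (simp_all add: independent_imp_finite)
qed

lemma inner_orthobasis:
  assumes "S \<noteq> {}" "e \<in> orthobasis S" "e' \<in> orthobasis S"
  shows "e \<bullet> e' = (if e = e' then 1 else 0)"
  using orthobasis(2,3)[OF assms(1)] assms(2,3)
  by (auto simp: pairwise_def orthogonal_def dot_square_norm)

text \<open>The isometric parametrization of the affine hull underlying \<^const>\<open>flat_measure\<close>.\<close>

definition chart :: "'a::euclidean_space set \<Rightarrow> ('a \<Rightarrow> real) \<Rightarrow> 'a"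
  where "chart S t = (SOME p. p \<in> affine hull S) + (\<Sum>e\<in>orthobasis S. t e *\<^sub>R e)"

lemma flat_measure_chart: "flat_measure S = distr (PiM (orthobasis S) (\<lambda>_. lborel)) borel (chart S)"
  by (simp add: flat_measure_def chart_def[abs_def])

lemma sets_flat_measure [simp, measurable_cong]: "sets (flat_measure S) = sets borel"
  and space_flat_measure [simp]: "space (flat_measure S) = UNIV"
  by (simp_all add: flat_measure_def)

lemma measurable_chart [measurable]: "chart S \<in> PiM (orthobasis S) (\<lambda>_. lborel) \<rightarrow>\<^sub>M borel"
  unfolding chart_def[abs_def] by measurable

lemma origin_in: "S \<noteq> {} \<Longrightarrow> (SOME p. p \<in> affine hull S) \<in> affine hull S"
  by (rule someI_ex) (auto intro: hull_inc)

lemma chart_in: "S \<noteq> {} \<Longrightarrow> chart S t \<in> affine hull S"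
  unfolding chart_def using orthobasis(1,6) subspace_tangent[of S]
  by (intro add_tangent origin_in subspace_sum subspace_scale) auto

lemma chart_inner:
  assumes "S \<noteq> {}" "e \<in> orthobasis S"
  shows "(chart S t - (SOME p. p \<in> affine hull S)) \<bullet> e = t e"
  using assms orthobasis(6)[OF assms(1)]
  by (simp add: chart_def inner_sum_left inner_orthobasis if_distrib cong: if_cong)

lemma chart_surj:
  assumes "S \<noteq> {}" "x \<in> affine hull S"
  shows "\<exists>t. x = chart S t"
proof -
  have "x - (SOME p. p \<in> affine hull S) \<in> span (orthobasis S)"
    using orthobasis(5)[OF assms(1)] diff_in_tangent[OF assms(2) origin_in[OF assms(1)]] by simp
  then obtain t where "x - (SOME p. p \<in> affine hull S) = (\<Sum>e\<in>orthobasis S. t e *\<^sub>R e)"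
    using span_finite[OF orthobasis(6)[OF assms(1)]] by auto
  then show ?thesis by (auto simp: chart_def algebra_simps)
qed

lemma dist_chart_le:
  assumes "S \<noteq> {}"
  shows "dist (chart S s) (chart S t) \<le> (\<Sum>e\<in>orthobasis S. \<bar>s e - t e\<bar>)"
proof -
  have "dist (chart S s) (chart S t) = norm (\<Sum>e\<in>orthobasis S. (s e - t e) *\<^sub>R e)"
    by (simp add: chart_def dist_norm scaleR_diff_left sum_subtractf)
  also have "\<dots> \<le> (\<Sum>e\<in>orthobasis S. norm ((s e - t e) *\<^sub>R e))" by (rule norm_sum)
  finally show ?thesis using orthobasis(3)[OF assms] by simp
qed

interpretation lborel_product: product_sigma_finite "\<lambda>_. lborel :: real measure"
  by standard

lemma emeasure_box:
  fixes c :: "'a \<Rightarrow> real"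
  assumes "finite I" "r \<ge> 0"
  shows "emeasure (PiM I (\<lambda>_. lborel)) (PiE I (\<lambda>e. {c e - r<..<c e + r})) = ennreal ((2 * r) ^ card I)"
  using assms by (subst lborel_product.emeasure_PiM) (auto simp: prod_constant ennreal_power)

text \<open>The coordinates of the points of a bounded set are bounded, as they are inner products with unit vectors.\<close>

lemma emeasure_flat_measure_finite:
  assumes S: "S \<noteq> {}" and A: "A \<in> sets borel" "bounded A"
  shows "emeasure (flat_measure S) A < \<infinity>"
proof -
  let ?p = "SOME p. p \<in> affine hull S" and ?P = "PiM (orthobasis S) (\<lambda>_. lborel :: real measure)"
  obtain r where r: "r > 0" "\<And>x. x \<in> A \<Longrightarrow> norm (x - ?p) < r"
    using bounded_subset_ballD[OF A(2), of ?p] by (auto simp: dist_norm norm_minus_commute subset_eq)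
  have "emeasure (flat_measure S) A = emeasure ?P (chart S -` A \<inter> space ?P)"
    unfolding flat_measure_chart using A(1) by (intro emeasure_distr) auto
  also have "\<dots> \<le> emeasure ?P (PiE (orthobasis S) (\<lambda>_. {0 - r<..<0 + r}))"
  proof (rule emeasure_mono)
    show "chart S -` A \<inter> space ?P \<subseteq> PiE (orthobasis S) (\<lambda>_. {0 - r<..<0 + r})"
    proof
      fix t assume t: "t \<in> chart S -` A \<inter> space ?P"
      have "\<bar>t e\<bar> < r" if e: "e \<in> orthobasis S" for e
      proof -
        have "\<bar>t e\<bar> \<le> norm (chart S t - ?p) * norm e"
          using chart_inner[OF S e, of t] Cauchy_Schwarz_ineq2[of "chart S t - ?p" e] by simp
        then show ?thesis using r(2)[of "chart S t"] t orthobasis(3)[OF S e] by simp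
      qed
      then show "t \<in> PiE (orthobasis S) (\<lambda>_. {0 - r<..<0 + r})"
        using t by (simp add: space_PiM PiE_iff abs_less_iff minus_less_iff[of r])
    qed
    show "PiE (orthobasis S) (\<lambda>_. {0 - r<..<0 + r}) \<in> sets ?P"
      using orthobasis(6)[OF S] by (intro sets_PiM_I_finite) auto
  qed
  also have "\<dots> < \<infinity>"
    using emeasure_box[OF orthobasis(6)[OF S], of r "\<lambda>_. 0"] r(1) by simp
  finally show ?thesis .
qed

lemma emeasure_flat_measure_pos:
  assumes S: "S \<noteq> {}" and A: "A \<in> sets borel" and x: "x \<in> A" "x \<in> affine hull S"
    and op: "\<epsilon> > 0" "ball x \<epsilon> \<inter> affine hull S \<subseteq> A"
  shows "emeasure (flat_measure S) A > 0"
proof -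
  let ?P = "PiM (orthobasis S) (\<lambda>_. lborel :: real measure)"
  obtain t where t: "x = chart S t" using chart_surj[OF S x(2)] by blast
  \<comment> \<open>small enough for the chart to map the box of half width \<open>r\<close> around \<open>t\<close> into the ball\<close>
  define r where "r = \<epsilon> / (2 * (1 + card (orthobasis S)))"
  have r: "r > 0" using op(1) by (simp add: r_def)
  let ?U = "PiE (orthobasis S) (\<lambda>e. {t e - r<..<t e + r})"
  have "0 < emeasure ?P ?U"
    using emeasure_box[OF orthobasis(6)[OF S], of r t] r by simp
  also have "\<dots> \<le> emeasure ?P (chart S -` A \<inter> space ?P)"
  proof (rule emeasure_mono)
    show "?U \<subseteq> chart S -` A \<inter> space ?P"
    proof
      fix s assume s: "s \<in> ?U"
      have "dist (chart S t) (chart S s) \<le> (\<Sum>e\<in>orthobasis S. \<bar>t e - s e\<bar>)"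
        by (rule dist_chart_le[OF S])
      also have "\<dots> \<le> (\<Sum>e\<in>orthobasis S. r)"
        using s by (intro sum_mono) (force simp: PiE_iff abs_le_iff)
      also have "\<dots> = card (orthobasis S) * r" by simp
      also have "\<dots> < \<epsilon>"
        using op(1) mult_nonneg_nonneg[of \<epsilon> "card (orthobasis S)"] unfolding r_def
        by (simp add: field_simps add_pos_nonneg)
      finally have "chart S s \<in> A" using op(2) chart_in[OF S] t by auto
      then show "s \<in> chart S -` A \<inter> space ?P" using s by (auto simp: space_PiM PiE_iff)
    qed
    show "chart S -` A \<inter> space ?P \<in> sets ?P" using A by measurable
  qed
  also have "\<dots> = emeasure (flat_measure S) A"
    unfolding flat_measure_chart using A by (intro emeasure_distr[symmetric]) auto
  finally show ?thesis .
qed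

lemma emeasure_lborel_midpoint:
  assumes "A \<in> sets borel"
  shows "emeasure lborel ((\<lambda>x::real. (c + x) / 2) -` A) = 2 * emeasure lborel A"
proof -
  have "(lborel :: real measure) = density (distr lborel borel (\<lambda>x. c / 2 + (1 / 2) * x)) (\<lambda>_. ennreal \<bar>1 / 2\<bar>)"
    by (rule lborel_real_affine) simp
  then have "emeasure lborel A = emeasure (density (distr lborel borel (\<lambda>x. c / 2 + (1 / 2) * x)) (\<lambda>_. ennreal \<bar>1 / 2\<bar>)) A"
    by simp
  also have "\<dots> = ennreal (1 / 2) * emeasure (distr lborel borel (\<lambda>x. c / 2 + (1 / 2) * x)) A"
    using assms by (subst emeasure_density_const) auto
  also have "emeasure (distr lborel borel (\<lambda>x. c / 2 + (1 / 2) * x)) A = emeasure lborel ((\<lambda>x. (c + x) / 2) -` A)"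
    using assms by (subst emeasure_distr) (auto simp: add_divide_distrib)
  finally have "2 * emeasure lborel A = (2 * ennreal (1 / 2)) * emeasure lborel ((\<lambda>x. (c + x) / 2) -` A)"
    by (simp add: mult.assoc)
  also have "2 * ennreal (1 / 2) = 1"
    by (metis ennreal_1 ennreal_mult'' ennreal_numeral mult.commute nonzero_eq_divide_eq zero_le_divide_1_iff zero_le_numeral zero_neq_numeral)
  finally show ?thesis by simp
qed

text \<open>Both measures agree on boxes, which generate the product algebra, and the cubes exhaust the space.\<close>

lemma distr_PiM_midpoint:
  fixes c :: "'i \<Rightarrow> real"
  assumes I: "finite I"
  defines "\<tau> \<equiv> \<lambda>t. \<lambda>e\<in>I. (c e + t e) / 2"
  shows "\<tau> \<in> PiM I (\<lambda>_. lborel) \<rightarrow>\<^sub>M PiM I (\<lambda>_. lborel)"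
    and "distr (PiM I (\<lambda>_. lborel)) (PiM I (\<lambda>_. lborel)) \<tau> = scale_measure (2 ^ card I) (PiM I (\<lambda>_. lborel))"
proof -
  let ?P = "PiM I (\<lambda>_. lborel :: real measure)"
  show meas: "\<tau> \<in> ?P \<rightarrow>\<^sub>M ?P" unfolding \<tau>_def by measurable
  have emb: "emeasure (distr ?P ?P \<tau>) (PiE I A) = 2 ^ card I * (\<Prod>i\<in>I. emeasure lborel (A i))"
    if A: "\<And>i. i \<in> I \<Longrightarrow> A i \<in> sets lborel" for A
  proof -
    have "\<tau> -` PiE I A \<inter> space ?P = PiE I (\<lambda>i. (\<lambda>x. (c i + x) / 2) -` A i)"
      by (auto simp: \<tau>_def space_PiM PiE_iff)
    then have "emeasure (distr ?P ?P \<tau>) (PiE I A) = emeasure ?P (PiE I (\<lambda>i. (\<lambda>x. (c i + x) / 2) -` A i))"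
      using meas A I by (subst emeasure_distr) (auto intro!: sets_PiM_I_finite)
    also have "\<dots> = (\<Prod>i\<in>I. emeasure lborel ((\<lambda>x. (c i + x) / 2) -` A i))"
    proof (rule lborel_product.emeasure_PiM[OF I])
      fix i assume "i \<in> I"
      then have "A i \<in> sets borel" using A by simp
      moreover have "(\<lambda>x. (c i + x) / 2) \<in> borel \<rightarrow>\<^sub>M borel" by measurable
      ultimately show "(\<lambda>x. (c i + x) / 2) -` A i \<in> sets lborel"
        using measurable_sets[of "\<lambda>x. (c i + x) / 2" borel borel "A i"] by simp
    qed
    also have "\<dots> = (\<Prod>i\<in>I. 2 * emeasure lborel (A i))"
      using A by (intro prod.cong) (auto simp: emeasure_lborel_midpoint)
    finally show ?thesis by (simp add: prod.distrib)
  qed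
  show "distr ?P ?P \<tau> = scale_measure (2 ^ card I) ?P"
  proof (rule measure_eqI_PiM_finite[OF I])
    show "emeasure (distr ?P ?P \<tau>) (PiE I A) = emeasure (scale_measure (2 ^ card I) ?P) (PiE I A)"
      if "\<And>i. i \<in> I \<Longrightarrow> A i \<in> sets lborel" for A
      using emb[OF that] that I by (simp add: lborel_product.emeasure_PiM)
    let ?A = "\<lambda>n::nat. PiE I (\<lambda>_. {- real n<..<real n})"
    show "range ?A \<subseteq> prod_algebra I (\<lambda>_. lborel)"
      using I by (auto intro!: prod_algebraI_finite)
    show "(\<Union>n. ?A n) = space (PiM I (\<lambda>_. lborel))"
    proof
      show "space ?P \<subseteq> (\<Union>n. ?A n)"
      proof
        fix t assume t: "t \<in> space ?P"
        obtain n :: nat where n: "(\<Sum>e\<in>I. \<bar>t e\<bar>) < real n" using reals_Archimedean2 by blast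
        have "\<bar>t e\<bar> < real n" if "e \<in> I" for e
          using n member_le_sum[of e I "\<lambda>e. \<bar>t e\<bar>"] that I by simp
        then have "t \<in> ?A n" using t by (auto simp: space_PiM PiE_iff abs_less_iff minus_less_iff)
        then show "t \<in> (\<Union>n. ?A n)" by blast
      qed
    qed (auto simp: space_PiM)
    show "emeasure (distr ?P ?P \<tau>) (?A n) \<noteq> \<infinity>" for n
      by (subst emb) (auto simp: ennreal_mult_eq_top_iff power_eq_top_ennreal)
  qed auto
qed

lemma nn_integral_flat_measure_midpoint:
  assumes S: "S \<noteq> {}" and x0: "x0 \<in> affine hull S" and h: "h \<in> borel_measurable borel"
  shows "(\<integral>\<^sup>+x. h ((1 / 2) *\<^sub>R (x0 + x)) \<partial>flat_measure S) = 2 ^ dim (tangent S) * (\<integral>\<^sup>+x. h x \<partial>flat_measure S)"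
proof -
  let ?B = "orthobasis S" and ?P = "PiM (orthobasis S) (\<lambda>_. lborel :: real measure)"
  obtain c where c: "x0 = chart S c" using chart_surj[OF S x0] by blast
  define \<tau> where "\<tau> = (\<lambda>t. \<lambda>e\<in>?B. (c e + t e) / 2)"
  note tau = distr_PiM_midpoint[OF orthobasis(6)[OF S], of c, folded \<tau>_def]
  have mid: "(1 / 2) *\<^sub>R (x0 + chart S t) = chart S (\<tau> t)" for t
  proof -
    have "chart S (\<tau> t) = (SOME p. p \<in> affine hull S) + (\<Sum>e\<in>?B. ((c e + t e) / 2) *\<^sub>R e)"
      by (simp add: chart_def \<tau>_def)
    also have "(\<Sum>e\<in>?B. ((c e + t e) / 2) *\<^sub>R e) = (1 / 2) *\<^sub>R ((\<Sum>e\<in>?B. c e *\<^sub>R e) + (\<Sum>e\<in>?B. t e *\<^sub>R e))"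
      by (simp add: scaleR_sum_right sum.distrib[symmetric] algebra_simps add_divide_distrib)
    finally show ?thesis
      unfolding c chart_def by (simp add: algebra_simps scaleR_half_double flip: scaleR_add_left)
  qed
  have "(\<integral>\<^sup>+x. h ((1 / 2) *\<^sub>R (x0 + x)) \<partial>flat_measure S) = (\<integral>\<^sup>+t. h (chart S (\<tau> t)) \<partial>?P)"
    unfolding flat_measure_chart using h by (subst nn_integral_distr) (auto simp: mid)
  also have "\<dots> = (\<integral>\<^sup>+t. h (chart S t) \<partial>distr ?P ?P \<tau>)"
    using h tau(1) by (subst nn_integral_distr) auto
  also have "\<dots> = 2 ^ card ?B * (\<integral>\<^sup>+t. h (chart S t) \<partial>?P)"
    unfolding tau(2) using h by (subst nn_integral_scale_measure) auto
  also have "(\<integral>\<^sup>+t. h (chart S t) \<partial>?P) = (\<integral>\<^sup>+x. h x \<partial>flat_measure S)"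
    unfolding flat_measure_chart using h by (subst nn_integral_distr) auto
  finally show ?thesis using orthobasis(7)[OF S] by simp
qed

lemma set_integrable_flat_measure:
  fixes f :: "'a::euclidean_space \<Rightarrow> real"
  assumes "S \<noteq> {}" "A \<in> sets borel" "bounded A" "f \<in> borel_measurable borel" "\<And>x. x \<in> A \<Longrightarrow> \<bar>f x\<bar> \<le> C"
  shows "set_integrable (flat_measure S) A f"
  unfolding set_integrable_def
proof (rule integrableI_bounded_set)
  show "(\<lambda>x. indicat_real A x *\<^sub>R f x) \<in> borel_measurable (flat_measure S)"
    using assms(2,4) by measurable
  show "emeasure (flat_measure S) A < \<infinity>" by (rule emeasure_flat_measure_finite) fact+
  show "AE x\<in>A in flat_measure S. norm (indicat_real A x *\<^sub>R f x) \<le> C" using assms(5) by (auto simp: indicator_def)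
qed (use assms(2) in \<open>auto simp: indicator_def\<close>)

lemma set_integrable_flat_measure_continuous:
  fixes f :: "'a::euclidean_space \<Rightarrow> real"
  assumes "S \<noteq> {}" "compact A" "continuous_on UNIV f"
  shows "set_integrable (flat_measure S) A f"
proof -
  obtain C where "\<And>x. x \<in> A \<Longrightarrow> \<bar>f x\<bar> \<le> C"
    using compact_imp_bounded[OF compact_continuous_image[OF continuous_on_subset[OF assms(3)] assms(2)]]
    by (auto simp: bounded_iff)
  then show ?thesis
    using assms by (intro set_integrable_flat_measure[of _ _ _ C])
      (auto simp: compact_imp_bounded borel_measurable_continuous_onI borel_compact)
qed

text \<open>The inverse estimate behind the diagonal form. Since \<open>g\<close> is affine, \<open>g x0 = 2 g ((x0 + x) / 2) - g x\<close>; squaring and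
  integrating over \<open>x\<close> leaves an integral over the image of \<open>T\<close> under a homothety, which lies in \<open>T\<close> by
  convexity. The constant depends on the dimension only.\<close>

lemma affine_value_le_integral:
  fixes g :: "'a::euclidean_space \<Rightarrow> real"
  assumes S: "S \<noteq> {}" and T: "compact T" "convex T" "T \<subseteq> affine hull S" and x0: "x0 \<in> T"
    and g: "continuous_on UNIV g" "\<And>x. g ((1 / 2) *\<^sub>R (x0 + x)) = (g x0 + g x) / 2"
  shows "(g x0)\<^sup>2 * measure (flat_measure S) T \<le>
    (8 * 2 ^ dim (tangent S) + 2) * (LINT x:T|flat_measure S. (g x)\<^sup>2)"
proof -
  let ?F = "flat_measure S" and ?m = "\<lambda>x. (1 / 2) *\<^sub>R (x0 + x)"
  note cont [continuous_intros] = g(1)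
  have gm: "continuous_on UNIV (\<lambda>x. g (?m x))" unfolding g(2) by (intro continuous_intros) auto
  have int: "set_integrable ?F T (\<lambda>x. (g x)\<^sup>2)" "set_integrable ?F T (\<lambda>x. (g (?m x))\<^sup>2)"
    using S T g(1) gm by (auto intro!: set_integrable_flat_measure_continuous continuous_intros)
  have Tb: "T \<in> sets borel" using T(1) by (rule borel_compact)
  define h where "h x = ennreal (indicat_real T x * (g x)\<^sup>2)" for x
  have "g \<in> borel_measurable borel" using g(1) by (rule borel_measurable_continuous_onI)
  then have h: "h \<in> borel_measurable borel" unfolding h_def using Tb by measurable
  have hI: "(\<integral>\<^sup>+x. h x \<partial>?F) = ennreal (LINT x:T|?F. (g x)\<^sup>2)"
    using int(1) unfolding set_integrable_def set_lebesgue_integral_def h_def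
    by (subst nn_integral_eq_integral) auto
  have "ennreal (LINT x:T|?F. (g (?m x))\<^sup>2) = (\<integral>\<^sup>+x. ennreal (indicat_real T x * (g (?m x))\<^sup>2) \<partial>?F)"
    using int(2) unfolding set_integrable_def set_lebesgue_integral_def
    by (subst nn_integral_eq_integral) auto
  also have "\<dots> \<le> (\<integral>\<^sup>+x. h (?m x) \<partial>?F)"
  proof (rule nn_integral_mono)
    fix x
    show "ennreal (indicat_real T x * (g (?m x))\<^sup>2) \<le> h (?m x)"
    proof (cases "x \<in> T")
      case True
      have "(1 / 2) *\<^sub>R x0 + (1 / 2) *\<^sub>R x \<in> T" using T(2) x0 True by (intro convexD) auto
      then show ?thesis using True by (simp add: h_def scaleR_add_right)
    qed simp
  qed
  also have "\<dots> = 2 ^ dim (tangent S) * (\<integral>\<^sup>+x. h x \<partial>?F)"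
    by (rule nn_integral_flat_measure_midpoint[OF S _ h]) (use x0 T(3) in auto)
  also have "\<dots> = ennreal (2 ^ dim (tangent S) * (LINT x:T|?F. (g x)\<^sup>2))"
    unfolding hI by (simp add: ennreal_mult ennreal_power[symmetric] set_lebesgue_integral_def)
  finally have mid: "(LINT x:T|?F. (g (?m x))\<^sup>2) \<le> 2 ^ dim (tangent S) * (LINT x:T|?F. (g x)\<^sup>2)"
    by (subst (asm) ennreal_le_iff) (auto simp: set_lebesgue_integral_def)
  have "(g x0)\<^sup>2 * measure ?F T = (LINT x:T|?F. (g x0)\<^sup>2)"
    using Tb emeasure_flat_measure_finite[OF S Tb compact_imp_bounded[OF T(1)]]
    by (subst set_integral_const) auto
  also have "\<dots> \<le> (LINT x:T|?F. 8 * (g (?m x))\<^sup>2 + 2 * (g x)\<^sup>2)"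
  proof (rule set_integral_mono)
    show "set_integrable ?F T (\<lambda>x. (g x0)\<^sup>2)"
      using S T by (intro set_integrable_flat_measure_continuous) auto
    show "set_integrable ?F T (\<lambda>x. 8 * (g (?m x))\<^sup>2 + 2 * (g x)\<^sup>2)"
      using int by (intro set_integral_add set_integrable_mult_right)
    fix x
    have "8 * (g (?m x))\<^sup>2 + 2 * (g x)\<^sup>2 - (g x0)\<^sup>2 = (g x0 + 2 * g x)\<^sup>2"
      unfolding g(2) by (simp add: power2_eq_square field_simps)
    then show "(g x0)\<^sup>2 \<le> 8 * (g (?m x))\<^sup>2 + 2 * (g x)\<^sup>2"
      using zero_le_power2[of "g x0 + 2 * g x"] by linarith
  qed
  also have "\<dots> = 8 * (LINT x:T|?F. (g (?m x))\<^sup>2) + 2 * (LINT x:T|?F. (g x)\<^sup>2)"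
    using int by (simp add: set_integral_add set_integrable_mult_right)
  also have "\<dots> \<le> (8 * 2 ^ dim (tangent S) + 2) * (LINT x:T|?F. (g x)\<^sup>2)"
    using mid by (simp add: algebra_simps)
  finally show ?thesis .
qed

section \<open>Raviart--Thomas fields on a simplex\<close>

text \<open>The base point of the linear part can be moved, since points of \<open>T\<close> differ by tangent vectors.\<close>

lemma RT0_iff:
  assumes "c \<in> T"
  shows "v \<in> RT0 T \<longleftrightarrow> (\<exists>a\<in>tangent T. \<exists>b. v = (\<lambda>x. a + b *\<^sub>R (x - c)))"
proof
  assume "v \<in> RT0 T"
  then obtain a b c' where v: "a \<in> tangent T" "c' \<in> T" "v = (\<lambda>x. a + b *\<^sub>R (x - c'))"
    by (auto simp: RT0_def)
  have "T \<noteq> {}" using assms by auto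
  then have "a + b *\<^sub>R (c - c') \<in> tangent T"
    using v assms subspace_tangent[of T] diff_in_tangent[of c T c']
    by (intro subspace_add subspace_scale) (auto intro: hull_inc)
  moreover have "v = (\<lambda>x. (a + b *\<^sub>R (c - c')) + b *\<^sub>R (x - c))"
    using v(3) by (simp add: algebra_simps fun_eq_iff)
  ultimately show "\<exists>a\<in>tangent T. \<exists>b. v = (\<lambda>x. a + b *\<^sub>R (x - c))" by blast
qed (use assms in \<open>auto simp: RT0_def\<close>)

lemma RT0_subspace:
  assumes "T \<noteq> {}"
  shows "subspace (RT0 T)"
proof -
  obtain c where c: "c \<in> T" using assms by blast
  note sub = subspace_tangent[OF assms]
  show ?thesis
    unfolding subspace_def
  proof (intro conjI allI ballI)
    show "0 \<in> RT0 T"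
      unfolding RT0_iff[OF c] using subspace_0[OF sub] by (intro bexI[of _ 0] exI[of _ 0]) (auto simp: fun_eq_iff)
    fix u v assume "u \<in> RT0 T" "v \<in> RT0 T"
    then obtain a b a' b' where uv: "a \<in> tangent T" "u = (\<lambda>x. a + b *\<^sub>R (x - c))"
      "a' \<in> tangent T" "v = (\<lambda>x. a' + b' *\<^sub>R (x - c))"
      unfolding RT0_iff[OF c] by auto
    then show "u + v \<in> RT0 T"
      unfolding RT0_iff[OF c] using subspace_add[OF sub]
      by (intro bexI[of _ "a + a'"] exI[of _ "b + b'"]) (simp_all add: uv plus_fun_def algebra_simps)
  next
    fix k u assume "u \<in> RT0 T"
    then obtain a b where u: "a \<in> tangent T" "u = (\<lambda>x. a + b *\<^sub>R (x - c))"
      unfolding RT0_iff[OF c] by auto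
    then show "k *\<^sub>R u \<in> RT0 T"
      unfolding RT0_iff[OF c] using subspace_scale[OF sub]
      by (intro bexI[of _ "k *\<^sub>R a"] exI[of _ "k * b"]) (simp_all add: u scaleR_fun_def algebra_simps)
  qed
qed

lemma RT0_in_tangent:
  assumes "v \<in> RT0 T" "x \<in> T"
  shows "v x \<in> tangent T"
  using assms unfolding RT0_iff[OF assms(2)] by auto

lemma RT0_continuous: "v \<in> RT0 T \<Longrightarrow> continuous_on X v"
  by (auto simp: RT0_def intro!: continuous_intros)

lemma RT0_midpoint: "v \<in> RT0 T \<Longrightarrow> v ((1 / 2) *\<^sub>R (x + y)) = (1 / 2) *\<^sub>R (v x + v y)"
proof -
  assume "v \<in> RT0 T"
  then obtain a b c where v: "v = (\<lambda>x. a + b *\<^sub>R (x - c))" by (auto simp: RT0_def)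
  define d where "d = a - b *\<^sub>R c"
  have v': "v z = d + b *\<^sub>R z" for z unfolding v d_def by (simp add: algebra_simps)
  have "v x + v y = (d + d) + b *\<^sub>R (x + y)" unfolding v' by (simp add: scaleR_add_right)
  then have "(1 / 2) *\<^sub>R (v x + v y) = (1 / 2) *\<^sub>R (d + d) + b *\<^sub>R ((1 / 2) *\<^sub>R (x + y))"
    by (simp only: scaleR_add_right[of _ "d + d"] scaleR_left_commute)
  then show ?thesis unfolding v' scaleR_half_double by simp
qed

locale simplex_vertices =
  fixes C :: "'a::euclidean_space set"
  assumes indep: "\<not> affine_dependent C" and two: "2 \<le> card C"
begin

definition "K = convex hull C"
definition "face u = convex hull (C - {u})"
definition "normal u = outer_normal K (face u)"
definition "height u = (THE h. \<forall>w\<in>C - {u}. (w - u) \<bullet> normal u = h)"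

lemma finite_C: "finite C"
  using indep by (rule aff_independent_finite)

lemma other_vertex: "\<exists>w. w \<in> C - {u}"
proof (rule ccontr)
  assume "\<not> ?thesis"
  then have "C \<subseteq> {u}" by blast
  then have "card C \<le> 1" by (metis card.empty card_mono finite.emptyI finite.insertI is_singletonI is_singleton_altdef)
  then show False using two by simp
qed

lemma C_sub_K: "C \<subseteq> K" by (simp add: K_def hull_subset)

lemma K_nonempty: "K \<noteq> {}" using other_vertex C_sub_K by blast

lemma facet_iff: "f facet_of K \<longleftrightarrow> (\<exists>u\<in>C. f = face u)"
  unfolding K_def face_def using facet_of_convex_hull_affine_independent_alt[OF indep] two by blast

lemma vertex_in_face: "w \<in> C \<Longrightarrow> w \<noteq> u \<Longrightarrow> w \<in> face u"
  by (simp add: face_def hull_inc)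

lemma face_sub_K: "face u \<subseteq> K"
  unfolding face_def K_def by (intro hull_mono) auto

lemma face_nonempty: "face u \<noteq> {}"
  using other_vertex[of u] vertex_in_face by blast

lemma affine_hull_K: "affine hull K = affine hull C"
  by (simp add: K_def)

lemma vertex_not_in_face: "u \<in> C \<Longrightarrow> u \<notin> affine hull (C - {u})"
  using indep by (auto simp: affine_dependent_def)

lemma face_inj:
  assumes "u \<in> C" "w \<in> C" "face u = face w"
  shows "u = w"
proof (rule ccontr)
  assume "u \<noteq> w"
  then have "u \<in> face u" using assms vertex_in_face[of u w] by simp
  then show False
    using vertex_not_in_face[OF assms(1)] convex_hull_subset_affine_hull[of "C - {u}"] by (auto simp: face_def)
qed

lemma K_combination:
  assumes "x \<in> K"
  obtains \<alpha> where "\<And>c. c \<in> C \<Longrightarrow> 0 \<le> \<alpha> c" "sum \<alpha> C = 1" "x = (\<Sum>c\<in>C. \<alpha> c *\<^sub>R c)"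
  using assms unfolding K_def convex_hull_finite[OF finite_C] by auto

lemma affine_combination:
  assumes "x \<in> affine hull K"
  obtains \<alpha> where "sum \<alpha> C = 1" "x = (\<Sum>c\<in>C. \<alpha> c *\<^sub>R c)"
  using assms unfolding affine_hull_K affine_hull_finite[OF finite_C] by auto

lemma tangent_combination:
  assumes "v \<in> tangent K"
  obtains \<delta> where "sum \<delta> C = 0" "v = (\<Sum>c\<in>C. \<delta> c *\<^sub>R c)"
proof -
  obtain x y where xy: "v = x - y" "x \<in> affine hull K" "y \<in> affine hull K"
    using assms by (auto simp: tangent_def)
  obtain \<alpha> where l: "sum \<alpha> C = 1" "x = (\<Sum>c\<in>C. \<alpha> c *\<^sub>R c)" using affine_combination[OF xy(2)] .
  obtain \<mu> where m: "sum \<mu> C = 1" "y = (\<Sum>c\<in>C. \<mu> c *\<^sub>R c)" using affine_combination[OF xy(3)] .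
  show thesis
    using l m xy(1) by (intro that[of "\<lambda>c. \<alpha> c - \<mu> c"]) (simp_all add: sum_subtractf scaleR_diff_left)
qed

text \<open>A vector orthogonal to all edges of \<open>face u\<close> sees of a tangent vector only its coefficient at \<open>u\<close>.\<close>

lemma tangent_inner:
  assumes u: "u \<in> C" and w: "w \<in> C - {u}" and orth: "\<And>c. c \<in> C - {u} \<Longrightarrow> (c - w) \<bullet> n = 0"
    and \<delta>: "sum \<delta> C = 0"
  shows "(\<Sum>c\<in>C. \<delta> c *\<^sub>R c) \<bullet> n = \<delta> u * ((u - w) \<bullet> n)"
proof -
  have "(\<Sum>c\<in>C. \<delta> c *\<^sub>R c) = (\<Sum>c\<in>C. \<delta> c *\<^sub>R (c - w))"
    using \<delta> by (simp add: scaleR_diff_right sum_subtractf flip: scaleR_sum_left)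
  then have "(\<Sum>c\<in>C. \<delta> c *\<^sub>R c) \<bullet> n = (\<Sum>c\<in>C. \<delta> c * ((c - w) \<bullet> n))"
    by (simp add: inner_sum_left)
  also have "\<dots> = \<delta> u * ((u - w) \<bullet> n) + (\<Sum>c\<in>C - {u}. \<delta> c * ((c - w) \<bullet> n))"
    using finite_C u by (rule sum.remove)
  also have "(\<Sum>c\<in>C - {u}. \<delta> c * ((c - w) \<bullet> n)) = 0"
    using orth by simp
  finally show ?thesis by simp
qed

text \<open>The component orthogonal to \<open>face u\<close> of an edge from the face to \<open>u\<close> is nonzero by affine independence; its length is
  the height over the face.\<close>

lemma normal_exists:
  assumes u: "u \<in> C"
  shows "\<exists>n h. h > 0 \<and> norm n = 1 \<and> n \<in> tangent K \<and> (\<forall>w\<in>C - {u}. (w - u) \<bullet> n = h)"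
proof -
  obtain w0 where w0: "w0 \<in> C - {u}" using other_vertex by blast
  let ?W = "tangent (C - {u})"
  have W: "subspace ?W" using w0 by (intro subspace_tangent) blast
  obtain y z where yz: "y \<in> span ?W" "\<And>w. w \<in> span ?W \<Longrightarrow> orthogonal z w" "u - w0 = y + z"
    using orthogonal_subspace_decomp_exists[of ?W "u - w0"] by metis
  have span: "span ?W = ?W" using W by (simp add: span_eq_iff)
  have z0: "z \<noteq> 0"
  proof
    assume "z = 0"
    then have "u = w0 + y" using yz(3) by (simp add: algebra_simps)
    moreover have "w0 + y \<in> affine hull (C - {u})"
      using w0 yz(1) span by (intro add_tangent hull_inc) auto
    ultimately have "u \<in> affine hull (C - {u})" by (simp only:)
    then show False using vertex_not_in_face u by blast
  qed
  have WK: "?W \<subseteq> tangent K"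
    by (rule tangent_mono) (auto simp: affine_hull_K intro: hull_mono[THEN subsetD])
  have "u - w0 \<in> tangent K"
    using u w0 C_sub_K by (intro diff_in_tangent hull_inc) auto
  then have zK: "z \<in> tangent K"
    using yz(1,3) WK span subspace_diff[OF subspace_tangent[OF K_nonempty], of "u - w0" y]
    by (auto simp: algebra_simps)
  let ?n = "- (z /\<^sub>R norm z)"
  have "(w - u) \<bullet> ?n = norm z" if w: "w \<in> C - {u}" for w
  proof -
    have "w0 - w \<in> ?W" using w w0 by (intro diff_in_tangent hull_inc) auto
    then have "z \<bullet> (w0 - w) = 0" "z \<bullet> y = 0"
      using yz(1,2) span by (auto simp: orthogonal_def)
    then have "(w0 - w) \<bullet> z = 0" "y \<bullet> z = 0" by (metis inner_commute)+
    then have "(u - w0) \<bullet> z = z \<bullet> z" "(w0 - w) \<bullet> z = 0"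
      unfolding yz(3) by (simp_all add: inner_add_left)
    then have "(u - w) \<bullet> z = z \<bullet> z" by (simp add: inner_diff_left)
    then have "(w - u) \<bullet> z = - (norm z * norm z)"
      by (simp add: inner_diff_left dot_square_norm power2_eq_square)
    then show ?thesis using z0 by simp
  qed
  moreover have "norm ?n = 1" using z0 by simp
  moreover have "?n \<in> tangent K"
    using zK subspace_tangent[OF K_nonempty] by (intro subspace_neg subspace_scale)
  moreover have "norm z > 0" using z0 by simp
  ultimately show ?thesis by (intro exI[of _ ?n] exI[of _ "norm z"]) blast
qed

lemma affine_combination_inner:
  assumes u: "u \<in> C" and h: "\<And>w. w \<in> C - {u} \<Longrightarrow> (w - u) \<bullet> n = h" and \<alpha>: "sum \<alpha> C = 1"
  shows "((\<Sum>c\<in>C. \<alpha> c *\<^sub>R c) - u) \<bullet> n = (1 - \<alpha> u) * h"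
proof -
  have "(\<Sum>c\<in>C. \<alpha> c *\<^sub>R c) - u = (\<Sum>c\<in>C. \<alpha> c *\<^sub>R (c - u))"
    using \<alpha> by (simp add: scaleR_diff_right sum_subtractf flip: scaleR_sum_left)
  then have "((\<Sum>c\<in>C. \<alpha> c *\<^sub>R c) - u) \<bullet> n = (\<Sum>c\<in>C. \<alpha> c * ((c - u) \<bullet> n))"
    by (simp add: inner_sum_left)
  also have "\<dots> = (\<Sum>c\<in>C - {u}. \<alpha> c * ((c - u) \<bullet> n))"
    using sum.remove[OF finite_C u, of "\<lambda>c. \<alpha> c * ((c - u) \<bullet> n)"] by simp
  also have "\<dots> = (\<Sum>c\<in>C - {u}. \<alpha> c) * h"
    using h by (simp add: sum_distrib_right)
  also have "(\<Sum>c\<in>C - {u}. \<alpha> c) = 1 - \<alpha> u"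
    using sum.remove[OF finite_C u, of \<alpha>] \<alpha> by simp
  finally show ?thesis .
qed

lemma face_inner:
  assumes u: "u \<in> C" and h: "\<And>w. w \<in> C - {u} \<Longrightarrow> (w - u) \<bullet> n = h" and x: "x \<in> face u"
  shows "(x - u) \<bullet> n = h"
proof -
  obtain \<alpha> where \<alpha>: "sum \<alpha> (C - {u}) = 1" "x = (\<Sum>c\<in>C - {u}. \<alpha> c *\<^sub>R c)"
    using x finite_C unfolding face_def by (subst (asm) convex_hull_finite) auto
  define \<mu> where "\<mu> c = (if c = u then 0 else \<alpha> c)" for c
  have "sum \<mu> C = 1" "(\<Sum>c\<in>C. \<mu> c *\<^sub>R c) = x"
    using \<alpha> sum.remove[OF finite_C u, of \<mu>] sum.remove[OF finite_C u, of "\<lambda>c. \<mu> c *\<^sub>R c"]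
    by (simp_all add: \<mu>_def)
  then show ?thesis using affine_combination_inner[OF u h, of \<mu>] by (simp add: \<mu>_def)
qed

text \<open>The conditions in the definition of the outer normal force orthogonality to the edges of the face; by
  \<open>tangent_inner\<close> the vector is then determined up to a nonnegative factor.\<close>

lemma outer_normal_eq:
  assumes u: "u \<in> C" and h: "h > 0" "norm n = 1" "n \<in> tangent K" "\<And>w. w \<in> C - {u} \<Longrightarrow> (w - u) \<bullet> n = h"
  shows "normal u = n"
  unfolding normal_def outer_normal_def
proof (rule the_equality)
  have "(y - x) \<bullet> n \<le> 0" if x: "x \<in> face u" and y: "y \<in> K" for x y
  proof -
    obtain \<alpha> where l: "\<And>c. c \<in> C \<Longrightarrow> 0 \<le> \<alpha> c" "sum \<alpha> C = 1" "y = (\<Sum>c\<in>C. \<alpha> c *\<^sub>R c)"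
      using K_combination[OF y] by blast
    have "(y - u) \<bullet> n = (1 - \<alpha> u) * h" using affine_combination_inner[OF u h(4) l(2)] l(3) by simp
    moreover have "(x - u) \<bullet> n = h" using face_inner[OF u h(4) x] .
    ultimately have "(y - x) \<bullet> n = - (\<alpha> u * h)" by (simp add: inner_diff_left algebra_simps)
    then show ?thesis using l(1)[OF u] h(1) by simp
  qed
  then show "norm n = 1 \<and> n \<in> tangent K \<and> (\<forall>x\<in>face u. \<forall>y\<in>K. (y - x) \<bullet> n \<le> 0)"
    using h by blast
next
  fix m assume m: "norm m = 1 \<and> m \<in> tangent K \<and> (\<forall>x\<in>face u. \<forall>y\<in>K. (y - x) \<bullet> m \<le> 0)"
  obtain w0 where w0: "w0 \<in> C - {u}" using other_vertex by blast
  have orth_m: "(c - w0) \<bullet> m = 0" if c: "c \<in> C - {u}" for c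
  proof -
    have "c \<in> face u" "w0 \<in> face u" using c w0 vertex_in_face by auto
    then have "(c - w0) \<bullet> m \<le> 0" "(w0 - c) \<bullet> m \<le> 0" using m face_sub_K by blast+
    then show ?thesis by (simp add: inner_diff_left)
  qed
  have orth_n: "(c - w0) \<bullet> n = 0" if c: "c \<in> C - {u}" for c
    using h(4)[OF c] h(4)[OF w0] by (simp add: inner_diff_left)
  define s where "s = (w0 - u) \<bullet> m / h"
  have "s \<ge> 0"
  proof -
    have "w0 \<in> face u" "u \<in> K" using w0 u vertex_in_face C_sub_K by auto
    then have "(u - w0) \<bullet> m \<le> 0" using m by blast
    then show ?thesis using h(1) by (simp add: s_def inner_diff_left)
  qed
  have eq: "v \<bullet> m = s * (v \<bullet> n)" if v: "v \<in> tangent K" for v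
  proof -
    obtain \<delta> where d: "sum \<delta> C = 0" "v = (\<Sum>c\<in>C. \<delta> c *\<^sub>R c)" by (rule tangent_combination[OF v])
    have "v \<bullet> m = \<delta> u * ((u - w0) \<bullet> m)" "v \<bullet> n = \<delta> u * ((u - w0) \<bullet> n)"
      unfolding d(2) using tangent_inner[OF u w0 _ d(1)] orth_m orth_n by blast+
    moreover have "(u - w0) \<bullet> m = - (s * h)" "(u - w0) \<bullet> n = - h"
      using h(1) h(4)[OF w0] by (simp_all add: s_def inner_diff_left)
    ultimately show ?thesis by simp
  qed
  have "m - s *\<^sub>R n \<in> tangent K"
    using m h(3) subspace_tangent[OF K_nonempty] by (intro subspace_diff subspace_scale) auto
  then have "(m - s *\<^sub>R n) \<bullet> (m - s *\<^sub>R n) = 0"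
    using eq[of "m - s *\<^sub>R n"] by (simp add: inner_diff_right)
  then have "m = s *\<^sub>R n" by simp
  moreover from this have "s = 1" using m h(2) \<open>s \<ge> 0\<close> by simp
  ultimately show "m = n" by simp
qed

lemma normal:
  assumes u: "u \<in> C"
  shows "norm (normal u) = 1" "normal u \<in> tangent K" "height u > 0"
    "w \<in> C - {u} \<Longrightarrow> (w - u) \<bullet> normal u = height u"
proof -
  obtain n h where nh: "h > 0" "norm n = 1" "n \<in> tangent K" "\<And>w. w \<in> C - {u} \<Longrightarrow> (w - u) \<bullet> n = h"
    using normal_exists[OF u] by blast
  have n: "normal u = n" by (rule outer_normal_eq[OF u nh])
  have "height u = h"
    unfolding height_def n using nh(4) other_vertex[of u] by (intro the_equality) auto
  then show "norm (normal u) = 1" "normal u \<in> tangent K" "height u > 0"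
    "w \<in> C - {u} \<Longrightarrow> (w - u) \<bullet> normal u = height u"
    using n nh by auto
qed

lemma face_height: "u \<in> C \<Longrightarrow> x \<in> face u \<Longrightarrow> (x - u) \<bullet> normal u = height u"
  using face_inner normal(4) by blast

lemma face_orthogonal: "u \<in> C \<Longrightarrow> x \<in> face u \<Longrightarrow> y \<in> face u \<Longrightarrow> (x - y) \<bullet> normal u = 0"
  using face_height[of u x] face_height[of u y] by (simp add: inner_diff_left)

lemma combination_height:
  "u \<in> C \<Longrightarrow> sum \<alpha> C = 1 \<Longrightarrow> ((\<Sum>c\<in>C. \<alpha> c *\<^sub>R c) - u) \<bullet> normal u = (1 - \<alpha> u) * height u"
  using affine_combination_inner normal(4) by blast

lemma tangent_height:
  assumes u: "u \<in> C" and d: "sum \<delta> C = 0"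
  shows "(\<Sum>c\<in>C. \<delta> c *\<^sub>R c) \<bullet> normal u = - (\<delta> u * height u)"
proof -
  obtain w where w: "w \<in> C - {u}" using other_vertex by blast
  have "(c - w) \<bullet> normal u = 0" if "c \<in> C - {u}" for c
    using normal(4)[OF u that] normal(4)[OF u w] by (simp add: inner_diff_left)
  from tangent_inner[OF u w this d] normal(4)[OF u w] show ?thesis
    by (simp add: inner_diff_left algebra_simps)
qed

text \<open>The basis function of \<open>face u\<close>: for \<open>x\<close> on any other face, \<open>x - u\<close> is parallel to that face.\<close>

definition phi :: "'a \<Rightarrow> 'a \<Rightarrow> 'a"
  where "phi u = (\<lambda>x. (1 / height u) *\<^sub>R (x - u))"

lemma phi_RT0: "u \<in> C \<Longrightarrow> phi u \<in> RT0 K"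
  using C_sub_K RT0_iff[of u K "phi u"] subspace_0[OF subspace_tangent[OF K_nonempty]]
  by (force simp: phi_def)

lemma phi_normal:
  assumes "u \<in> C" "w \<in> C" "x \<in> face w"
  shows "phi u x \<bullet> normal w = (if w = u then 1 else 0)"
  using assms face_height[of u x] normal(3)[of u] face_orthogonal[of w x u] vertex_in_face[of u w]
  by (auto simp: phi_def)

lemma RT0_constant_normal:
  assumes "v \<in> RT0 K" "u \<in> C" "x \<in> face u" "y \<in> face u"
  shows "v x \<bullet> normal u = v y \<bullet> normal u"
proof -
  obtain a b c where v: "v = (\<lambda>x. a + b *\<^sub>R (x - c))" using assms(1) by (auto simp: RT0_def)
  have "v x - v y = b *\<^sub>R (x - y)" unfolding v by (simp add: algebra_simps)
  then have "(v x - v y) \<bullet> normal u = 0" using face_orthogonal[OF assms(2-4)] by simp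
  then show ?thesis by (simp add: inner_diff_left)
qed

lemma RT0_nflux:
  assumes "v \<in> RT0 K" "u \<in> C" "x \<in> face u"
  shows "v x \<bullet> normal u = nflux v K (face u)"
proof -
  have "nflux v K (face u) = v x \<bullet> normal u"
    unfolding nflux_def normal_def[symmetric]
  proof (rule the_equality)
    show "\<forall>y\<in>face u. v y \<bullet> normal u = v x \<bullet> normal u"
      using RT0_constant_normal[OF assms(1,2) _ assms(3)] by blast
  qed (use assms(3) in auto)
  then show ?thesis by simp
qed

text \<open>At a vertex \<open>p\<close> the field is tangential and orthogonal to the normals of all faces through \<open>p\<close>, which forces its
  coefficients at all other vertices to vanish. A field vanishing at two points is zero.\<close>

lemma RT0_unisolvent:
  assumes v: "v \<in> RT0 K" and 0: "\<And>u. u \<in> C \<Longrightarrow> nflux v K (face u) = 0"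
  shows "v = 0"
proof -
  have vp: "v p = 0" if p: "p \<in> C" for p
  proof -
    have "v p \<in> tangent K" using RT0_in_tangent[OF v] p C_sub_K by blast
    then obtain \<delta> where d: "sum \<delta> C = 0" "v p = (\<Sum>c\<in>C. \<delta> c *\<^sub>R c)" using tangent_combination by blast
    have d0: "\<delta> w = 0" if w: "w \<in> C - {p}" for w
    proof -
      have "v p \<bullet> normal w = 0"
        using RT0_nflux[OF v, of w p] 0[of w] vertex_in_face[OF p, of w] w by auto
      then have "\<delta> w * height w = 0" using tangent_height[of w \<delta>] w d by simp
      then show ?thesis using normal(3)[of w] w by simp
    qed
    then have "\<delta> p = 0" using d(1) sum.remove[OF finite_C p, of \<delta>] by simp
    then have "\<delta> c = 0" if "c \<in> C" for c using d0 that by (cases "c = p") auto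
    then show ?thesis using d(2) by simp
  qed
  obtain p q where pq: "p \<in> C" "q \<in> C" "q \<noteq> p" using other_vertex by blast
  obtain a b where ab: "v = (\<lambda>x. a + b *\<^sub>R (x - p))"
    using v RT0_iff[of p K] pq(1) C_sub_K by blast
  have "a = 0" using vp[OF pq(1)] ab by simp
  moreover have "b = 0" using vp[OF pq(2)] ab \<open>a = 0\<close> pq(3) by simp
  ultimately show ?thesis using ab by (simp add: fun_eq_iff)
qed

lemma nflux_add:
  assumes "v \<in> RT0 K" "v' \<in> RT0 K" "u \<in> C"
  shows "nflux (v + v') K (face u) = nflux v K (face u) + nflux v' K (face u)"
proof -
  obtain x where x: "x \<in> face u" using face_nonempty by blast
  have "v + v' \<in> RT0 K" using assms(1,2) RT0_subspace[OF K_nonempty] by (rule_tac subspace_add)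
  from RT0_nflux[OF this assms(3) x] RT0_nflux[OF assms(1,3) x] RT0_nflux[OF assms(2,3) x]
  show ?thesis by (simp add: inner_add_left)
qed

lemma nflux_scale:
  assumes "v \<in> RT0 K" "u \<in> C"
  shows "nflux (c *\<^sub>R v) K (face u) = c * nflux v K (face u)"
proof -
  obtain x where x: "x \<in> face u" using face_nonempty by blast
  have "c *\<^sub>R v \<in> RT0 K" using assms(1) RT0_subspace[OF K_nonempty] by (rule_tac subspace_scale)
  from RT0_nflux[OF this assms(2) x] RT0_nflux[OF assms x]
  show ?thesis by (simp add: scaleR_fun_def)
qed

lemma nflux_phi: "u \<in> C \<Longrightarrow> w \<in> C \<Longrightarrow> nflux (phi u) K (face w) = (if w = u then 1 else 0)"
  using RT0_nflux[OF phi_RT0, of u w] phi_normal face_nonempty[of w] by force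

lemma RT0_ext:
  assumes v: "v \<in> RT0 K" "v' \<in> RT0 K" and eq: "\<And>u. u \<in> C \<Longrightarrow> nflux v K (face u) = nflux v' K (face u)"
  shows "v = v'"
proof -
  have m: "(-1) *\<^sub>R v' \<in> RT0 K" using v(2) RT0_subspace[OF K_nonempty] by (intro subspace_scale)
  have "v + (-1) *\<^sub>R v' = 0"
  proof (rule RT0_unisolvent)
    show "v + (-1) *\<^sub>R v' \<in> RT0 K" using v(1) m RT0_subspace[OF K_nonempty] by (intro subspace_add)
    show "nflux (v + (-1) *\<^sub>R v') K (face u) = 0" if "u \<in> C" for u
      using nflux_add[OF v(1) m that] nflux_scale[OF v(2) that, of "-1"] eq[OF that] by simp
  qed
  then show ?thesis by simp
qed

lemma RT0_basis_eq: "u \<in> C \<Longrightarrow> RT0_basis K (face u) = phi u"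
  unfolding RT0_basis_def
proof (rule the_equality)
  assume u: "u \<in> C"
  show P: "phi u \<in> RT0 K \<and> (\<forall>g. g facet_of K \<longrightarrow> (\<forall>x\<in>g. phi u x \<bullet> outer_normal K g = (if g = face u then 1 else 0)))"
  proof (intro conjI allI impI ballI phi_RT0[OF u])
    fix g x assume "g facet_of K" and x: "x \<in> g"
    then obtain w where w: "w \<in> C" "g = face w" using facet_iff by blast
    then show "phi u x \<bullet> outer_normal K g = (if g = face u then 1 else 0)"
      using phi_normal[OF u w(1)] face_inj[OF u w(1)] x by (auto simp: normal_def[symmetric])
  qed
  fix v assume v: "v \<in> RT0 K \<and> (\<forall>g. g facet_of K \<longrightarrow> (\<forall>x\<in>g. v x \<bullet> outer_normal K g = (if g = face u then 1 else 0)))"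
  show "v = phi u"
  proof (rule RT0_ext)
    fix w assume w: "w \<in> C"
    obtain x where x: "x \<in> face w" using face_nonempty by blast
    have "face w facet_of K" using w facet_iff by blast
    then have "v x \<bullet> normal w = phi u x \<bullet> normal w"
      using v P x by (simp add: normal_def)
    then show "nflux v K (face w) = nflux (phi u) K (face w)"
      using RT0_nflux w x v phi_RT0[OF u] by simp
  qed (use v phi_RT0[OF u] in auto)
qed

text \<open>The numerator \<open>x - u\<close> is at most the diameter, the height at least the radius \<open>r\<close> of an inscribed ball: moving from the centre
  by \<open>r\<close> against the normal stays in the simplex, and \<open>height u\<close> times the barycentric coordinate at \<open>u\<close> grows by \<open>r\<close>
  but does not exceed \<open>height u\<close>.\<close>

lemma phi_bounded:
  assumes u: "u \<in> C" and sr: "shape_regular \<sigma> K" and x: "x \<in> K"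
  shows "norm (phi u x) \<le> \<sigma>"
proof -
  obtain r c where r: "r > 0" "c \<in> K" "cball c r \<inter> affine hull K \<subseteq> K" "diameter K \<le> \<sigma> * r"
    using sr by (auto simp: shape_regular_def)
  let ?n = "normal u"
  have "c + (- r) *\<^sub>R ?n \<in> affine hull K"
    using r(2) normal(2)[OF u] subspace_tangent[OF K_nonempty]
    by (intro add_tangent subspace_scale) (auto intro: hull_inc)
  moreover have "c + (- r) *\<^sub>R ?n \<in> cball c r" using r(1) normal(1)[OF u] by (simp add: dist_norm)
  ultimately have "c + (- r) *\<^sub>R ?n \<in> K" using r(3) by blast
  then obtain \<alpha> where l: "\<And>c. c \<in> C \<Longrightarrow> 0 \<le> \<alpha> c" "sum \<alpha> C = 1" "c + (- r) *\<^sub>R ?n = (\<Sum>c\<in>C. \<alpha> c *\<^sub>R c)"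
    using K_combination by blast
  obtain \<mu> where m: "\<And>c. c \<in> C \<Longrightarrow> 0 \<le> \<mu> c" "sum \<mu> C = 1" "c = (\<Sum>c\<in>C. \<mu> c *\<^sub>R c)"
    using K_combination[OF r(2)] by blast
  have lu: "\<alpha> u \<le> 1" using member_le_sum[of u C \<alpha>] l(1,2) u finite_C by simp
  have "(c + (- r) *\<^sub>R ?n - u) \<bullet> ?n = (1 - \<alpha> u) * height u"
    using combination_height[OF u l(2)] l(3) by simp
  moreover have "(c - u) \<bullet> ?n = (1 - \<mu> u) * height u"
    using combination_height[OF u m(2)] m(3) by simp
  moreover have "?n \<bullet> ?n = 1" using normal(1)[OF u] by (simp add: dot_square_norm)
  ultimately have "r = (\<alpha> u - \<mu> u) * height u" by (simp add: inner_diff_left inner_add_left algebra_simps)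
  also have "\<dots> \<le> 1 * height u" using lu m(1)[OF u] normal(3)[OF u] by (intro mult_right_mono) auto
  finally have rh: "r \<le> height u" by simp
  have "bounded K" unfolding K_def using finite_C by (simp add: bounded_convex_hull finite_imp_bounded)
  then have "norm (x - u) \<le> diameter K"
    using diameter_bounded_bound[of K x u] x u C_sub_K by (auto simp: dist_norm)
  moreover have "0 \<le> \<sigma>"
    using diameter_ge_0[OF \<open>bounded K\<close>] r(1,4) by (meson dual_order.trans zero_le_mult_iff less_le_not_le)
  moreover from this have "\<sigma> * r \<le> \<sigma> * height u" using rh by (rule mult_left_mono[rotated])
  ultimately have "norm (x - u) \<le> \<sigma> * height u" using r(4) by linarith
  moreover have "norm (phi u x) = norm (x - u) / height u" using normal(3)[OF u] by (simp add: phi_def)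
  ultimately show ?thesis using normal(3)[OF u] by (simp add: pos_divide_le_eq)
qed

text \<open>In barycentric coordinates: \<open>x\<close> has positive coefficients except for \<open>0\<close> at \<open>u\<close>, and the coefficient of
  the inner normal at \<open>u\<close> is \<open>1 / height u\<close>.\<close>

lemma inward_rel_interior:
  assumes u: "u \<in> C" and x: "x \<in> rel_interior (face u)"
  shows "\<forall>\<^sub>F t in at_right 0. x - t *\<^sub>R normal u \<in> rel_interior K"
proof -
  have "\<not> affine_dependent (C - {u})" using indep affine_independent_Diff by blast
  then obtain l where l: "\<And>c. c \<in> C - {u} \<Longrightarrow> 0 < l c" "sum l (C - {u}) = 1" "x = (\<Sum>c\<in>C - {u}. l c *\<^sub>R c)"
    using x unfolding face_def by (subst (asm) rel_interior_convex_hull_explicit) auto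
  define \<alpha> where "\<alpha> c = (if c = u then 0 else l c)" for c
  have \<alpha>: "sum \<alpha> C = 1" "(\<Sum>c\<in>C. \<alpha> c *\<^sub>R c) = x"
    using l sum.remove[OF finite_C u, of \<alpha>] sum.remove[OF finite_C u, of "\<lambda>c. \<alpha> c *\<^sub>R c"]
    by (simp_all add: \<alpha>_def)
  obtain \<delta> where d: "sum \<delta> C = 0" "normal u = (\<Sum>c\<in>C. \<delta> c *\<^sub>R c)"
    using tangent_combination[OF normal(2)[OF u]] .
  have "normal u \<bullet> normal u = 1" using normal(1)[OF u] by (simp add: dot_square_norm)
  then have "\<delta> u * height u = - 1" using tangent_height[OF u d(1)] d(2) by simp
  then have du: "\<delta> u < 0" using normal(3)[OF u]
    by (metis less_minus_one_simps(1) linorder_not_less mult_nonneg_nonneg order_less_imp_le)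
  have "\<forall>\<^sub>F t in at_right 0. 0 < \<alpha> c - t * \<delta> c" if c: "c \<in> C" for c
  proof (cases "c = u")
    case True
    have "\<forall>\<^sub>F t::real in at_right 0. 0 < t" by (rule eventually_at_right_less)
    then show ?thesis by eventually_elim (use True du in \<open>simp add: \<alpha>_def mult_less_0_iff\<close>)
  next
    case False
    have "((\<lambda>t. \<alpha> c - t * \<delta> c) \<longlongrightarrow> \<alpha> c - 0 * \<delta> c) (at_right 0)" by (intro tendsto_intros)
    moreover have "0 < \<alpha> c - 0 * \<delta> c" using l(1)[of c] c False by (simp add: \<alpha>_def)
    ultimately show ?thesis by (rule order_tendstoD(1))
  qed
  then have "\<forall>\<^sub>F t in at_right 0. \<forall>c\<in>C. 0 < \<alpha> c - t * \<delta> c"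
    using finite_C by (simp add: eventually_ball_finite)
  then show ?thesis
  proof eventually_elim
    case (elim t)
    have "sum (\<lambda>c. \<alpha> c - t * \<delta> c) C = 1" using \<alpha>(1) d(1) by (simp add: sum_subtractf flip: sum_distrib_left)
    moreover have "(\<Sum>c\<in>C. (\<alpha> c - t * \<delta> c) *\<^sub>R c) = x - t *\<^sub>R normal u"
      using \<alpha>(2) d(2) by (simp add: scaleR_diff_left sum_subtractf scaleR_sum_right)
    ultimately show ?case
      unfolding K_def rel_interior_convex_hull_explicit[OF indep]
      using elim by (intro CollectI exI[of _ "\<lambda>c. \<alpha> c - t * \<delta> c"] conjI) blast+
  qed
qed

end

text \<open>The same facts in terms of facets instead of vertices. Points have no facets, hence the bound on the dimension.\<close>

context
  fixes T :: "'a::euclidean_space set" and n :: int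
  assumes simplex: "n simplex T" and n: "1 \<le> n"
begin

lemma simplex_vertices_exist: "\<exists>C. simplex_vertices C \<and> T = simplex_vertices.K C \<and> int (card C) = n + 1"
proof -
  obtain C where C: "\<not> affine_dependent C" "int (card C) = n + 1" "T = convex hull C"
    using simplex by (auto simp: simplex_def)
  then have "simplex_vertices C" using n by unfold_locales auto
  then show ?thesis using C simplex_vertices.K_def by blast
qed

lemma simplex_compact: "compact T" and simplex_convex: "convex T"
proof -
  obtain C where "\<not> affine_dependent C" "T = convex hull C" using simplex by (auto simp: simplex_def)
  then show "compact T" "convex T"
    using aff_independent_finite by (auto intro: compact_convex_hull finite_imp_compact)
qed

lemma simplex_facets: "finite {f. f facet_of T}" "int (card {f. f facet_of T}) \<le> n + 1"
proof -
  obtain C where C: "simplex_vertices C" "T = simplex_vertices.K C" "int (card C) = n + 1"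
    using simplex_vertices_exist by blast
  interpret simplex_vertices C by fact
  have "{f. f facet_of T} = face ` C" using facet_iff C(2) by auto
  then show "finite {f. f facet_of T}" "int (card {f. f facet_of T}) \<le> n + 1"
    using finite_C card_image_le[OF finite_C, of face] C(3) by auto
qed

lemma simplex_nonempty: "T \<noteq> {}"
  using simplex_vertices_exist simplex_vertices.K_nonempty by metis

lemma facet_nonempty: "f facet_of T \<Longrightarrow> f \<noteq> {}"
  by (simp add: facet_of_def)

lemma outer_normal_facet:
  assumes "f facet_of T"
  shows "norm (outer_normal T f) = 1" "outer_normal T f \<in> tangent T"
proof -
  obtain C where C: "simplex_vertices C" "T = simplex_vertices.K C" using simplex_vertices_exist by blast
  interpret simplex_vertices C by fact
  show "norm (outer_normal T f) = 1" "outer_normal T f \<in> tangent T"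
    using assms normal(1,2) unfolding C(2) facet_iff by (auto simp: normal_def)
qed

lemma nflux_eq:
  assumes "v \<in> RT0 T" "f facet_of T" "x \<in> f"
  shows "v x \<bullet> outer_normal T f = nflux v T f"
proof -
  obtain C where C: "simplex_vertices C" "T = simplex_vertices.K C" using simplex_vertices_exist by blast
  interpret simplex_vertices C by fact
  show ?thesis using assms RT0_nflux unfolding C(2) facet_iff by (auto simp: normal_def)
qed

lemma nflux_linear:
  assumes "v \<in> RT0 T" "f facet_of T"
  shows "w \<in> RT0 T \<Longrightarrow> nflux (v + w) T f = nflux v T f + nflux w T f"
    and "nflux (c *\<^sub>R v) T f = c * nflux v T f"
proof -
  obtain C where C: "simplex_vertices C" "T = simplex_vertices.K C" using simplex_vertices_exist by blast
  interpret simplex_vertices C by fact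
  show "w \<in> RT0 T \<Longrightarrow> nflux (v + w) T f = nflux v T f + nflux w T f" "nflux (c *\<^sub>R v) T f = c * nflux v T f"
    using assms nflux_add nflux_scale unfolding C(2) facet_iff by auto
qed

lemma RT0_basis_in: "f facet_of T \<Longrightarrow> RT0_basis T f \<in> RT0 T"
  and nflux_RT0_basis: "f facet_of T \<Longrightarrow> g facet_of T \<Longrightarrow> nflux (RT0_basis T f) T g = (if g = f then 1 else 0)"
proof -
  obtain C where C: "simplex_vertices C" "T = simplex_vertices.K C" using simplex_vertices_exist by blast
  interpret simplex_vertices C by fact
  show "f facet_of T \<Longrightarrow> RT0_basis T f \<in> RT0 T"
    using phi_RT0 unfolding C(2) facet_iff by (auto simp: RT0_basis_eq)
  assume "f facet_of T" "g facet_of T"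
  then obtain u w where "u \<in> C" "f = face u" "w \<in> C" "g = face w" unfolding C(2) facet_iff by blast
  then show "nflux (RT0_basis T f) T g = (if g = f then 1 else 0)"
    using nflux_phi[of u w] face_inj[of w u] unfolding C(2) by (auto simp: RT0_basis_eq)
qed

lemma RT0_eqI:
  assumes "v \<in> RT0 T" "w \<in> RT0 T" "\<And>f. f facet_of T \<Longrightarrow> nflux v T f = nflux w T f"
  shows "v = w"
proof -
  obtain C where C: "simplex_vertices C" "T = simplex_vertices.K C" using simplex_vertices_exist by blast
  interpret simplex_vertices C by fact
  show ?thesis using assms RT0_ext[of v w] unfolding C(2) facet_iff by blast
qed

lemma RT0_combination:
  fixes c :: "'a set \<Rightarrow> real"
  defines "w \<equiv> \<Sum>f | f facet_of T. c f *\<^sub>R RT0_basis T f"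
  shows "w \<in> RT0 T" "g facet_of T \<Longrightarrow> nflux w T g = c g"
proof -
  note sub = RT0_subspace[OF simplex_nonempty]
  show w: "w \<in> RT0 T"
    unfolding w_def by (intro subspace_sum[OF sub] subspace_scale[OF sub] RT0_basis_in) simp
  assume g: "g facet_of T"
  obtain x where x: "x \<in> g" using facet_nonempty[OF g] by blast
  have sum_apply: "(\<Sum>f\<in>A. c f *\<^sub>R RT0_basis T f) x = (\<Sum>f\<in>A. c f *\<^sub>R RT0_basis T f x)" if "finite A" for A
    using that by (induction A rule: finite_induct) (auto simp: scaleR_fun_def)
  have "nflux w T g = w x \<bullet> outer_normal T g" using nflux_eq[OF w g x] by simp
  also have "\<dots> = (\<Sum>f | f facet_of T. c f * (RT0_basis T f x \<bullet> outer_normal T g))"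
    unfolding w_def sum_apply[OF simplex_facets(1)] by (simp add: inner_sum_left)
  also have "\<dots> = (\<Sum>f | f facet_of T. c f * (if g = f then 1 else 0))"
  proof (intro sum.cong refl)
    fix f assume "f \<in> {f. f facet_of T}"
    then have f: "f facet_of T" by simp
    show "c f * (RT0_basis T f x \<bullet> outer_normal T g) = c f * (if g = f then 1 else 0)"
      unfolding nflux_eq[OF RT0_basis_in[OF f] g x] nflux_RT0_basis[OF f g] ..
  qed
  also have "\<dots> = c g" using simplex_facets(1) g by (simp add: if_distrib cong: if_cong)
  finally show "nflux w T g = c g" .
qed

lemma RT0_expansion:
  assumes v: "v \<in> RT0 T"
  shows "v x = (\<Sum>f | f facet_of T. nflux v T f *\<^sub>R RT0_basis T f x)"
proof -
  have eq: "v = (\<Sum>f | f facet_of T. nflux v T f *\<^sub>R RT0_basis T f)"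
    by (rule RT0_eqI[OF v RT0_combination(1)]) (simp add: RT0_combination(2))
  have "(\<Sum>f\<in>A. nflux v T f *\<^sub>R RT0_basis T f) x = (\<Sum>f\<in>A. nflux v T f *\<^sub>R RT0_basis T f x)" if "finite A" for A
    using that by (induction A rule: finite_induct) (auto simp: scaleR_fun_def)
  from this[OF simplex_facets(1)] show ?thesis using fun_cong[OF eq, of x] by simp
qed

lemma RT0_basis_bounded: "f facet_of T \<Longrightarrow> shape_regular \<sigma> T \<Longrightarrow> x \<in> T \<Longrightarrow> norm (RT0_basis T f x) \<le> \<sigma>"
proof -
  obtain C where C: "simplex_vertices C" "T = simplex_vertices.K C" using simplex_vertices_exist by blast
  interpret simplex_vertices C by fact
  show "f facet_of T \<Longrightarrow> shape_regular \<sigma> T \<Longrightarrow> x \<in> T \<Longrightarrow> norm (RT0_basis T f x) \<le> \<sigma>"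
    using phi_bounded unfolding C(2) facet_iff by (auto simp: RT0_basis_eq)
qed

lemma facet_inward:
  assumes "f facet_of T" "x \<in> rel_interior f"
  shows "\<forall>\<^sub>F t in at_right 0. x - t *\<^sub>R outer_normal T f \<in> rel_interior T"
proof -
  obtain C where C: "simplex_vertices C" "T = simplex_vertices.K C" using simplex_vertices_exist by blast
  interpret simplex_vertices C by fact
  show ?thesis using assms inward_rel_interior unfolding C(2) facet_iff by (auto simp: normal_def)
qed

end

section \<open>The weighted mass matrix of an element and its diagonal\<close>

lemma set_integral_sum:
  fixes f :: "'i \<Rightarrow> 'a \<Rightarrow> real"
  assumes "\<And>i. i \<in> I \<Longrightarrow> set_integrable F A (f i)"
  shows "set_integrable F A (\<lambda>x. \<Sum>i\<in>I. f i x)" "(LINT x:A|F. \<Sum>i\<in>I. f i x) = (\<Sum>i\<in>I. LINT x:A|F. f i x)"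
  using assms unfolding set_integrable_def set_lebesgue_integral_def scaleR_sum_right
  by (auto intro: Bochner_Integration.integrable_sum Bochner_Integration.integral_sum)

lemma (in psd_form) sum_self_le:
  assumes "finite I" "\<And>i. i \<in> I \<Longrightarrow> x i \<in> V"
  shows "a (sum x I) (sum x I) \<le> card I * (\<Sum>i\<in>I. a (x i) (x i))"
proof -
  have lin: "sum x J \<in> V \<and> (\<forall>z\<in>V. a (sum x J) z = (\<Sum>i\<in>J. a (x i) z))" if "J \<subseteq> I" for J
    using finite_subset[OF that assms(1)] that
    by (induction J rule: finite_induct) (auto simp: zero_left add_left assms(2))
  have "a (sum x I) (sum x I) = (\<Sum>i\<in>I. \<Sum>j\<in>I. a (x i) (x j))"
  proof -
    have "a (x i) (sum x I) = (\<Sum>j\<in>I. a (x i) (x j))" if i: "i \<in> I" for i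
    proof -
      have "a (x i) (sum x I) = a (sum x I) (x i)" using lin[of I] assms(2)[OF i] sym by blast
      also have "\<dots> = (\<Sum>j\<in>I. a (x j) (x i))" using lin[of I] assms(2)[OF i] by blast
      also have "\<dots> = (\<Sum>j\<in>I. a (x i) (x j))"
        by (rule sum.cong[OF refl]) (rule sym[OF assms(2) assms(2)[OF i]])
      finally show ?thesis .
    qed
    moreover have "a (sum x I) (sum x I) = (\<Sum>i\<in>I. a (x i) (sum x I))" using lin[of I] by blast
    ultimately show ?thesis by simp
  qed
  also have "\<dots> \<le> (\<Sum>i\<in>I. \<Sum>j\<in>I. (a (x i) (x i) + a (x j) (x j)) / 2)"
  proof (intro sum_mono)
    fix i j assume ij: "i \<in> I" "j \<in> I"
    have "0 \<le> a (x i - x j) (x i - x j)" using assms(2) ij by (intro nonneg) auto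
    then show "a (x i) (x j) \<le> (a (x i) (x i) + a (x j) (x j)) / 2"
      using assms(2) ij sym[of "x j" "x i"] by (simp add: diff_left diff_right)
  qed
  also have "\<dots> = card I * (\<Sum>i\<in>I. a (x i) (x i))"
    by (simp add: add_divide_distrib sum.distrib sum_distrib_left sum_divide_distrib[symmetric])
  finally show ?thesis .
qed

text \<open>The inverse of an elliptic map on a subspace \<open>W\<close> is specified on \<open>W\<close> only; that it agrees there with a globally
  linear map makes the integrands below continuous. The lower bound for the inverse is the upper bound for \<open>K\<close>, combined
  with Cauchy--Schwarz for the form of \<open>K\<close> at \<open>x\<close> and \<open>K x\<close>.\<close>

lemma elliptic_inverse:
  fixes K :: "'a::euclidean_space \<Rightarrow> 'a"
  assumes W: "subspace W" and lin: "linear K" and KW: "K ` W \<subseteq> W"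
    and K_sym: "\<And>x y. x \<in> W \<Longrightarrow> y \<in> W \<Longrightarrow> K x \<bullet> y = x \<bullet> K y"
    and k: "k > 0" and lower: "\<And>x. x \<in> W \<Longrightarrow> k * (norm x)\<^sup>2 \<le> K x \<bullet> x"
    and upper: "\<And>x. x \<in> W \<Longrightarrow> K x \<bullet> x \<le> \<theta> * k * (norm x)\<^sup>2"
  shows "\<exists>L. linear L \<and> (\<forall>y\<in>W. inv_into W K y = L y) \<and> psd_form W (\<lambda>x y. L x \<bullet> y) \<and>
    (\<forall>y\<in>W. k * (L y \<bullet> y) \<le> (norm y)\<^sup>2 \<and> (norm y)\<^sup>2 \<le> \<theta> * k * (L y \<bullet> y))"
proof -
  have inj0: "x = 0" if "x \<in> W" "K x = 0" for x
  proof -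
    have "k * (norm x)\<^sup>2 \<le> 0" using lower[OF that(1)] that(2) by simp
    then show ?thesis using k by (simp add: mult_le_0_iff)
  qed
  have inj: "inj_on K W"
    using linear_injective_on_subspace_0[OF lin W] inj0 by blast
  have surj: "K ` W = W"
  proof (rule injective_endomorphism_surjective[OF W _ finite_Basis KW])
    show "W \<subseteq> span Basis" by simp
  qed (use lin inj0 in \<open>auto simp: linear_add linear_scale\<close>)
  obtain L where L: "range L \<subseteq> W" "linear L" "\<And>x. x \<in> W \<Longrightarrow> L (K x) = x"
    using linear_exists_left_inverse_on[OF lin W inj] by blast
  have LK: "\<exists>x\<in>W. y = K x \<and> L y = x" if "y \<in> W" for y
    using that surj L(3) by (metis imageE)
  interpret K: psd_form W "\<lambda>x y. K x \<bullet> y"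
  proof
    show "0 \<le> K x \<bullet> x" if "x \<in> W" for x
      using lower[OF that] k by (meson dual_order.trans mult_nonneg_nonneg less_imp_le zero_le_power2)
    show "K x \<bullet> y = K y \<bullet> x" if "x \<in> W" "y \<in> W" for x y
      using K_sym[OF that] by (simp add: inner_commute)
  qed (use W lin in \<open>auto simp: linear_add linear_scale inner_add_left\<close>)
  have L_sym: "L x \<bullet> y = L y \<bullet> x" if "x \<in> W" "y \<in> W" for x y
    using LK[OF that(1)] LK[OF that(2)] K_sym by (metis inner_commute)
  show ?thesis
  proof (intro exI[of _ L] conjI ballI L(2))
    show "inv_into W K y = L y" if "y \<in> W" for y
      using LK[OF that] inv_into_f_f[OF inj] by metis
    show "psd_form W (\<lambda>x y. L x \<bullet> y)"
    proof
      show "0 \<le> L y \<bullet> y" if "y \<in> W" for y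
        using LK[OF that] K.nonneg by (metis inner_commute)
    qed (use W L_sym L(2) in \<open>auto simp: linear_add linear_scale inner_add_left\<close>)
    fix y assume y: "y \<in> W"
    obtain x where x: "x \<in> W" "y = K x" "L y = x" using LK[OF y] by blast
    have pos: "0 \<le> K x \<bullet> x" using K.nonneg[OF x(1)] .
    have "k * norm x * norm x \<le> norm y * norm x"
      using lower[OF x(1)] norm_cauchy_schwarz[of "K x" x] x(2) by (simp add: power2_eq_square)
    then have kx: "k * norm x \<le> norm y"
      using mult_right_le_imp_le[of "k * norm x" "norm x" "norm y"] by (cases "x = 0") auto
    have "L y \<bullet> y \<le> norm x * norm y" using norm_cauchy_schwarz x(3) by blast
    then have "k * (L y \<bullet> y) \<le> (k * norm x) * norm y" using k by simp
    also have "\<dots> \<le> norm y * norm y" using kx by (rule mult_right_mono) simp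
    finally show "k * (L y \<bullet> y) \<le> (norm y)\<^sup>2" by (simp add: power2_eq_square)
    have "(K x \<bullet> K x)\<^sup>2 \<le> (K x \<bullet> x) * (K (K x) \<bullet> K x)"
      using K.Cauchy_Schwarz[OF x(1), of "K x"] KW x(1) by blast
    also have "\<dots> \<le> (K x \<bullet> x) * (\<theta> * k * (norm y)\<^sup>2)"
      using upper[OF y] pos x(2) by (intro mult_left_mono) auto
    finally have "(norm y)\<^sup>2 * (norm y)\<^sup>2 \<le> (\<theta> * k * (K x \<bullet> x)) * (norm y)\<^sup>2"
      using x(2) by (simp add: dot_square_norm power2_eq_square ac_simps)
    then have "(norm y)\<^sup>2 \<le> \<theta> * k * (K x \<bullet> x)" if "y \<noteq> 0"
      using that mult_right_le_imp_le[of "(norm y)\<^sup>2" "(norm y)\<^sup>2" "\<theta> * k * (K x \<bullet> x)"] by simp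
    moreover have "K x \<bullet> x = L y \<bullet> y" using x by (simp add: inner_commute)
    ultimately show "(norm y)\<^sup>2 \<le> \<theta> * k * (L y \<bullet> y)"
      by (cases "y = 0") (auto simp: linear_0[OF L(2)])
  qed
qed

context
  fixes S T :: "'a::euclidean_space set" and n :: int and L :: "'a \<Rightarrow> 'a" and k \<theta> \<sigma> :: real
  assumes simplex: "n simplex T" and n: "1 \<le> n" and hull: "affine hull T = affine hull S"
    and L: "linear L" and psd: "psd_form (tangent S) (\<lambda>x y. L x \<bullet> y)"
begin

interpretation psd: psd_form "tangent S" "\<lambda>x y. L x \<bullet> y" by (rule psd)

lemma RT0_tangent: "v \<in> RT0 T \<Longrightarrow> x \<in> T \<Longrightarrow> v x \<in> tangent S"
  using RT0_in_tangent tangent_cong[OF hull] by blast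

lemma S_nonempty: "S \<noteq> {}"
  using hull simplex_nonempty[OF simplex n] by auto

lemma set_integrable_RT0:
  assumes "u \<in> RT0 T" "v \<in> RT0 T"
  shows "set_integrable (flat_measure S) T (\<lambda>x. L (u x) \<bullet> v x)"
  using S_nonempty simplex_compact[OF simplex n]
proof (rule set_integrable_flat_measure_continuous)
  have bl: "bounded_linear L" using L by (simp add: linear_conv_bounded_linear)
  show "continuous_on UNIV (\<lambda>x. L (u x) \<bullet> v x)"
    by (rule continuous_on_inner[OF bounded_linear.continuous_on[OF bl RT0_continuous[OF assms(1)]]
      RT0_continuous[OF assms(2)]])
qed

text \<open>Expand \<open>v\<close> in the at most \<open>n + 1\<close> basis functions and use \<open>sum_self_le\<close> pointwise.\<close>

lemma mass_le_diagonal: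
  assumes v: "v \<in> RT0 T"
  shows "(LINT x:T|flat_measure S. L (v x) \<bullet> v x) \<le>
    (n + 1) * (\<Sum>f | f facet_of T. (nflux v T f)\<^sup>2 * (LINT x:T|flat_measure S. L (RT0_basis T f x) \<bullet> RT0_basis T f x))"
proof -
  let ?I = "{f. f facet_of T}" and ?\<phi> = "RT0_basis T"
  note fin = simplex_facets(1)[OF simplex n] and B = RT0_basis_in[OF simplex n]
  have int: "set_integrable (flat_measure S) T (\<lambda>x. (nflux v T f)\<^sup>2 * (L (?\<phi> f x) \<bullet> ?\<phi> f x))" if "f \<in> ?I" for f
    using set_integrable_RT0[OF B B] that by auto
  have "(LINT x:T|flat_measure S. L (v x) \<bullet> v x) \<le>
    (LINT x:T|flat_measure S. (n + 1) * (\<Sum>f\<in>?I. (nflux v T f)\<^sup>2 * (L (?\<phi> f x) \<bullet> ?\<phi> f x)))"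
  proof (rule set_integral_mono[OF set_integrable_RT0[OF v v]])
    show "set_integrable (flat_measure S) T (\<lambda>x. (n + 1) * (\<Sum>f\<in>?I. (nflux v T f)\<^sup>2 * (L (?\<phi> f x) \<bullet> ?\<phi> f x)))"
      by (rule set_integrable_mult_right, rule set_integral_sum(1), rule int)
    fix x assume x: "x \<in> T"
    let ?y = "\<lambda>f. nflux v T f *\<^sub>R ?\<phi> f x"
    have y: "?y f \<in> tangent S" if "f \<in> ?I" for f
      using that RT0_tangent[OF B x] by auto
    have "L (v x) \<bullet> v x = L (sum ?y ?I) \<bullet> sum ?y ?I"
      using RT0_expansion[OF simplex n v, of x] by simp
    also have "\<dots> \<le> card ?I * (\<Sum>f\<in>?I. L (?y f) \<bullet> ?y f)" by (rule psd.sum_self_le[OF fin y])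
    also have "\<dots> \<le> (n + 1) * (\<Sum>f\<in>?I. L (?y f) \<bullet> ?y f)"
    proof (rule mult_right_mono)
      show "real (card ?I) \<le> (n + 1)" using simplex_facets(2)[OF simplex n] by linarith
      show "0 \<le> (\<Sum>f\<in>?I. L (?y f) \<bullet> ?y f)" by (intro sum_nonneg psd.nonneg y)
    qed
    finally show "L (v x) \<bullet> v x \<le> (n + 1) * (\<Sum>f\<in>?I. (nflux v T f)\<^sup>2 * (L (?\<phi> f x) \<bullet> ?\<phi> f x))"
      by (simp add: linear_scale[OF L] power2_eq_square mult.assoc)
  qed
  also have "\<dots> = (n + 1) * (\<Sum>f\<in>?I. (nflux v T f)\<^sup>2 * (LINT x:T|flat_measure S. L (?\<phi> f x) \<bullet> ?\<phi> f x))"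
    by (subst set_integral_mult_right, subst set_integral_sum(2)[OF int]) simp_all
  finally show ?thesis .
qed

text \<open>For each facet separately: the weighted square of the basis function is at most \<open>\<sigma>\<^sup>2 / k\<close>, the flux is the value of the affine
  function \<open>v \<bullet> n\<close> at a point of the facet, and \<open>(v \<bullet> n)\<^sup>2 \<le> |v|\<^sup>2\<close> is at most \<open>\<theta> k\<close> times the weighted square of \<open>v\<close>.
  The unknown magnitude \<open>k\<close> of the permeability cancels.\<close>

lemma diagonal_le_mass:
  assumes v: "v \<in> RT0 T" and k: "k > 0" and sr: "shape_regular \<sigma> T"
    and upper: "\<And>y. y \<in> tangent S \<Longrightarrow> k * (L y \<bullet> y) \<le> (norm y)\<^sup>2"
    and lower: "\<And>y. y \<in> tangent S \<Longrightarrow> (norm y)\<^sup>2 \<le> \<theta> * k * (L y \<bullet> y)"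
  shows "(\<Sum>f | f facet_of T. (nflux v T f)\<^sup>2 * (LINT x:T|flat_measure S. L (RT0_basis T f x) \<bullet> RT0_basis T f x)) \<le>
    (n + 1) * ((8 * 2 ^ dim (tangent S) + 2) * \<sigma>\<^sup>2 * \<bar>\<theta>\<bar>) * (LINT x:T|flat_measure S. L (v x) \<bullet> v x)"
proof -
  let ?I = "{f. f facet_of T}" and ?\<phi> = "RT0_basis T" and ?F = "flat_measure S"
  let ?E = "LINT x:T|?F. L (v x) \<bullet> v x" and ?c = "8 * 2 ^ dim (tangent S) + 2 :: real"
  note fin = simplex_facets(1)[OF simplex n] and B = RT0_basis_in[OF simplex n]
  note comp = simplex_compact[OF simplex n] and conv = simplex_convex[OF simplex n]
  have TS: "T \<subseteq> affine hull S" using hull hull_subset[of T affine] by simp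
  have Tfin: "T \<in> sets borel" "emeasure ?F T < \<infinity>"
    using emeasure_flat_measure_finite[OF S_nonempty _ compact_imp_bounded[OF comp]] comp by (auto intro: borel_compact)
  have E: "0 \<le> ?E" unfolding set_lebesgue_integral_def
    using psd.nonneg[OF RT0_tangent[OF v]] by (intro integral_nonneg_AE) (auto simp: indicator_def)
  have one: "(nflux v T f)\<^sup>2 * (LINT x:T|?F. L (?\<phi> f x) \<bullet> ?\<phi> f x) \<le> ?c * \<sigma>\<^sup>2 * \<bar>\<theta>\<bar> * ?E" if f: "f facet_of T" for f
  proof -
    let ?n = "outer_normal T f"
    have "(LINT x:T|?F. L (?\<phi> f x) \<bullet> ?\<phi> f x) \<le> (LINT x:T|?F. \<sigma>\<^sup>2 / k)"
    proof (rule set_integral_mono[OF set_integrable_RT0[OF B[OF f] B[OF f]]])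
      show "set_integrable ?F T (\<lambda>x. \<sigma>\<^sup>2 / k)"
        by (rule set_integrable_flat_measure_continuous[OF S_nonempty comp]) simp
      fix x assume x: "x \<in> T"
      have "k * (L (?\<phi> f x) \<bullet> ?\<phi> f x) \<le> (norm (?\<phi> f x))\<^sup>2" using upper RT0_tangent[OF B[OF f] x] .
      also have "\<dots> \<le> \<sigma>\<^sup>2" using RT0_basis_bounded[OF simplex n f sr x] by (intro power_mono) auto
      finally show "L (?\<phi> f x) \<bullet> ?\<phi> f x \<le> \<sigma>\<^sup>2 / k" using k by (simp add: field_simps)
    qed
    also have "\<dots> = \<sigma>\<^sup>2 / k * measure ?F T" using Tfin by (subst set_integral_const) auto
    finally have m1: "(LINT x:T|?F. L (?\<phi> f x) \<bullet> ?\<phi> f x) \<le> \<sigma>\<^sup>2 / k * measure ?F T" .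
    obtain x0 where x0: "x0 \<in> f" using facet_nonempty[OF simplex n f] by blast
    then have x0T: "x0 \<in> T" using f by (auto simp: facet_of_def dest: face_of_imp_subset)
    have cont: "continuous_on UNIV (\<lambda>x. v x \<bullet> ?n)" by (intro continuous_intros RT0_continuous[OF v])
    have "(v x0 \<bullet> ?n)\<^sup>2 * measure ?F T \<le> ?c * (LINT x:T|?F. (v x \<bullet> ?n)\<^sup>2)"
      using S_nonempty comp conv TS x0T cont
      by (rule affine_value_le_integral) (simp add: RT0_midpoint[OF v] inner_add_left)
    then have m2: "(nflux v T f)\<^sup>2 * measure ?F T \<le> ?c * (LINT x:T|?F. (v x \<bullet> ?n)\<^sup>2)"
      using nflux_eq[OF simplex n v f x0] by simp
    have m3: "(LINT x:T|?F. (v x \<bullet> ?n)\<^sup>2) \<le> (LINT x:T|?F. \<bar>\<theta>\<bar> * k * (L (v x) \<bullet> v x))"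
    proof (rule set_integral_mono)
      show "set_integrable ?F T (\<lambda>x. (v x \<bullet> ?n)\<^sup>2)"
        using S_nonempty comp by (rule set_integrable_flat_measure_continuous) (intro continuous_intros cont)
      show "set_integrable ?F T (\<lambda>x. \<bar>\<theta>\<bar> * k * (L (v x) \<bullet> v x))"
        using set_integrable_RT0[OF v v] by simp
      fix x assume x: "x \<in> T"
      have vx: "v x \<in> tangent S" using RT0_tangent[OF v x] .
      have "\<bar>v x \<bullet> ?n\<bar> \<le> norm (v x)"
        using Cauchy_Schwarz_ineq2[of "v x" ?n] outer_normal_facet(1)[OF simplex n f] by simp
      then have "(v x \<bullet> ?n)\<^sup>2 \<le> (norm (v x))\<^sup>2" by (simp add: abs_le_square_iff[symmetric])
      also have "\<dots> \<le> \<theta> * k * (L (v x) \<bullet> v x)" using lower[OF vx] .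
      also have "\<dots> \<le> \<bar>\<theta>\<bar> * k * (L (v x) \<bullet> v x)"
        using psd.nonneg[OF vx] k by (intro mult_right_mono) auto
      finally show "(v x \<bullet> ?n)\<^sup>2 \<le> \<bar>\<theta>\<bar> * k * (L (v x) \<bullet> v x)" .
    qed
    have "(nflux v T f)\<^sup>2 * (LINT x:T|?F. L (?\<phi> f x) \<bullet> ?\<phi> f x) \<le> (nflux v T f)\<^sup>2 * (\<sigma>\<^sup>2 / k * measure ?F T)"
      using m1 by (intro mult_left_mono) auto
    also have "\<dots> = \<sigma>\<^sup>2 / k * ((nflux v T f)\<^sup>2 * measure ?F T)" by simp
    also have "\<dots> \<le> \<sigma>\<^sup>2 / k * (?c * (\<bar>\<theta>\<bar> * k * ?E))"
    proof -
      have "(nflux v T f)\<^sup>2 * measure ?F T \<le> ?c * (LINT x:T|?F. (v x \<bullet> ?n)\<^sup>2)" using m2 .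
      also have "\<dots> \<le> ?c * (\<bar>\<theta>\<bar> * k * ?E)" using m3 by (intro mult_left_mono) auto
      finally show ?thesis using k by (intro mult_left_mono) auto
    qed
    also have "\<dots> = ?c * \<sigma>\<^sup>2 * \<bar>\<theta>\<bar> * ?E" using k by simp
    finally show ?thesis .
  qed
  have "(\<Sum>f\<in>?I. (nflux v T f)\<^sup>2 * (LINT x:T|?F. L (?\<phi> f x) \<bullet> ?\<phi> f x)) \<le> (\<Sum>f\<in>?I. ?c * \<sigma>\<^sup>2 * \<bar>\<theta>\<bar> * ?E)"
    using one by (intro sum_mono) auto
  also have "\<dots> = card ?I * (?c * \<sigma>\<^sup>2 * \<bar>\<theta>\<bar> * ?E)" by simp
  also have "\<dots> \<le> (n + 1) * (?c * \<sigma>\<^sup>2 * \<bar>\<theta>\<bar> * ?E)"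
  proof (rule mult_right_mono)
    show "real (card ?I) \<le> (n + 1)" using simplex_facets(2)[OF simplex n] by linarith
    show "0 \<le> ?c * \<sigma>\<^sup>2 * \<bar>\<theta>\<bar> * ?E" using E by simp
  qed
  finally show ?thesis by (simp only: mult.assoc)
qed

end

section \<open>Fractured media and their meshes\<close>

text \<open>An algebra of functions which contains all piecewise constant functions and is integrable over every bounded Borel
  set of a flat.\<close>

definition bounded_borel :: "('a::euclidean_space \<Rightarrow> real) \<Rightarrow> bool"
  where "bounded_borel f \<longleftrightarrow> f \<in> borel_measurable borel \<and> (\<exists>C. \<forall>x. \<bar>f x\<bar> \<le> C)"

lemma bounded_borel_const: "bounded_borel (\<lambda>x. c)"
  by (auto simp: bounded_borel_def)

lemma bounded_borel_indicator: "A \<in> sets borel \<Longrightarrow> bounded_borel (indicat_real A)"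
  by (auto simp: bounded_borel_def indicator_def intro!: exI[of _ 1])

lemma bounded_borel_add: "bounded_borel f \<Longrightarrow> bounded_borel g \<Longrightarrow> bounded_borel (\<lambda>x. f x + g x)"
  unfolding bounded_borel_def
proof (elim conjE exE, intro conjI exI allI)
  fix C D x assume "\<forall>x. \<bar>f x\<bar> \<le> C" "\<forall>x. \<bar>g x\<bar> \<le> D"
  then show "\<bar>f x + g x\<bar> \<le> C + D" by (metis abs_triangle_ineq add_mono order_trans)
qed auto

lemma bounded_borel_mult: "bounded_borel f \<Longrightarrow> bounded_borel g \<Longrightarrow> bounded_borel (\<lambda>x. f x * g x)"
  unfolding bounded_borel_def
proof (elim conjE exE, intro conjI exI allI)
  fix C D x assume CD: "\<forall>x. \<bar>f x\<bar> \<le> C" "\<forall>x. \<bar>g x\<bar> \<le> D"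
  then have "0 \<le> C" by (meson abs_ge_zero order_trans)
  then show "\<bar>f x * g x\<bar> \<le> C * D" using CD by (simp add: abs_mult mult_mono)
qed auto

lemma bounded_borel_uminus: "bounded_borel f \<Longrightarrow> bounded_borel (\<lambda>x. - f x)"
  using bounded_borel_mult[OF bounded_borel_const[of "-1"]] by simp

lemma bounded_borel_diff: "bounded_borel f \<Longrightarrow> bounded_borel g \<Longrightarrow> bounded_borel (\<lambda>x. f x - g x)"
  using bounded_borel_add[OF _ bounded_borel_uminus] by simp

lemma bounded_borel_sum: "(\<And>i. i \<in> I \<Longrightarrow> bounded_borel (f i)) \<Longrightarrow> bounded_borel (\<lambda>x. \<Sum>i\<in>I. f i x)"
  by (induction I rule: infinite_finite_induct) (auto intro: bounded_borel_add bounded_borel_const)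

lemmas bounded_borel_intros =
  bounded_borel_const bounded_borel_indicator bounded_borel_add bounded_borel_mult bounded_borel_diff
  bounded_borel_sum bounded_borel_uminus

lemma set_integrable_bounded_borel:
  assumes "S \<noteq> {}" "A \<in> sets borel" "bounded A" "bounded_borel f"
  shows "set_integrable (flat_measure S) A f"
  using assms unfolding bounded_borel_def by (auto intro: set_integrable_flat_measure)

lemma openin_affine_borel:
  fixes S :: "'a::euclidean_space set"
  assumes "openin (top_of_set (affine hull S)) A"
  shows "A \<in> sets borel"
proof -
  obtain U where "open U" "A = affine hull S \<inter> U" using assms by (auto simp: openin_open)
  moreover have "affine hull S \<in> sets borel" by (intro borel_closed) (simp add: closed_affine_hull)
  ultimately show ?thesis by (simp add: sets.Int)
qed

lemma rel_interior_borel: "rel_interior S \<in> sets borel" for S :: "'a::euclidean_space set"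
  by (rule openin_affine_borel) (rule openin_rel_interior)

text \<open>The orthogonal complement of \<open>U\<close> in \<open>W\<close> is a line, which contains two unit vectors.\<close>

lemma finite_unit_normals:
  fixes U W :: "'a::euclidean_space set"
  assumes "subspace U" "subspace W" "U \<subseteq> W" "dim W = Suc (dim U)"
  shows "finite {\<nu>\<in>W. norm \<nu> = 1 \<and> (\<forall>\<tau>\<in>U. \<nu> \<bullet> \<tau> = 0)}"
proof -
  define N where "N = {y\<in>W. \<forall>x\<in>U. orthogonal x y}"
  have "dim N + dim U = dim W" unfolding N_def using assms(1-3) by (rule dim_subspace_orthogonal_to_vectors)
  then have dimN: "dim N = 1" using assms(4) by simp
  obtain B where B: "B \<subseteq> N" "independent B" "N \<subseteq> span B" "card B = dim N" using basis_exists by blast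
  then obtain e where e: "B = {e}" using dimN card_1_singletonE by metis
  have "{\<nu>\<in>W. norm \<nu> = 1 \<and> (\<forall>\<tau>\<in>U. \<nu> \<bullet> \<tau> = 0)} \<subseteq> {(1 / norm e) *\<^sub>R e, (- 1 / norm e) *\<^sub>R e}"
  proof
    fix \<nu> assume \<nu>: "\<nu> \<in> {\<nu>\<in>W. norm \<nu> = 1 \<and> (\<forall>\<tau>\<in>U. \<nu> \<bullet> \<tau> = 0)}"
    then have "\<nu> \<in> N" by (simp add: N_def orthogonal_def inner_commute)
    then obtain k where k: "\<nu> = k *\<^sub>R e" using B(3) e by (auto simp: span_singleton)
    then have "\<bar>k\<bar> * norm e = 1" using \<nu> by simp
    then have "\<bar>k\<bar> = 1 / norm e" by (metis mult_zero_right nonzero_eq_divide_eq zero_neq_one)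
    then have "k = 1 / norm e \<or> k = - 1 / norm e" by (auto simp: abs_if split: if_splits)
    then show "\<nu> \<in> {(1 / norm e) *\<^sub>R e, (- 1 / norm e) *\<^sub>R e}" using k by auto
  qed
  then show ?thesis by (rule finite_subset) simp
qed

locale fracture_mesh =
  fixes M :: "'a::euclidean_space medium" and X :: "'a mesh" and \<sigma> :: real
  assumes medium: "fractured_medium M" and mesh: "admissible_mesh M \<sigma> X"
begin

lemma subdom:
  assumes "S \<in> subdom M d"
  shows "S \<noteq> {}" "bounded S" "aff_dim S = int d" "openin (top_of_set (affine hull S)) S" "S \<in> subdomains M"
    "S \<in> sets borel"
proof -
  from medium have "\<forall>d. \<forall>S\<in>subdom M d. S \<noteq> {} \<and> connected S \<and> bounded S \<and> aff_dim S = int d \<and>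
      openin (top_of_set (affine hull S)) S"
    unfolding fractured_medium_def by (elim conjE)
  then show S: "S \<noteq> {}" "bounded S" "aff_dim S = int d" "openin (top_of_set (affine hull S)) S"
    using assms by simp_all
  have "d \<le> DIM('a)" using medium assms unfolding fractured_medium_def by (metis empty_iff not_le)
  then show "S \<in> subdomains M" using assms by (auto simp: subdomains_def)
  show "S \<in> sets borel" using S(4) by (rule openin_affine_borel)
qed

lemma subdomains_E:
  assumes "S \<in> subdomains M"
  obtains d where "S \<in> subdom M d" "d \<le> DIM('a)"
  using assms by (auto simp: subdomains_def)

lemma subdomains_disjoint: "S \<in> subdomains M \<Longrightarrow> S' \<in> subdomains M \<Longrightarrow> S \<noteq> S' \<Longrightarrow> S \<inter> S' = {}"
proof -
  from medium have "\<forall>S\<in>subdomains M. \<forall>S'\<in>subdomains M. S \<noteq> S' \<longrightarrow> S \<inter> S' = {}"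
    unfolding fractured_medium_def by (elim conjE)
  then show "S \<in> subdomains M \<Longrightarrow> S' \<in> subdomains M \<Longrightarrow> S \<noteq> S' \<Longrightarrow> S \<inter> S' = {}" by blast
qed

lemma finite_subdomains: "finite (subdomains M)"
  using medium unfolding fractured_medium_def subdomains_def by auto

lemma open_medium: "open (medium_dom M)"
  using medium unfolding fractured_medium_def by blast

lemma bdN_frontier: "bdN M \<subseteq> frontier (medium_dom M)"
  using medium unfolding fractured_medium_def by blast

lemma subdomain_bdN: "S \<in> subdomains M \<Longrightarrow> S \<inter> bdN M = {}"
  using bdN_frontier open_medium unfolding medium_dom_def frontier_def by (auto simp: interior_open)

lemma affine_hull_eq_of_subset:
  assumes "A \<subseteq> affine hull B" "aff_dim A = aff_dim B" "A \<noteq> {}"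
  shows "affine hull A = affine hull B"
proof (rule affine_dim_equal)
  show "affine hull A \<subseteq> affine hull B" using assms(1) by (simp add: hull_minimal)
qed (use assms in auto)

lemma tri_triangulates: "S \<in> subdomains M \<Longrightarrow> triangulates (tri X S) S"
  using mesh unfolding admissible_mesh_def by blast

lemma cell:
  assumes "(S, T) \<in> cells M X"
  shows "S \<in> subdomains M" "aff_dim S simplex T" "rel_interior T \<subseteq> S" "affine hull T = affine hull S"
    "shape_regular \<sigma> T" "S \<noteq> {}" "0 \<le> aff_dim S" "aff_dim S \<le> DIM('a)"
proof -
  show S: "S \<in> subdomains M" using assms by (simp add: cells_def)
  have T: "T \<in> tri X S" using assms by (simp add: cells_def)
  obtain d where d: "S \<in> subdom M d" using S by (rule subdomains_E)
  show "S \<noteq> {}" "0 \<le> aff_dim S" using subdom[OF d] by auto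
  show "aff_dim S \<le> DIM('a)" by (rule aff_dim_le_DIM)
  show simp: "aff_dim S simplex T" and "rel_interior T \<subseteq> S"
    using tri_triangulates[OF S] T unfolding triangulates_def by auto
  show "shape_regular \<sigma> T" using mesh S T unfolding admissible_mesh_def by blast
  have "T \<subseteq> closure S" using tri_triangulates[OF S] T unfolding triangulates_def by blast
  also have "\<dots> \<subseteq> affine hull S" by (rule closure_affine_hull)
  finally show "affine hull T = affine hull S"
    using simp aff_dim_simplex[OF simp] subdom(1,3)[OF d] by (intro affine_hull_eq_of_subset) auto
qed

lemma finite_cells: "finite (cells M X)"
  using finite_subdomains tri_triangulates unfolding cells_def triangulates_def by auto

text \<open>The intersection of the two cells is a face of the first one which meets its relative interior.\<close>

lemma cell_overlap:
  assumes T: "(S, T) \<in> cells M X" "(S, T') \<in> cells M X" and x: "x \<in> rel_interior T" "x \<in> T'"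
  shows "T \<subseteq> T'"
proof -
  have "x \<in> T \<inter> T' \<inter> S" using x cell(3)[OF T(1)] rel_interior_subset by blast
  then have "(T \<inter> T') face_of T"
    using tri_triangulates[OF cell(1)[OF T(1)]] T unfolding triangulates_def cells_def by blast
  then have "T \<inter> T' = T"
    using face_of_disjoint_rel_interior[of "T \<inter> T'" T] x rel_interior_subset by blast
  then show ?thesis by blast
qed

lemma iface:
  assumes "(L, S, \<nu>) \<in> ifaces M"
  obtains d where "L \<in> subdom M d" "S \<in> subdom M (Suc d)" "norm \<nu> = 1" "\<nu> \<in> tangent S"
    "\<And>\<tau>. \<tau> \<in> tangent L \<Longrightarrow> \<nu> \<bullet> \<tau> = 0" "L \<subseteq> closure S"
  using assms unfolding ifaces_def by blast

lemma iface_fst: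
  assumes "g \<in> ifaces M"
  shows "fst g \<in> subdomains M" "fst g \<noteq> {}" "fst g \<in> sets borel" "bounded (fst g)"
proof -
  obtain L S \<nu> where g: "g = (L, S, \<nu>)" by (cases g)
  with assms obtain d where "L \<in> subdom M d" by (auto elim: iface)
  from subdom[OF this] g show "fst g \<in> subdomains M" "fst g \<noteq> {}" "fst g \<in> sets borel" "bounded (fst g)" by auto
qed

lemma finite_ifaces: "finite (ifaces M)"
proof -
  let ?N = "\<lambda>L S. {\<nu>. (L, S, \<nu>) \<in> ifaces M}"
  have fin: "finite (?N L S)" for L S
  proof (cases "?N L S = {}")
    case False
    then obtain \<nu> where "(L, S, \<nu>) \<in> ifaces M" by blast
    then obtain d where d: "L \<in> subdom M d" "S \<in> subdom M (Suc d)" "L \<subseteq> closure S" by (rule iface)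
    note Ln = subdom(1)[OF d(1)] and Sn = subdom(1)[OF d(2)]
    have "L \<subseteq> affine hull S" using d(3) closure_affine_hull by blast
    then have "affine hull L \<subseteq> affine hull S" by (simp add: hull_minimal)
    moreover have "dim (tangent S) = Suc (dim (tangent L))"
      using dim_tangent[OF Ln] dim_tangent[OF Sn] subdom(3)[OF d(1)] subdom(3)[OF d(2)] by simp
    ultimately have "finite {\<nu>\<in>tangent S. norm \<nu> = 1 \<and> (\<forall>\<tau>\<in>tangent L. \<nu> \<bullet> \<tau> = 0)}"
      using Ln Sn by (intro finite_unit_normals subspace_tangent tangent_mono)
    then show ?thesis by (rule rev_finite_subset) (auto elim: iface)
  qed simp
  have "ifaces M \<subseteq> (SIGMA L:subdomains M. SIGMA S:subdomains M. ?N L S)"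
  proof
    fix g assume g: "g \<in> ifaces M"
    obtain L S \<nu> where eq: "g = (L, S, \<nu>)" by (cases g)
    obtain d where "L \<in> subdom M d" "S \<in> subdom M (Suc d)" using g unfolding eq by (rule iface)
    then show "g \<in> (SIGMA L:subdomains M. SIGMA S:subdomains M. ?N L S)"
      using g eq subdom(5) by auto
  qed
  then show ?thesis
    by (rule finite_subset) (intro finite_SigmaI finite_subdomains fin)
qed

lemma finite_mcells: "finite (mcells M X)"
proof -
  have "finite (mortar_tri X g)" if "g \<in> ifaces M" for g
    using mesh that unfolding admissible_mesh_def triangulates_def by (cases g) blast
  then show ?thesis unfolding mcells_def using finite_ifaces by auto
qed

section \<open>Facets on interfaces\<close>

definition iface_facets :: "'a iface \<Rightarrow> ('a cell \<times> 'a set) set"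
  where "iface_facets g = {(c, f). c \<in> cells M X \<and> f facet_of snd c \<and> on_iface g c f}"

definition off_iface :: "'a cell \<Rightarrow> 'a set \<Rightarrow> bool"
  where "off_iface c f \<longleftrightarrow> \<not> (\<exists>g\<in>ifaces M. on_iface g c f)"

lemma facet_rel_interior:
  assumes "f facet_of T" "convex T"
  shows "rel_interior f \<noteq> {}" "convex f"
proof -
  show "convex f" using assms by (auto simp: facet_of_def dest: face_of_imp_convex)
  moreover have "f \<noteq> {}" using assms by (simp add: facet_of_def)
  ultimately show "rel_interior f \<noteq> {}" by (simp add: rel_interior_eq_empty)
qed

lemma iface_facet:
  assumes g: "g \<in> ifaces M" and i: "(c, f) \<in> iface_facets g"
  shows "c \<in> cells M X" "f facet_of snd c" "fst (snd g) = fst c" "1 \<le> aff_dim (fst c)"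
    "outer_normal (snd c) f = snd (snd g)" "rel_interior f \<subseteq> fst g" "rel_interior f \<noteq> {}"
    "affine hull f = affine hull fst g"
proof -
  obtain L S \<nu> where g': "g = (L, S, \<nu>)" by (cases g)
  obtain S' T where c: "c = (S', T)" by (cases c)
  show *: "c \<in> cells M X" "f facet_of snd c" "fst (snd g) = fst c"
    "outer_normal (snd c) f = snd (snd g)" "rel_interior f \<subseteq> fst g"
    using i g' c by (auto simp: iface_facets_def on_iface_def)
  obtain d where d: "L \<in> subdom M d" "S \<in> subdom M (Suc d)" using g unfolding g' by (rule iface)
  have S: "S' = S" using *(3) g' c by simp
  have aS: "aff_dim S = int d + 1" using subdom(3)[OF d(2)] by simp
  then show "1 \<le> aff_dim (fst c)" using S c by simp
  have T: "(S, T) \<in> cells M X" using *(1) c S by simp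
  have "convex T" using simplex_convex[OF cell(2)[OF T]] aS by simp
  then show ri: "rel_interior f \<noteq> {}" using facet_rel_interior *(2) c by simp
  have "convex f" using facet_rel_interior(2) *(2) c \<open>convex T\<close> by simp
  have af: "aff_dim f = int d"
    using *(2) c aff_dim_simplex[OF cell(2)[OF T]] aS by (simp add: facet_of_def)
  have hull: "affine hull rel_interior f = affine hull f"
    using \<open>convex f\<close> by (rule rel_interior_same_affine_hull)
  have "affine hull rel_interior f = affine hull L"
  proof (rule affine_hull_eq_of_subset[OF _ _ ri])
    show "rel_interior f \<subseteq> affine hull L" using *(5) g' hull_subset by fastforce
    show "aff_dim (rel_interior f) = aff_dim L"
      using af subdom(3)[OF d(1)] \<open>convex f\<close> by (simp add: rel_interior_aff_dim)
  qed
  then show "affine hull f = affine hull fst g" using hull g' by simp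
qed

lemma finite_iface_facets: "g \<in> ifaces M \<Longrightarrow> finite (iface_facets g)"
proof -
  assume g: "g \<in> ifaces M"
  have "iface_facets g \<subseteq> (SIGMA c:{c\<in>cells M X. 1 \<le> aff_dim (fst c)}. {f. f facet_of snd c})"
    using iface_facet[OF g] by auto
  moreover have "finite (SIGMA c:{c\<in>cells M X. 1 \<le> aff_dim (fst c)}. {f. f facet_of snd c})"
    using finite_cells simplex_facets(1)[OF cell(2)] by (intro finite_SigmaI) auto
  ultimately show ?thesis by (rule finite_subset)
qed

text \<open>Two facets on one interface have the same outer normal, so moving a little against it from a common point of their
  relative interiors leads into the interiors of both cells. This is where a subdomain on both sides of a fracture
  must be distinguished by the normals.\<close>

lemma iface_facets_disjoint:
  assumes g: "g \<in> ifaces M" and i: "(c, f) \<in> iface_facets g" "(c', f') \<in> iface_facets g"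
    and x: "x \<in> rel_interior f" "x \<in> rel_interior f'"
  shows "c = c' \<and> f = f'"
proof -
  obtain S T where c: "c = (S, T)" by (cases c)
  obtain S' T' where c': "c' = (S', T')" by (cases c')
  have S: "S' = S" using iface_facet(3)[OF g i(1)] iface_facet(3)[OF g i(2)] c c' by simp
  have T: "(S, T) \<in> cells M X" and T': "(S, T') \<in> cells M X"
    using iface_facet(1)[OF g i(1)] iface_facet(1)[OF g i(2)] c c' S by auto
  have dim: "1 \<le> aff_dim S" using iface_facet(4)[OF g i(1)] c by simp
  let ?\<nu> = "snd (snd g)"
  have "\<forall>\<^sub>F t in at_right 0. x - t *\<^sub>R ?\<nu> \<in> rel_interior T"
    using facet_inward[OF cell(2)[OF T] dim _ x(1)] iface_facet(2,5)[OF g i(1)] c by simp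
  moreover have "\<forall>\<^sub>F t in at_right 0. x - t *\<^sub>R ?\<nu> \<in> rel_interior T'"
    using facet_inward[OF cell(2)[OF T'] dim _ x(2)] iface_facet(2,5)[OF g i(2)] c' by simp
  ultimately have "\<forall>\<^sub>F t::real in at_right 0. x - t *\<^sub>R ?\<nu> \<in> rel_interior T \<inter> rel_interior T'"
    by eventually_elim blast
  then obtain t where t: "x - t *\<^sub>R ?\<nu> \<in> rel_interior T" "x - t *\<^sub>R ?\<nu> \<in> rel_interior T'"
    using eventually_happens' trivial_limit_at_right_real by blast
  have "T = T'"
    using cell_overlap[OF T T' t(1)] cell_overlap[OF T' T t(2)] t rel_interior_subset by blast
  moreover have "f = f'"
  proof (rule face_of_eq)
    show "f face_of T" "f' face_of T"
      using iface_facet(2)[OF g i(1)] iface_facet(2)[OF g i(2)] c c' \<open>T = T'\<close> by (auto simp: facet_of_def)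
    show "rel_interior f \<inter> rel_interior f' \<noteq> {}" using x by blast
  qed
  ultimately show ?thesis using c c' S by simp
qed

lemma iface_unique:
  assumes g: "g \<in> ifaces M" "g' \<in> ifaces M" and i: "(c, f) \<in> iface_facets g" "(c, f) \<in> iface_facets g'"
  shows "g = g'"
proof -
  have "fst g = fst g'"
  proof (rule ccontr)
    assume "fst g \<noteq> fst g'"
    then have "fst g \<inter> fst g' = {}" using subdomains_disjoint iface_fst(1) g by blast
    then show False using iface_facet(6,7)[OF g(1) i(1)] iface_facet(6)[OF g(2) i(2)] by blast
  qed
  then show ?thesis
    using iface_facet(3,5)[OF g(1) i(1)] iface_facet(3,5)[OF g(2) i(2)] by (simp add: prod_eq_iff)
qed

text \<open>Such a facet has the dimension of the interface, hence its relative interior is open in the hull of the interface.\<close>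

lemma iface_facet_measure_pos:
  assumes g: "g \<in> ifaces M" and i: "(c, f) \<in> iface_facets g"
  shows "0 < measure (flat_measure (fst g)) (rel_interior f)"
proof -
  obtain x where x: "x \<in> rel_interior f" using iface_facet(7)[OF g i] by blast
  then obtain e where e: "e > 0" "ball x e \<inter> affine hull f \<subseteq> f" "x \<in> f" using mem_rel_interior_ball by blast
  have "openin (top_of_set (affine hull f)) (rel_interior f)" by (rule openin_rel_interior)
  then obtain \<epsilon> where \<epsilon>: "\<epsilon> > 0" "ball x \<epsilon> \<inter> affine hull f \<subseteq> rel_interior f"
    using x by (metis openin_contains_ball)
  have "0 < emeasure (flat_measure (fst g)) (rel_interior f)"
    using iface_fst(2)[OF g] rel_interior_borel x
  proof (rule emeasure_flat_measure_pos)
    show "x \<in> affine hull fst g" "\<epsilon> > 0" "ball x \<epsilon> \<inter> affine hull fst g \<subseteq> rel_interior f"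
      using iface_facet(8)[OF g i] e(3) \<epsilon> hull_inc[of x f affine] by auto
  qed
  moreover have "emeasure (flat_measure (fst g)) (rel_interior f) < \<infinity>"
    using iface_fst(2,4)[OF g] rel_interior_borel iface_facet(6)[OF g i]
    by (intro emeasure_flat_measure_finite) (auto intro: bounded_subset)
  ultimately show ?thesis by (simp add: measure_def enn2real_positive_iff)
qed

section \<open>The global Raviart--Thomas space\<close>

lemma VhD:
  assumes "v \<in> Vh M X"
  shows "(S, T) \<in> cells M X \<Longrightarrow> 1 \<le> aff_dim S \<Longrightarrow> v (S, T) \<in> RT0 T"
    and "(S, T) \<notin> cells M X \<or> aff_dim S = 0 \<Longrightarrow> v (S, T) = 0"
    and "(S, T) \<in> cells M X \<Longrightarrow> (S, T') \<in> cells M X \<Longrightarrow> T \<noteq> T' \<Longrightarrow> f facet_of T \<Longrightarrow> f facet_of T' \<Longrightarrow>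
      rel_interior f \<subseteq> S \<Longrightarrow> x \<in> f \<Longrightarrow> v (S, T) x \<bullet> outer_normal T f + v (S, T') x \<bullet> outer_normal T' f = 0"
    and "(S, T) \<in> cells M X \<Longrightarrow> f facet_of T \<Longrightarrow> rel_interior f \<subseteq> bdN M \<Longrightarrow> x \<in> f \<Longrightarrow>
      v (S, T) x \<bullet> outer_normal T f = 0"
proof -
  note v = assms[unfolded Vh_def, THEN CollectD]
  show "(S, T) \<in> cells M X \<Longrightarrow> 1 \<le> aff_dim S \<Longrightarrow> v (S, T) \<in> RT0 T"
    using v[THEN conjunct1] by simp
  show "(S, T) \<notin> cells M X \<or> aff_dim S = 0 \<Longrightarrow> v (S, T) = 0"
    using v[THEN conjunct2, THEN conjunct1] by simp
  show "(S, T) \<in> cells M X \<Longrightarrow> (S, T') \<in> cells M X \<Longrightarrow> T \<noteq> T' \<Longrightarrow> f facet_of T \<Longrightarrow> f facet_of T' \<Longrightarrow>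
      rel_interior f \<subseteq> S \<Longrightarrow> x \<in> f \<Longrightarrow> v (S, T) x \<bullet> outer_normal T f + v (S, T') x \<bullet> outer_normal T' f = 0"
    using v[THEN conjunct2, THEN conjunct2, THEN conjunct1] by simp
  show "(S, T) \<in> cells M X \<Longrightarrow> f facet_of T \<Longrightarrow> rel_interior f \<subseteq> bdN M \<Longrightarrow> x \<in> f \<Longrightarrow>
      v (S, T) x \<bullet> outer_normal T f = 0"
    using v[THEN conjunct2, THEN conjunct2, THEN conjunct2] by simp
qed

lemma Vh_cell:
  assumes "v \<in> Vh M X"
  shows "c \<in> cells M X \<Longrightarrow> 1 \<le> aff_dim (fst c) \<Longrightarrow> v c \<in> RT0 (snd c)"
    and "c \<notin> cells M X \<or> \<not> 1 \<le> aff_dim (fst c) \<Longrightarrow> v c = 0"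
proof -
  obtain S T where c: "c = (S, T)" by (cases c)
  show "c \<in> cells M X \<Longrightarrow> 1 \<le> aff_dim (fst c) \<Longrightarrow> v c \<in> RT0 (snd c)"
    using VhD(1)[OF assms] c by simp
  assume "c \<notin> cells M X \<or> \<not> 1 \<le> aff_dim (fst c)"
  then have "(S, T) \<notin> cells M X \<or> aff_dim S = 0" using cell(7)[of S T] c by force
  then show "v c = 0" using VhD(2)[OF assms] c by simp
qed

lemma cell_nonempty: "(S, T) \<in> cells M X \<Longrightarrow> 1 \<le> aff_dim S \<Longrightarrow> T \<noteq> {}"
  using simplex_nonempty cell(2) by blast

lemma subspace_Vh: "subspace (Vh M X)"
proof -
  note sub = RT0_subspace[OF cell_nonempty]
  have zero: "0 \<in> RT0 T" if "(S, T) \<in> cells M X \<and> 1 \<le> aff_dim S" for S T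
    using that by (intro subspace_0[OF sub]) auto
  show ?thesis
  proof (rule subspaceI)
    show "0 \<in> Vh M X" unfolding Vh_def using zero by simp
    fix v w assume v: "v \<in> Vh M X" and w: "w \<in> Vh M X"
    show "v + w \<in> Vh M X"
      unfolding Vh_def mem_Collect_eq
    proof (intro conjI allI impI ballI)
      show "(v + w) (S, T) \<in> RT0 T" if T: "(S, T) \<in> cells M X \<and> 1 \<le> aff_dim S" for S T
        unfolding plus_fun_apply[of v w] using T by (intro subspace_add[OF sub] VhD(1)[OF v] VhD(1)[OF w]) auto
      show "(v + w) (S, T) = 0" if "(S, T) \<notin> cells M X \<or> aff_dim S = 0" for S T
        using VhD(2)[OF v that] VhD(2)[OF w that] by simp
      show "(v + w) (S, T) x \<bullet> outer_normal T f + (v + w) (S, T') x \<bullet> outer_normal T' f = 0"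
        if "(S, T) \<in> cells M X \<and> (S, T') \<in> cells M X \<and> T \<noteq> T' \<and>
          f facet_of T \<and> f facet_of T' \<and> rel_interior f \<subseteq> S" "x \<in> f" for S T T' f x
        using VhD(3)[OF v, of S T T' f x] VhD(3)[OF w, of S T T' f x] that by (simp add: inner_add_left)
      show "(v + w) (S, T) x \<bullet> outer_normal T f = 0"
        if "(S, T) \<in> cells M X \<and> f facet_of T \<and> rel_interior f \<subseteq> bdN M" "x \<in> f" for S T f x
        using VhD(4)[OF v, of S T f x] VhD(4)[OF w, of S T f x] that by (simp add: inner_add_left)
    qed
  next
    fix k v assume v: "v \<in> Vh M X"
    have app: "(k *\<^sub>R v) c = k *\<^sub>R v c" "(k *\<^sub>R v) c x = k *\<^sub>R v c x" for c x
      by (simp_all add: scaleR_fun_def)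
    show "k *\<^sub>R v \<in> Vh M X"
      unfolding Vh_def mem_Collect_eq
    proof (intro conjI allI impI ballI)
      show "(k *\<^sub>R v) (S, T) \<in> RT0 T" if T: "(S, T) \<in> cells M X \<and> 1 \<le> aff_dim S" for S T
        unfolding app(1) using T by (intro subspace_scale[OF sub] VhD(1)[OF v]) auto
      show "(k *\<^sub>R v) (S, T) = 0" if "(S, T) \<notin> cells M X \<or> aff_dim S = 0" for S T
        unfolding app(1) VhD(2)[OF v that] by simp
      show "(k *\<^sub>R v) (S, T) x \<bullet> outer_normal T f + (k *\<^sub>R v) (S, T') x \<bullet> outer_normal T' f = 0"
        if "(S, T) \<in> cells M X \<and> (S, T') \<in> cells M X \<and> T \<noteq> T' \<and>
          f facet_of T \<and> f facet_of T' \<and> rel_interior f \<subseteq> S" "x \<in> f" for S T T' f x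
      proof -
        have "v (S, T) x \<bullet> outer_normal T f + v (S, T') x \<bullet> outer_normal T' f = 0"
          using that by (intro VhD(3)[OF v]) auto
        then have "k * (v (S, T) x \<bullet> outer_normal T f + v (S, T') x \<bullet> outer_normal T' f) = 0" by simp
        then show ?thesis unfolding app(2) by (simp add: distrib_left)
      qed
      show "(k *\<^sub>R v) (S, T) x \<bullet> outer_normal T f = 0"
        if "(S, T) \<in> cells M X \<and> f facet_of T \<and> rel_interior f \<subseteq> bdN M" "x \<in> f" for S T f x
        unfolding app(2) using VhD(4)[OF v, of S T f x] that by simp
    qed
  qed
qed

lemma V0h_sub_Vh: "V0h M X \<subseteq> Vh M X"
  by (auto simp: V0h_def)

lemma subspace_V0h: "subspace (V0h M X)"
proof (rule subspaceI)
  show "0 \<in> V0h M X" using subspace_0[OF subspace_Vh] by (simp add: V0h_def)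
  show "v + w \<in> V0h M X" if "v \<in> V0h M X" "w \<in> V0h M X" for v w
    using that subspace_add[OF subspace_Vh, of v w] unfolding V0h_def by (auto simp: inner_add_left)
  show "k *\<^sub>R v \<in> V0h M X" if "v \<in> V0h M X" for k v
    using that subspace_scale[OF subspace_Vh, of v k] unfolding V0h_def by (auto simp: scaleR_fun_def)
qed

lemma subspace_Lamh: "subspace (Lamh M X)"
  and subspace_Qh: "subspace (Qh M X)"
  by (auto simp: subspace_def Lamh_def Qh_def scaleR_fun_def)

lemma subspace_Wh: "subspace (Wh M X)"
  unfolding Wh_def using subspace_V0h subspace_Lamh by (rule subspace_Times)

lemma Vh_eqI:
  assumes v: "v \<in> Vh M X" "w \<in> Vh M X"
    and eq: "\<And>c f. c \<in> cells M X \<Longrightarrow> 1 \<le> aff_dim (fst c) \<Longrightarrow> f facet_of snd c \<Longrightarrow>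
      nflux (v c) (snd c) f = nflux (w c) (snd c) f"
  shows "v = w"
proof
  fix c
  show "v c = w c"
  proof (cases "c \<in> cells M X \<and> 1 \<le> aff_dim (fst c)")
    case True
    obtain S T where c: "c = (S, T)" by (cases c)
    have T: "(S, T) \<in> cells M X" "1 \<le> aff_dim S" using True c by auto
    show ?thesis
      using RT0_eqI[OF cell(2)[OF T(1)] T(2), of "v c" "w c"] Vh_cell(1)[OF v(1), of c] Vh_cell(1)[OF v(2), of c] eq[of c] True
      unfolding c by simp
  next
    case False
    then show ?thesis using Vh_cell(2)[OF v(1), of c] Vh_cell(2)[OF v(2), of c] by simp
  qed
qed

text \<open>Fluxes through the facets on interfaces can be prescribed independently: such a facet lies neither inside a
  subdomain nor on the Neumann boundary, so the conditions which define \<open>Vh\<close> do not constrain its flux.\<close>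

lemma Vh_prescribed_flux:
  fixes t :: "'a cell \<Rightarrow> 'a set \<Rightarrow> real"
  shows "\<exists>v\<in>Vh M X. (\<forall>g\<in>ifaces M. \<forall>(c, f)\<in>iface_facets g. nflux (v c) (snd c) f = t c f) \<and>
    (\<forall>c f. c \<in> cells M X \<and> f facet_of snd c \<and> off_iface c f \<longrightarrow> nflux (v c) (snd c) f = 0)"
proof -
  define s where "s c f = (if off_iface c f then 0 else t c f)" for c f
  define v where "v c = (if c \<in> cells M X \<and> 1 \<le> aff_dim (fst c)
    then \<Sum>f | f facet_of snd c. s c f *\<^sub>R RT0_basis (snd c) f else 0)" for c :: "'a cell"
  have v_in: "v (S, T) \<in> RT0 T" and v_flux: "f facet_of T \<Longrightarrow> nflux (v (S, T)) T f = s (S, T) f"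
    if T: "(S, T) \<in> cells M X" "1 \<le> aff_dim S" for S T f
    using RT0_combination[OF cell(2)[OF T(1)] T(2)] T by (simp_all add: v_def)
  have v_normal: "v (S, T) x \<bullet> outer_normal T f = 0"
    if T: "(S, T) \<in> cells M X" "f facet_of T" "off_iface (S, T) f" "x \<in> f" for S T f x
  proof (cases "1 \<le> aff_dim S")
    case True
    then show ?thesis
      using nflux_eq[OF cell(2)[OF T(1)] True v_in[OF T(1) True] T(2,4)] v_flux[OF T(1) True T(2)] T(3)
      by (simp add: s_def)
  qed (simp add: v_def)
  have ri: "rel_interior f \<noteq> {}" if "(S, T) \<in> cells M X" "f facet_of T" for S T f
  proof -
    have "convex T" using cell(2)[OF that(1)] by (auto simp: simplex_def)
    then show ?thesis using facet_rel_interior(1)[OF that(2)] by simp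
  qed
  have off1: "off_iface (S, T) f" if T: "(S, T) \<in> cells M X" "f facet_of T" "rel_interior f \<subseteq> S" for S T f
    unfolding off_iface_def
  proof
    assume "\<exists>g\<in>ifaces M. on_iface g (S, T) f"
    then obtain L \<nu> where g: "(L, S, \<nu>) \<in> ifaces M" "rel_interior f \<subseteq> L"
      by (auto simp: on_iface_def split: prod.splits)
    obtain d where d: "L \<in> subdom M d" "S \<in> subdom M (Suc d)" using g(1) by (rule iface)
    have "L \<noteq> S" using subdom(3)[OF d(1)] subdom(3)[OF d(2)] by auto
    then have "L \<inter> S = {}" using subdomains_disjoint subdom(5) d by blast
    then show False using g(2) T(3) ri[OF T(1,2)] by blast
  qed
  have off2: "off_iface (S, T) f" if T: "(S, T) \<in> cells M X" "f facet_of T" "rel_interior f \<subseteq> bdN M" for S T f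
    unfolding off_iface_def
  proof
    assume "\<exists>g\<in>ifaces M. on_iface g (S, T) f"
    then obtain L \<nu> where g: "(L, S, \<nu>) \<in> ifaces M" "rel_interior f \<subseteq> L"
      by (auto simp: on_iface_def split: prod.splits)
    have "L \<inter> bdN M = {}" using subdomain_bdN[OF iface_fst(1)[OF g(1)]] by simp
    then show False using g(2) T(3) ri[OF T(1,2)] by blast
  qed
  have "v \<in> Vh M X"
    unfolding Vh_def mem_Collect_eq
  proof (intro conjI allI impI ballI)
    show "v (S, T) \<in> RT0 T" if "(S, T) \<in> cells M X \<and> 1 \<le> aff_dim S" for S T using v_in that by blast
    show "v (S, T) = 0" if "(S, T) \<notin> cells M X \<or> aff_dim S = 0" for S T using that by (auto simp: v_def)
    show "v (S, T) x \<bullet> outer_normal T f + v (S, T') x \<bullet> outer_normal T' f = 0"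
      if "(S, T) \<in> cells M X \<and> (S, T') \<in> cells M X \<and> T \<noteq> T' \<and>
        f facet_of T \<and> f facet_of T' \<and> rel_interior f \<subseteq> S" "x \<in> f" for S T T' f x
      using that off1 v_normal by simp
    show "v (S, T) x \<bullet> outer_normal T f = 0"
      if "(S, T) \<in> cells M X \<and> f facet_of T \<and> rel_interior f \<subseteq> bdN M" "x \<in> f" for S T f x
      using that off2 v_normal by blast
  qed
  moreover have "nflux (v c) (snd c) f = t c f" if g: "g \<in> ifaces M" and i: "(c, f) \<in> iface_facets g" for g c f
  proof -
    have "\<not> off_iface c f" using g i by (auto simp: off_iface_def iface_facets_def)
    then show ?thesis
      using v_flux[of "fst c" "snd c" f] iface_facet(1,2,4)[OF g i] by (simp add: s_def)
  qed
  moreover have "nflux (v c) (snd c) f = 0" if i: "c \<in> cells M X \<and> f facet_of snd c \<and> off_iface c f" for c f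
  proof -
    obtain x where x: "x \<in> f" using i by (auto simp: facet_of_def)
    have "v c y \<bullet> outer_normal (snd c) f = 0" if "y \<in> f" for y
      using v_normal[of "fst c" "snd c" f y] i that by simp
    then show ?thesis unfolding nflux_def using x by (intro the_equality) auto
  qed
  ultimately show ?thesis by blast
qed

end

context fracture_mesh
begin

section \<open>The discrete extension\<close>

lemma nflux_Vh:
  assumes v: "v \<in> Vh M X" and T: "c \<in> cells M X" "1 \<le> aff_dim (fst c)" "f facet_of snd c"
  shows "w \<in> Vh M X \<Longrightarrow> nflux ((v + w) c) (snd c) f = nflux (v c) (snd c) f + nflux (w c) (snd c) f"
    and "nflux ((k *\<^sub>R v) c) (snd c) f = k * nflux (v c) (snd c) f"
proof -
  obtain S T where c: "c = (S, T)" by (cases c)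
  have T': "(S, T) \<in> cells M X" "1 \<le> aff_dim S" "f facet_of T" using T c by auto
  note lin = nflux_linear[OF cell(2)[OF T'(1)] T'(2) VhD(1)[OF v T'(1,2)] T'(3)]
  show "w \<in> Vh M X \<Longrightarrow> nflux ((v + w) c) (snd c) f = nflux (v c) (snd c) f + nflux (w c) (snd c) f"
    using lin(1)[OF VhD(1)[OF _ T'(1,2)]] unfolding c plus_fun_apply[of v w] snd_conv by blast
  show "nflux ((k *\<^sub>R v) c) (snd c) f = k * nflux (v c) (snd c) f"
    using lin(2)[of k] unfolding c scaleR_fun_def[of k v] snd_conv by blast
qed

lemma normal_trace_eq:
  "normal_trace M X v g x = (if g \<in> ifaces M then
    (\<Sum>(c, f)\<in>iface_facets g. nflux (v c) (snd c) f * indicator (rel_interior f) x) else 0)"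
  unfolding normal_trace_def iface_facets_def by (auto intro!: sum.cong)

lemma normal_trace_at:
  assumes g: "g \<in> ifaces M" and i: "(c, f) \<in> iface_facets g" and x: "x \<in> rel_interior f"
  shows "normal_trace M X v g x = nflux (v c) (snd c) f"
proof -
  have "normal_trace M X v g x = (\<Sum>(c', f')\<in>iface_facets g. nflux (v c') (snd c') f' * indicator (rel_interior f') x)"
    using g by (simp add: normal_trace_eq)
  also have "\<dots> = (\<Sum>i\<in>{(c, f)}. case i of (c', f') \<Rightarrow> nflux (v c') (snd c') f' * indicator (rel_interior f') x)"
    using finite_iface_facets[OF g] i iface_facets_disjoint[OF g i _ x]
    by (intro sum.mono_neutral_right) (auto simp: indicator_def)
  finally show ?thesis using x by simp
qed

lemma normal_trace_linear:
  assumes "v \<in> Vh M X"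
  shows "w \<in> Vh M X \<Longrightarrow> normal_trace M X (v + w) g x = normal_trace M X v g x + normal_trace M X w g x"
    and "normal_trace M X (k *\<^sub>R v) g x = k * normal_trace M X v g x"
proof -
  show "w \<in> Vh M X \<Longrightarrow> normal_trace M X (v + w) g x = normal_trace M X v g x + normal_trace M X w g x"
    using nflux_Vh(1)[OF assms] iface_facet[of g] unfolding normal_trace_eq
    by (auto simp: sum.distrib[symmetric] distrib_right simp del: plus_fun_apply intro!: sum.cong)
  show "normal_trace M X (k *\<^sub>R v) g x = k * normal_trace M X v g x"
    using nflux_Vh(2)[OF assms] iface_facet[of g] unfolding normal_trace_eq
    by (auto simp: sum_distrib_left intro!: sum.cong)
qed

lemma normal_trace_cong:
  assumes "\<And>g c f. g \<in> ifaces M \<Longrightarrow> (c, f) \<in> iface_facets g \<Longrightarrow> nflux (v c) (snd c) f = nflux (w c) (snd c) f"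
  shows "normal_trace M X v = normal_trace M X w"
  using assms by (auto simp: fun_eq_iff normal_trace_eq intro!: sum.cong)

lemma bounded_borel_normal_trace: "bounded_borel (normal_trace M X v g)"
  unfolding normal_trace_eq[abs_def]
  by (cases "g \<in> ifaces M") (auto intro!: bounded_borel_intros rel_interior_borel simp: split_beta)

lemma bounded_borel_pw_const: "bounded_borel (pw_const \<T> q)"
  unfolding pw_const_def[abs_def] by (intro bounded_borel_intros rel_interior_borel)

lemma bounded_borel_mortar_fun: "bounded_borel (mortar_fun X \<mu> g)"
  and bounded_borel_cell_fun: "bounded_borel (cell_fun X q S)"
  unfolding mortar_fun_def cell_fun_def by (rule bounded_borel_pw_const)+

lemma mortar_fun_linear:
  "mortar_fun X (l + \<mu>) g x = mortar_fun X l g x + mortar_fun X \<mu> g x"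
  "mortar_fun X (k *\<^sub>R \<mu>) g x = k * mortar_fun X \<mu> g x"
  by (simp_all add: mortar_fun_def pw_const_def distrib_right sum.distrib scaleR_fun_def sum_distrib_left mult.assoc)

lemma cell_fun_linear:
  "cell_fun X (q + p) S x = cell_fun X q S x + cell_fun X p S x"
  "cell_fun X (k *\<^sub>R q) S x = k * cell_fun X q S x"
  by (simp_all add: cell_fun_def pw_const_def distrib_right sum.distrib scaleR_fun_def sum_distrib_left mult.assoc)

lemma set_integrable_iface: "g \<in> ifaces M \<Longrightarrow> bounded_borel f \<Longrightarrow> set_integrable (flat_measure (fst g)) (fst g) f"
  using iface_fst by (intro set_integrable_bounded_borel) auto

lemma ip_Gamma_linear:
  assumes "\<And>g. g \<in> ifaces M \<Longrightarrow> bounded_borel (\<phi> g)" "\<And>g. g \<in> ifaces M \<Longrightarrow> bounded_borel (\<psi> g)"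
  shows "(\<And>g. g \<in> ifaces M \<Longrightarrow> bounded_borel (\<phi>' g)) \<Longrightarrow>
      ip_Gamma M (\<lambda>g x. \<phi> g x + \<phi>' g x) \<psi> = ip_Gamma M \<phi> \<psi> + ip_Gamma M \<phi>' \<psi>"
    and "ip_Gamma M (\<lambda>g x. k * \<phi> g x) \<psi> = k * ip_Gamma M \<phi> \<psi>"
proof -
  have int: "set_integrable (flat_measure (fst g)) (fst g) (\<lambda>x. \<phi> g x * \<psi> g x)" if "g \<in> ifaces M"
    "bounded_borel (\<phi> g)" for g \<phi>
    using that assms by (intro set_integrable_iface bounded_borel_intros)
  show "ip_Gamma M (\<lambda>g x. \<phi> g x + \<phi>' g x) \<psi> = ip_Gamma M \<phi> \<psi> + ip_Gamma M \<phi>' \<psi>"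
    if "\<And>g. g \<in> ifaces M \<Longrightarrow> bounded_borel (\<phi>' g)"
    unfolding ip_Gamma_def sum.distrib[symmetric]
  proof (intro sum.cong refl)
    fix g assume g: "g \<in> ifaces M"
    show "(LINT x:fst g|flat_measure (fst g). (\<phi> g x + \<phi>' g x) * \<psi> g x) =
      (LINT x:fst g|flat_measure (fst g). \<phi> g x * \<psi> g x) + (LINT x:fst g|flat_measure (fst g). \<phi>' g x * \<psi> g x)"
      unfolding distrib_right by (rule set_integral_add(2)[OF int[of g \<phi>, OF g assms(1)[OF g]] int[of g \<phi>', OF g that[OF g]]])
  qed
  show "ip_Gamma M (\<lambda>g x. k * \<phi> g x) \<psi> = k * ip_Gamma M \<phi> \<psi>"
    by (simp add: ip_Gamma_def sum_distrib_left mult.assoc)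
qed

text \<open>The defining relation between a mortar function and its extension. It is linear in \<open>(\<mu>, v)\<close>, so linearity of the
  extension follows from unique solvability.\<close>

definition extends :: "('a mcell \<Rightarrow> real) \<Rightarrow> ('a cell \<Rightarrow> 'a \<Rightarrow> 'a) \<Rightarrow> bool"
  where "extends \<mu> v \<longleftrightarrow> v \<in> Vh M X \<and>
    (\<forall>w\<in>Vh M X. ip_Gamma M (\<lambda>g x. normal_trace M X v g x - mortar_fun X \<mu> g x) (normal_trace M X w) = 0) \<and>
    (\<forall>c f. c \<in> cells M X \<and> f facet_of snd c \<and> off_iface c f \<longrightarrow> nflux (v c) (snd c) f = 0)"

lemma extends_off:
  assumes "extends \<mu> v" "c \<in> cells M X" "f facet_of snd c" "off_iface c f"
  shows "nflux (v c) (snd c) f = 0"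
proof -
  from assms(1) have "\<forall>c f. c \<in> cells M X \<and> f facet_of snd c \<and> off_iface c f \<longrightarrow> nflux (v c) (snd c) f = 0"
    unfolding extends_def by (elim conjE)
  then show ?thesis using assms(2-4) by blast
qed

text \<open>On the relative interior of a facet the trace has the constant value of the flux, and this set has positive measure.\<close>

lemma trace_definite:
  assumes v: "v \<in> Vh M X" and 0: "ip_Gamma M (normal_trace M X v) (normal_trace M X v) = 0"
    and g: "g \<in> ifaces M" and i: "(c, f) \<in> iface_facets g"
  shows "nflux (v c) (snd c) f = 0"
proof -
  let ?t = "normal_trace M X v" and ?F = "flat_measure (fst g)" and ?\<phi> = "nflux (v c) (snd c) f"
  have nn: "0 \<le> (LINT x:fst g|flat_measure (fst g). ?t g x * ?t g x)" for g
    unfolding set_lebesgue_integral_def by (intro integral_nonneg_AE) auto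
  then have "(LINT x:fst g|?F. ?t g x * ?t g x) = 0"
    using 0 g finite_ifaces unfolding ip_Gamma_def by (subst (asm) sum_nonneg_eq_0_iff) auto
  moreover have "?\<phi>\<^sup>2 * measure ?F (rel_interior f) \<le> (LINT x:fst g|?F. ?t g x * ?t g x)"
  proof -
    have "?\<phi>\<^sup>2 * measure ?F (rel_interior f) = (LINT x:rel_interior f|?F. ?\<phi>\<^sup>2)"
      using rel_interior_borel iface_facet_measure_pos[OF g i]
      by (subst set_integral_const) (auto simp: measure_def)
    also have "\<dots> = (LINT x:fst g|?F. indicator (rel_interior f) x * ?\<phi>\<^sup>2)"
      using iface_facet(6)[OF g i] unfolding set_lebesgue_integral_def
      by (intro Bochner_Integration.integral_cong) (auto simp: indicator_def)
    also have "\<dots> \<le> (LINT x:fst g|?F. ?t g x * ?t g x)"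
    proof (rule set_integral_mono)
      show "set_integrable ?F (fst g) (\<lambda>x. indicator (rel_interior f) x * ?\<phi>\<^sup>2)"
        by (intro set_integrable_iface g bounded_borel_intros rel_interior_borel)
      show "set_integrable ?F (fst g) (\<lambda>x. ?t g x * ?t g x)"
        by (intro set_integrable_iface g bounded_borel_intros bounded_borel_normal_trace)
      show "indicator (rel_interior f) x * ?\<phi>\<^sup>2 \<le> ?t g x * ?t g x" for x
        using normal_trace_at[OF g i, of x v] by (cases "x \<in> rel_interior f") (auto simp: power2_eq_square)
    qed
    finally show ?thesis .
  qed
  ultimately have "?\<phi>\<^sup>2 * measure ?F (rel_interior f) \<le> 0" by simp
  then show ?thesis using iface_facet_measure_pos[OF g i] by (simp add: mult_le_0_iff)
qed

lemma orthogonal_trace_unique: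
  assumes v: "v \<in> Vh M X" "v' \<in> Vh M X"
    and o: "\<And>w. w \<in> Vh M X \<Longrightarrow> ip_Gamma M (\<lambda>g x. normal_trace M X v g x - mortar_fun X \<mu> g x) (normal_trace M X w) = 0"
      "\<And>w. w \<in> Vh M X \<Longrightarrow> ip_Gamma M (\<lambda>g x. normal_trace M X v' g x - mortar_fun X \<mu> g x) (normal_trace M X w) = 0"
    and g: "g \<in> ifaces M" and i: "(c, f) \<in> iface_facets g"
  shows "nflux (v c) (snd c) f = nflux (v' c) (snd c) f"
proof -
  define d where "d = v + (-1) *\<^sub>R v'"
  have mv': "(-1) *\<^sub>R v' \<in> Vh M X" using v(2) subspace_Vh by (rule_tac subspace_scale)
  have d: "d \<in> Vh M X" unfolding d_def using v(1) mv' subspace_Vh by (rule_tac subspace_add)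
  have td: "normal_trace M X d = (\<lambda>g x. (normal_trace M X v g x - mortar_fun X \<mu> g x) +
      (-1) * (normal_trace M X v' g x - mortar_fun X \<mu> g x))"
    unfolding d_def fun_eq_iff using normal_trace_linear(1)[OF v(1) mv'] normal_trace_linear(2)[OF v(2), of "-1"] by simp
  note bb = bounded_borel_intros bounded_borel_normal_trace bounded_borel_mortar_fun
  have "ip_Gamma M (normal_trace M X d) (normal_trace M X d) =
    ip_Gamma M (\<lambda>g x. normal_trace M X v g x - mortar_fun X \<mu> g x) (normal_trace M X d) +
    ip_Gamma M (\<lambda>g x. (-1) * (normal_trace M X v' g x - mortar_fun X \<mu> g x)) (normal_trace M X d)"
    by (subst (1) td, rule ip_Gamma_linear(1)) (intro bb)+
  also have "\<dots> = 0"
    by (subst ip_Gamma_linear(2)) (intro bb | simp add: o[OF d])+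
  finally have "nflux (d c) (snd c) f = 0" by (rule trace_definite[OF d _ g i])
  then show ?thesis
    using nflux_Vh(1)[OF v(1) iface_facet(1,4,2)[OF g i] mv'] nflux_Vh(2)[OF v(2) iface_facet(1,4,2)[OF g i], of "-1"]
    unfolding d_def by simp
qed

lemma extends_unique:
  assumes "extends \<mu> v" "extends \<mu> v'"
  shows "v = v'"
proof (rule Vh_eqI)
  show v: "v \<in> Vh M X" "v' \<in> Vh M X" using assms by (auto simp: extends_def)
  fix c f assume c: "c \<in> cells M X" "1 \<le> aff_dim (fst c)" "f facet_of snd c"
  show "nflux (v c) (snd c) f = nflux (v' c) (snd c) f"
  proof (cases "off_iface c f")
    case True
    then show ?thesis using extends_off[OF assms(1) c(1,3)] extends_off[OF assms(2) c(1,3)] by simp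
  next
    case False
    then obtain g where "g \<in> ifaces M" "(c, f) \<in> iface_facets g"
      using c by (auto simp: off_iface_def iface_facets_def)
    then show ?thesis using orthogonal_trace_unique[OF v, of \<mu>] assms unfolding extends_def by blast
  qed
qed

text \<open>The field whose flux through each interface facet is the mean value of the mortar function: the error then has
  mean zero on every facet, and the traces of test functions are constant there.\<close>

lemma extends_exists: "\<exists>v. extends \<mu> v"
proof -
  define G where "G c f = (SOME g. g \<in> ifaces M \<and> (c, f) \<in> iface_facets g)" for c f
  have G: "G c f = g" if "g \<in> ifaces M" "(c, f) \<in> iface_facets g" for g c f
    unfolding G_def using that iface_unique by (intro some_equality) blast+
  \<comment> \<open>a facet lies on at most one interface, which is the one chosen by \<open>G\<close>\<close>
  define t where "t c f = (LINT x:rel_interior f|flat_measure (fst (G c f)). mortar_fun X \<mu> (G c f) x) /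
    measure (flat_measure (fst (G c f))) (rel_interior f)" for c :: "'a cell" and f
  obtain v where v: "v \<in> Vh M X"
    "\<forall>g\<in>ifaces M. \<forall>(c, f)\<in>iface_facets g. nflux (v c) (snd c) f = t c f"
    "\<forall>c f. c \<in> cells M X \<and> f facet_of snd c \<and> off_iface c f \<longrightarrow> nflux (v c) (snd c) f = 0"
    using Vh_prescribed_flux[of t] by blast
  note bb = bounded_borel_intros bounded_borel_normal_trace bounded_borel_mortar_fun rel_interior_borel
  have "ip_Gamma M (\<lambda>g x. normal_trace M X v g x - mortar_fun X \<mu> g x) (normal_trace M X w) = 0" for w
    unfolding ip_Gamma_def
  proof (rule sum.neutral, rule ballI)
    fix g assume g: "g \<in> ifaces M"
    let ?F = "flat_measure (fst g)" and ?e = "\<lambda>x. normal_trace M X v g x - mortar_fun X \<mu> g x"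
    have zero: "(LINT x:fst g|?F. ?e x * indicator (rel_interior f) x) = 0" if i: "(c, f) \<in> iface_facets g" for c f
    proof -
      have sub: "rel_interior f \<subseteq> fst g" using iface_facet(6)[OF g i] .
      have fin: "emeasure ?F (rel_interior f) \<noteq> \<infinity>"
        using iface_facet_measure_pos[OF g i] by (auto simp: measure_def)
      have int: "set_integrable ?F (rel_interior f) h" if "bounded_borel h" for h
        using set_integrable_iface[OF g that] sub rel_interior_borel by (rule_tac set_integrable_subset) auto
      have "(LINT x:fst g|?F. ?e x * indicator (rel_interior f) x) =
        (LINT x:rel_interior f|?F. t c f - mortar_fun X \<mu> g x)"
        unfolding set_lebesgue_integral_def
      proof (intro Bochner_Integration.integral_cong refl)
        fix x
        show "indicat_real (fst g) x *\<^sub>R (?e x * indicator (rel_interior f) x) =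
          indicat_real (rel_interior f) x *\<^sub>R (t c f - mortar_fun X \<mu> g x)"
          using normal_trace_at[OF g i, of x v] v(2) g i sub by (auto simp: indicator_def)
      qed
      also have "\<dots> = (LINT x:rel_interior f|?F. t c f) - (LINT x:rel_interior f|?F. mortar_fun X \<mu> g x)"
        by (intro set_integral_diff int bb)
      also have "(LINT x:rel_interior f|?F. t c f) = measure ?F (rel_interior f) * t c f"
        using fin rel_interior_borel by (subst set_integral_const) auto
      also have "\<dots> = (LINT x:rel_interior f|?F. mortar_fun X \<mu> g x)"
        using iface_facet_measure_pos[OF g i] unfolding t_def G[OF g i] by simp
      finally show ?thesis by simp
    qed
    have "(LINT x:fst g|?F. ?e x * normal_trace M X w g x) =
      (LINT x:fst g|?F. \<Sum>(c, f)\<in>iface_facets g. nflux (w c) (snd c) f * (?e x * indicator (rel_interior f) x))"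
      using g by (simp add: normal_trace_eq[of w] sum_distrib_left split_beta ac_simps)
    also have "\<dots> = (\<Sum>(c, f)\<in>iface_facets g. LINT x:fst g|?F. nflux (w c) (snd c) f * (?e x * indicator (rel_interior f) x))"
      unfolding split_beta by (rule set_integral_sum(2)) (intro set_integrable_iface g bb)
    also have "\<dots> = 0"
      using zero by (intro sum.neutral) auto
    finally show "(LINT x:fst g|?F. ?e x * normal_trace M X w g x) = 0" .
  qed
  then have "extends \<mu> v" using v(1,3) by (simp add: extends_def)
  then show ?thesis by blast
qed

lemma extends_R_h: "extends \<mu> (R_h M X \<mu>)"
proof -
  obtain v where v: "extends \<mu> v" using extends_exists by blast
  then have vV: "v \<in> Vh M X" by (simp add: extends_def)
  have Pi: "Pi_h M X \<mu> = normal_trace M X v"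
    unfolding Pi_h_def
  proof (rule the_equality)
    show "normal_trace M X v \<in> normal_trace M X ` Vh M X \<and>
      (\<forall>w\<in>Vh M X. ip_Gamma M (\<lambda>g x. normal_trace M X v g x - mortar_fun X \<mu> g x) (normal_trace M X w) = 0)"
      using v by (auto simp: extends_def)
    fix t assume t: "t \<in> normal_trace M X ` Vh M X \<and>
      (\<forall>w\<in>Vh M X. ip_Gamma M (\<lambda>g x. t g x - mortar_fun X \<mu> g x) (normal_trace M X w) = 0)"
    then obtain v' where v': "v' \<in> Vh M X" "t = normal_trace M X v'" by blast
    show "t = normal_trace M X v"
      unfolding v'(2)
    proof (rule normal_trace_cong)
      show "nflux (v' c) (snd c) f = nflux (v c) (snd c) f" if "g \<in> ifaces M" "(c, f) \<in> iface_facets g" for g c f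
        using orthogonal_trace_unique[OF v'(1) vV, of \<mu>] t v that unfolding v'(2) extends_def by blast
    qed
  qed
  have "R_h M X \<mu> = v"
    unfolding R_h_def Pi
  proof (rule the_equality)
    show "v \<in> Vh M X \<and> normal_trace M X v = normal_trace M X v \<and>
      (\<forall>S T f. (S, T) \<in> cells M X \<and> f facet_of T \<and> \<not> (\<exists>g\<in>ifaces M. on_iface g (S, T) f) \<longrightarrow> nflux (v (S, T)) T f = 0)"
      using v unfolding extends_def off_iface_def by force
    fix v' assume v': "v' \<in> Vh M X \<and> normal_trace M X v' = normal_trace M X v \<and>
      (\<forall>S T f. (S, T) \<in> cells M X \<and> f facet_of T \<and> \<not> (\<exists>g\<in>ifaces M. on_iface g (S, T) f) \<longrightarrow> nflux (v' (S, T)) T f = 0)"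
    then have "extends \<mu> v'" using v unfolding extends_def off_iface_def by auto
    then show "v' = v" using v by (rule extends_unique)
  qed
  then show ?thesis using v by simp
qed

lemma R_h_in: "R_h M X \<mu> \<in> Vh M X"
  using extends_R_h by (simp add: extends_def)

lemma R_h_combination: "R_h M X (k *\<^sub>R l + \<mu>) = k *\<^sub>R R_h M X l + R_h M X \<mu>"
proof -
  note l = extends_R_h[of l, unfolded extends_def] and m = extends_R_h[of \<mu>, unfolded extends_def]
  let ?l = "R_h M X l" and ?m = "R_h M X \<mu>"
  have kl: "k *\<^sub>R ?l \<in> Vh M X" using R_h_in subspace_Vh by (rule_tac subspace_scale)
  note bb = bounded_borel_intros bounded_borel_normal_trace bounded_borel_mortar_fun
  have "extends (k *\<^sub>R l + \<mu>) (k *\<^sub>R ?l + ?m)"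
    unfolding extends_def
  proof (intro conjI ballI allI impI)
    show "k *\<^sub>R ?l + ?m \<in> Vh M X" using kl R_h_in subspace_Vh by (rule_tac subspace_add)
    fix w assume w: "w \<in> Vh M X"
    let ?el = "\<lambda>g x. normal_trace M X ?l g x - mortar_fun X l g x"
    let ?em = "\<lambda>g x. normal_trace M X ?m g x - mortar_fun X \<mu> g x"
    have eq: "(\<lambda>g x. normal_trace M X (k *\<^sub>R ?l + ?m) g x - mortar_fun X (k *\<^sub>R l + \<mu>) g x) =
      (\<lambda>g x. k * ?el g x + ?em g x)"
      unfolding mortar_fun_linear normal_trace_linear(1)[OF kl R_h_in] normal_trace_linear(2)[OF R_h_in]
      by (simp add: algebra_simps)
    have "ip_Gamma M (\<lambda>g x. k * ?el g x + ?em g x) (normal_trace M X w) =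
      ip_Gamma M (\<lambda>g x. k * ?el g x) (normal_trace M X w) + ip_Gamma M ?em (normal_trace M X w)"
      by (rule ip_Gamma_linear(1)) (intro bb)+
    also have "ip_Gamma M (\<lambda>g x. k * ?el g x) (normal_trace M X w) = k * ip_Gamma M ?el (normal_trace M X w)"
      by (rule ip_Gamma_linear(2)) (intro bb)+
    finally show "ip_Gamma M (\<lambda>g x. normal_trace M X (k *\<^sub>R ?l + ?m) g x - mortar_fun X (k *\<^sub>R l + \<mu>) g x)
        (normal_trace M X w) = 0"
      unfolding eq using l m w by simp
  next
    fix c f assume c: "c \<in> cells M X \<and> f facet_of snd c \<and> off_iface c f"
    then have c1: "c \<in> cells M X" and c2: "f facet_of snd c" by auto
    have off: "nflux (?l c) (snd c) f = 0" "nflux (?m c) (snd c) f = 0"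
      using extends_off[OF extends_R_h] c by blast+
    show "nflux ((k *\<^sub>R ?l + ?m) c) (snd c) f = 0"
    proof (cases "1 \<le> aff_dim (fst c)")
      case True
      show ?thesis
        unfolding nflux_Vh(1)[OF kl c1 True c2 R_h_in] nflux_Vh(2)[OF R_h_in c1 True c2] using off by simp
    next
      case False
      then have "?l c = 0" "?m c = 0" using Vh_cell(2)[OF R_h_in] by auto
      then have "(k *\<^sub>R ?l + ?m) c = ?l c" by (simp add: scaleR_fun_def[of k ?l])
      then show ?thesis using off(1) by simp
    qed
  qed
  then show ?thesis using extends_unique extends_R_h by blast
qed

lemma R_h_add: "R_h M X (l + \<mu>) = R_h M X l + R_h M X \<mu>"
  using R_h_combination[of 1 l \<mu>] by simp

lemma R_h_scale: "R_h M X (k *\<^sub>R l) = k *\<^sub>R R_h M X l"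
proof -
  have "R_h M X 0 = 0" using R_h_combination[of "-1" 0 0] by simp
  then show ?thesis using R_h_combination[of k l 0] by simp
qed

end

section \<open>The bilinear forms of the mixed-dimensional problem\<close>

lemma psd_form_zero: "subspace V \<Longrightarrow> (\<And>x y. x \<in> V \<Longrightarrow> y \<in> V \<Longrightarrow> a x y = 0) \<Longrightarrow> psd_form V a"
  by unfold_locales (simp_all add: subspace_add subspace_scale)

lemma psd_form_sum:
  assumes "subspace V" "\<And>i. i \<in> I \<Longrightarrow> psd_form V (a i)"
  shows "psd_form V (\<lambda>x y. \<Sum>i\<in>I. a i x y)"
proof
  fix x y z c assume x: "x \<in> V" and y: "y \<in> V"
  show "(\<Sum>i\<in>I. a i x y) = (\<Sum>i\<in>I. a i y x)"
    using psd_form.sym[OF assms(2)] x y by (intro sum.cong) auto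
  show "(\<Sum>i\<in>I. a i (c *\<^sub>R x) y) = c * (\<Sum>i\<in>I. a i x y)"
    unfolding sum_distrib_left using psd_form.scale_left[OF assms(2)] x y by (intro sum.cong) auto
  show "(\<Sum>i\<in>I. a i (x + y) z) = (\<Sum>i\<in>I. a i x z) + (\<Sum>i\<in>I. a i y z)" if "z \<in> V"
    unfolding sum.distrib[symmetric] using psd_form.add_left[OF assms(2)] x y that by (intro sum.cong) auto
  show "0 \<le> (\<Sum>i\<in>I. a i x x)"
    using psd_form.nonneg[OF assms(2)] x by (intro sum_nonneg) auto
qed (rule assms(1))

lemma psd_form_add:
  assumes "psd_form V a" "psd_form V b"
  shows "psd_form V (\<lambda>x y. a x y + b x y)"
proof -
  interpret a: psd_form V a by fact
  interpret b: psd_form V b by fact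
  show ?thesis
  proof
    show "a x y + b x y = a y x + b y x" if "x \<in> V" "y \<in> V" for x y
      using that by (simp add: a.sym[of x y] b.sym[of x y])
  qed (simp_all add: a.subspace_V a.add_left b.add_left a.scale_left b.scale_left a.nonneg b.nonneg distrib_left)
qed

lemma psd_form_pullback:
  assumes "psd_form W a" "subspace V" "\<And>x. x \<in> V \<Longrightarrow> T x \<in> W"
    "\<And>x y. x \<in> V \<Longrightarrow> y \<in> V \<Longrightarrow> T (x + y) = T x + T y" "\<And>c x. x \<in> V \<Longrightarrow> T (c *\<^sub>R x) = c *\<^sub>R T x"
  shows "psd_form V (\<lambda>x y. a (T x) (T y))"
proof -
  interpret a: psd_form W a by fact
  show ?thesis
  proof
    show "a (T x) (T y) = a (T y) (T x)" if "x \<in> V" "y \<in> V" for x y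
      using that assms(3) by (intro a.sym)
  qed (use assms(2-) in \<open>simp_all add: a.add_left a.scale_left a.nonneg\<close>)
qed

text \<open>Families of cell-wise polynomials, and of cell-wise constants, are spanned by the finitely many families which are
  supported on a single cell and have a basis polynomial there.\<close>

lemma finitely_supported_in_span:
  fixes v :: "'c \<Rightarrow> 'v::real_vector"
  assumes "finite I" "\<And>c. c \<notin> I \<Longrightarrow> v c = 0" "\<And>c. c \<in> I \<Longrightarrow> v c \<in> span B"
  shows "v \<in> span ((\<lambda>(c, p). \<lambda>c'. if c' = c then p else 0) ` (I \<times> B))" (is "_ \<in> span ?G")
proof -
  let ?\<iota> = "\<lambda>c p. \<lambda>c'. if c' = c then p else 0 :: 'v"
  have "?\<iota> c (v c) \<in> span ?G" if c: "c \<in> I" for c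
  proof -
    have lin: "linear (?\<iota> c)" by (rule linearI) (auto simp: fun_eq_iff scaleR_fun_def)
    have "?\<iota> c (v c) \<in> ?\<iota> c ` span B" using assms(3)[OF c] by blast
    also have "\<dots> = span (?\<iota> c ` B)" using linear_span_image[OF lin] by simp
    also have "\<dots> \<subseteq> span ?G" using c by (intro span_mono) auto
    finally show ?thesis .
  qed
  then have "(\<Sum>c\<in>I. ?\<iota> c (v c)) \<in> span ?G" by (rule span_sum)
  moreover have "(\<Sum>c\<in>I. ?\<iota> c (v c)) = v"
  proof
    fix c'
    have "(\<Sum>c\<in>J. ?\<iota> c (v c)) c' = (\<Sum>c\<in>J. if c' = c then v c else 0)" if "finite J" for J
      using that by (induction J rule: finite_induct) auto
    then show "(\<Sum>c\<in>I. ?\<iota> c (v c)) c' = v c'" using assms(1,2) by simp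
  qed
  ultimately show ?thesis by simp
qed

context fracture_mesh
begin

lemma Vh_affine:
  assumes "v \<in> Vh M X" "(S, T) \<in> cells M X"
  obtains a b where "v (S, T) = (\<lambda>x. a + b *\<^sub>R x)"
proof (cases "1 \<le> aff_dim S")
  case True
  then obtain a b c where "v (S, T) = (\<lambda>x. a + b *\<^sub>R (x - c))"
    using VhD(1)[OF assms(1,2)] by (auto simp: RT0_def)
  then show thesis by (intro that[of "a - b *\<^sub>R c" b]) (simp add: algebra_simps)
next
  case False
  then have "v (S, T) = 0" using Vh_cell(2)[OF assms(1), of "(S, T)"] by simp
  then show thesis by (intro that[of 0 0]) (simp add: fun_eq_iff)
qed

lemma Wh_finite_span: "\<exists>F. finite F \<and> Wh M X \<subseteq> span F"
proof -
  define B1 :: "('a \<Rightarrow> 'a) set" where "B1 = insert (\<lambda>x. x) ((\<lambda>e x. e) ` Basis)"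
  define F1 where "F1 = (\<lambda>(c, p). \<lambda>c'. if c' = c then p else 0) ` (cells M X \<times> B1)"
  define F2 :: "('a mcell \<Rightarrow> real) set" where "F2 = (\<lambda>(c, p). \<lambda>c'. if c' = c then p else 0) ` (mcells M X \<times> {1})"
  let ?i = "\<lambda>v. (v, 0) :: 'a flux" and ?j = "\<lambda>l. (0, l) :: 'a flux"
  have lin: "linear ?i" "linear ?j" by (auto intro!: linearI)
  have "x \<in> span (?i ` F1 \<union> ?j ` F2)" if x: "x \<in> Wh M X" for x
  proof -
    have v: "fst x \<in> Vh M X" and l: "snd x \<in> Lamh M X" using x V0h_sub_Vh by (auto simp: Wh_def)
    have "fst x \<in> span F1"
      unfolding F1_def
    proof (rule finitely_supported_in_span[OF finite_cells])
      show "fst x c = 0" if "c \<notin> cells M X" for c using Vh_cell(2)[OF v, of c] that by simp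
      fix c assume c: "c \<in> cells M X"
      obtain a b where ab: "fst x c = (\<lambda>x. a + b *\<^sub>R x)" using Vh_affine[OF v, of "fst c" "snd c"] c by auto
      have lin': "linear (\<lambda>e (x::'a). e :: 'a)" by (rule linearI) (auto simp: scaleR_fun_def fun_eq_iff)
      have "(\<lambda>x::'a. a) \<in> (\<lambda>e x. e) ` span Basis" by simp
      also have "\<dots> = span ((\<lambda>e (x::'a). e) ` Basis)" using linear_span_image[OF lin'] by simp
      also have "\<dots> \<subseteq> span B1" unfolding B1_def by (intro span_mono) auto
      finally have "(\<lambda>x. a) + b *\<^sub>R (\<lambda>x. x) \<in> span B1"
        by (rule span_add[OF _ span_scale[OF span_base]]) (simp add: B1_def)
      moreover have "fst x c = (\<lambda>x. a) + b *\<^sub>R (\<lambda>x. x)" unfolding ab by (simp add: fun_eq_iff scaleR_fun_def)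
      ultimately show "fst x c \<in> span B1" by simp
    qed
    then have "?i (fst x) \<in> span (?i ` F1)" using linear_span_image[OF lin(1)] by blast
    then have 1: "?i (fst x) \<in> span (?i ` F1 \<union> ?j ` F2)" using span_mono[of "?i ` F1"] by blast
    have "snd x \<in> span F2"
      unfolding F2_def
      by (rule finitely_supported_in_span[OF finite_mcells]) (use l in \<open>auto simp: Lamh_def span_singleton\<close>)
    then have "?j (snd x) \<in> span (?j ` F2)" using linear_span_image[OF lin(2)] by blast
    then have "?j (snd x) \<in> span (?i ` F1 \<union> ?j ` F2)" using span_mono[of "?j ` F2"] by blast
    from span_add[OF 1 this] show ?thesis by simp
  qed
  moreover have "finite (?i ` F1 \<union> ?j ` F2)"
    unfolding F1_def F2_def B1_def using finite_cells finite_mcells by auto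
  ultimately show ?thesis by blast
qed

lemma Qh_finite_span: "\<exists>F. finite F \<and> Qh M X \<subseteq> span F"
proof -
  let ?F = "(\<lambda>(c, p). \<lambda>c'. if c' = c then p else 0) ` (cells M X \<times> {1})"
  have "Qh M X \<subseteq> span ?F"
    by (rule subsetI, rule finitely_supported_in_span[OF finite_cells]) (auto simp: Qh_def span_singleton)
  moreover have "finite ?F" using finite_cells by simp
  ultimately show ?thesis by (intro exI[of _ ?F] conjI)
qed

lemma surface_div_affine: "surface_div S (\<lambda>x. a + b *\<^sub>R x) y = b * (\<Sum>e\<in>orthobasis S. e \<bullet> e)"
proof -
  have "((\<lambda>x. a + b *\<^sub>R x) has_derivative (\<lambda>h. b *\<^sub>R h)) (at y)"
    by (auto intro!: derivative_eq_intros)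
  then show ?thesis
    unfolding surface_div_def by (simp add: frechet_derivative_at[symmetric] sum_distrib_left)
qed

lemma surface_div_linear:
  assumes "v \<in> Vh M X" "(S, T) \<in> cells M X"
  shows "w \<in> Vh M X \<Longrightarrow> surface_div S ((v + w) (S, T)) y = surface_div S (v (S, T)) y + surface_div S (w (S, T)) y"
    and "surface_div S ((k *\<^sub>R v) (S, T)) y = k * surface_div S (v (S, T)) y"
    and "surface_div S (v (S, T)) y = surface_div S (v (S, T)) 0"
proof -
  obtain a b where ab: "v (S, T) = (\<lambda>x. a + b *\<^sub>R x)" using Vh_affine[OF assms] .
  show "surface_div S ((v + w) (S, T)) y = surface_div S (v (S, T)) y + surface_div S (w (S, T)) y" if w: "w \<in> Vh M X"
  proof -
    obtain a' b' where ab': "w (S, T) = (\<lambda>x. a' + b' *\<^sub>R x)" using Vh_affine[OF w assms(2)] .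
    have "(v + w) (S, T) = (\<lambda>x. (a + a') + (b + b') *\<^sub>R x)"
      unfolding plus_fun_apply[of v w] ab ab' by (simp add: fun_eq_iff algebra_simps)
    then show ?thesis unfolding ab ab' by (simp add: surface_div_affine distrib_right)
  qed
  have "(k *\<^sub>R v) (S, T) = (\<lambda>x. k *\<^sub>R a + (k * b) *\<^sub>R x)"
    unfolding scaleR_fun_def[of k v] ab by (simp add: scaleR_fun_def algebra_simps)
  then show "surface_div S ((k *\<^sub>R v) (S, T)) y = k * surface_div S (v (S, T)) y"
    unfolding ab by (simp add: surface_div_affine)
  show "surface_div S (v (S, T)) y = surface_div S (v (S, T)) 0" unfolding ab by (simp add: surface_div_affine)
qed

lemma mixed_div_linear:
  assumes v: "v \<in> Vh M X" and S: "S \<in> subdomains M"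
  shows "w \<in> Vh M X \<Longrightarrow> mixed_div M X (v + w) (l + \<mu>) S x = mixed_div M X v l S x + mixed_div M X w \<mu> S x"
    and "mixed_div M X (k *\<^sub>R v) (k *\<^sub>R l) S x = k * mixed_div M X v l S x"
    and "bounded_borel (mixed_div M X v l S)"
proof -
  have T: "(S, T) \<in> cells M X" if "T \<in> tri X S" for T using that S by (simp add: cells_def)
  show "mixed_div M X (v + w) (l + \<mu>) S x = mixed_div M X v l S x + mixed_div M X w \<mu> S x" if "w \<in> Vh M X"
    unfolding mixed_div_def jump_def
    using surface_div_linear(1)[OF v T that]
    by (simp add: mortar_fun_linear sum.distrib distrib_right del: plus_fun_apply cong: sum.cong)
  show "mixed_div M X (k *\<^sub>R v) (k *\<^sub>R l) S x = k * mixed_div M X v l S x"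
    unfolding mixed_div_def jump_def
    using surface_div_linear(2)[OF v T]
    by (simp add: mortar_fun_linear sum_distrib_left[symmetric] right_diff_distrib mult.assoc cong: sum.cong)
  have "mixed_div M X v l S = (\<lambda>x. (\<Sum>T\<in>tri X S. surface_div S (v (S, T)) 0 * indicator (rel_interior T) x) + jump M X l S x)"
  proof
    fix x
    show "mixed_div M X v l S x = (\<Sum>T\<in>tri X S. surface_div S (v (S, T)) 0 * indicator (rel_interior T) x) + jump M X l S x"
      unfolding mixed_div_def
      by (rule arg_cong2[where f = "(+)"], rule sum.cong[OF refl], subst surface_div_linear(3)[OF v T]) simp_all
  qed
  then show "bounded_borel (mixed_div M X v l S)"
    unfolding jump_def by (simp only:) (intro bounded_borel_intros bounded_borel_mortar_fun rel_interior_borel)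
qed

definition total_flux :: "'a flux \<Rightarrow> 'a cell \<Rightarrow> 'a \<Rightarrow> 'a"
  where "total_flux w = fst w + R_h M X (snd w)"

lemma total_flux_in: "w \<in> Wh M X \<Longrightarrow> total_flux w \<in> Vh M X"
  unfolding total_flux_def using V0h_sub_Vh R_h_in by (intro subspace_add[OF subspace_Vh]) (auto simp: Wh_def)

lemma total_flux_linear:
  "total_flux (w + r) = total_flux w + total_flux r" "total_flux (k *\<^sub>R w) = k *\<^sub>R total_flux w"
  by (simp_all add: total_flux_def R_h_add R_h_scale scaleR_add_right ac_simps)

lemma set_integrable_subdomain: "S \<in> subdomains M \<Longrightarrow> bounded_borel f \<Longrightarrow> set_integrable (flat_measure S) S f"
  by (erule subdomains_E) (auto intro: set_integrable_bounded_borel dest: subdom)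

lemma form_b_linear:
  assumes w: "w \<in> Wh M X"
  shows "r \<in> Wh M X \<Longrightarrow> form_b M X (w + r) q = form_b M X w q + form_b M X r q"
    and "form_b M X (k *\<^sub>R w) q = k * form_b M X w q"
    and "form_b M X w (q + p) = form_b M X w q + form_b M X w p"
    and "form_b M X w (k *\<^sub>R q) = k * form_b M X w q"
proof -
  let ?I = "\<lambda>w q S. LINT x:S|flat_measure S. cell_fun X q S x * mixed_div M X (total_flux w) (snd w) S x"
  have b: "form_b M X w q = - (\<Sum>S\<in>subdomains M. ?I w q S)" for w q
    by (simp add: form_b_def total_flux_def)
  note tw = total_flux_in[OF w]
  have int: "set_integrable (flat_measure S) S (\<lambda>x. cell_fun X q S x * mixed_div M X (total_flux w) (snd w) S x)"
    if "S \<in> subdomains M" "w \<in> Wh M X" for S w q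
    using that total_flux_in mixed_div_linear(3)
    by (intro set_integrable_subdomain bounded_borel_mult bounded_borel_cell_fun) auto
  show "form_b M X (w + r) q = form_b M X w q + form_b M X r q" if r: "r \<in> Wh M X"
  proof -
    have "?I (w + r) q S = ?I w q S + ?I r q S" if S: "S \<in> subdomains M" for S
      unfolding total_flux_linear snd_add mixed_div_linear(1)[OF tw S total_flux_in[OF r]] distrib_left
      by (rule set_integral_add(2)[OF int[OF S w] int[OF S r]])
    then show ?thesis unfolding b by (simp add: sum.distrib)
  qed
  show "form_b M X (k *\<^sub>R w) q = k * form_b M X w q"
  proof -
    have "?I (k *\<^sub>R w) q S = k * ?I w q S" if S: "S \<in> subdomains M" for S
      unfolding total_flux_linear snd_scaleR mixed_div_linear(2)[OF tw S] mult.left_commute[of _ k] by simp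
    then show ?thesis unfolding b by (simp add: sum_distrib_left)
  qed
  show "form_b M X w (q + p) = form_b M X w q + form_b M X w p"
  proof -
    have "?I w (q + p) S = ?I w q S + ?I w p S" if S: "S \<in> subdomains M" for S
      unfolding cell_fun_linear distrib_right
      by (rule set_integral_add(2)[OF int[OF S w] int[OF S w]])
    then show ?thesis unfolding b by (simp add: sum.distrib)
  qed
  show "form_b M X w (k *\<^sub>R q) = k * form_b M X w q"
    unfolding b cell_fun_linear by (simp add: sum_distrib_left mult.assoc)
qed

end

locale fracture_problem = fracture_mesh M X \<sigma>
  for M :: "'a::euclidean_space medium" and X \<sigma> +
  fixes P :: "'a params" and \<theta> :: real
  assumes params: "admissible_params M \<theta> P"
begin

lemma perm_inverse:
  assumes S: "S \<in> subdomains M"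
  shows "\<exists>L. \<exists>k>0. linear L \<and> (\<forall>y\<in>tangent S. perm_inv P S y = L y) \<and> psd_form (tangent S) (\<lambda>x y. L x \<bullet> y) \<and>
    (\<forall>y\<in>tangent S. k * (L y \<bullet> y) \<le> (norm y)\<^sup>2 \<and> (norm y)\<^sup>2 \<le> \<theta> * k * (L y \<bullet> y))"
proof -
  obtain d where "S \<in> subdom M d" using S by (rule subdomains_E)
  then have W: "subspace (tangent S)" using subdom(1) by (intro subspace_tangent)
  from params have "\<forall>S\<in>subdomains M. linear (perm P S) \<and> perm P S ` tangent S \<subseteq> tangent S \<and>
       (\<forall>x\<in>tangent S. \<forall>y\<in>tangent S. perm P S x \<bullet> y = x \<bullet> perm P S y) \<and>
       (\<exists>k>0. \<forall>x\<in>tangent S. k * (norm x)\<^sup>2 \<le> perm P S x \<bullet> x \<and> perm P S x \<bullet> x \<le> \<theta> * k * (norm x)\<^sup>2)"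
    unfolding admissible_params_def by (elim conjE)
  then have p: "linear (perm P S)" "perm P S ` tangent S \<subseteq> tangent S"
    "\<And>x y. x \<in> tangent S \<Longrightarrow> y \<in> tangent S \<Longrightarrow> perm P S x \<bullet> y = x \<bullet> perm P S y"
    "\<exists>k>0. \<forall>x\<in>tangent S. k * (norm x)\<^sup>2 \<le> perm P S x \<bullet> x \<and> perm P S x \<bullet> x \<le> \<theta> * k * (norm x)\<^sup>2"
    using S by blast+
  obtain k where k: "k > 0" "\<And>x. x \<in> tangent S \<Longrightarrow> k * (norm x)\<^sup>2 \<le> perm P S x \<bullet> x"
    "\<And>x. x \<in> tangent S \<Longrightarrow> perm P S x \<bullet> x \<le> \<theta> * k * (norm x)\<^sup>2" using p(4) by blast
  show ?thesis
    unfolding perm_inv_def using elliptic_inverse[OF W p(1-3) k] k(1) by blast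
qed

definition mass :: "'a cell \<Rightarrow> ('a cell \<Rightarrow> 'a \<Rightarrow> 'a) \<Rightarrow> ('a cell \<Rightarrow> 'a \<Rightarrow> 'a) \<Rightarrow> real"
  where "mass c u v = (LINT x:snd c|flat_measure (fst c). perm_inv P (fst c) (u c x) \<bullet> v c x)"

definition diagonal_mass :: "'a cell \<Rightarrow> ('a cell \<Rightarrow> 'a \<Rightarrow> 'a) \<Rightarrow> ('a cell \<Rightarrow> 'a \<Rightarrow> 'a) \<Rightarrow> real"
  where "diagonal_mass c u v = (\<Sum>f | f facet_of snd c. nflux (u c) (snd c) f * nflux (v c) (snd c) f *
    (LINT x:snd c|flat_measure (fst c). perm_inv P (fst c) (RT0_basis (snd c) f x) \<bullet> RT0_basis (snd c) f x))"

lemma ipK_eq: "ipK M X P = (\<lambda>u v. \<Sum>c\<in>cells M X. mass c u v)"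
  and ipKD_eq: "ipKD M X P = (\<lambda>u v. \<Sum>c\<in>cells M X. diagonal_mass c u v)"
  by (simp_all add: fun_eq_iff ipK_def ipKD_def mass_def diagonal_mass_def split_beta)

text \<open>The constant of \<open>diagonal_le_mass\<close>, with the dimension of the cell replaced by that of the space.\<close>

definition cell_const :: real
  where "cell_const = (DIM('a) + 1) * ((8 * 2 ^ DIM('a) + 2) * \<sigma>\<^sup>2 * \<bar>\<theta>\<bar>)"

text \<open>On cells of dimension \<open>0\<close> the fields vanish and there are no facets, so both forms are zero. On all others the estimates for a
  single simplex apply.\<close>

lemma cell_forms:
  assumes c: "c \<in> cells M X"
  shows "psd_form (Vh M X) (mass c)" "psd_form (Vh M X) (diagonal_mass c)"
    "v \<in> Vh M X \<Longrightarrow> mass c v v \<le> (DIM('a) + 1) * diagonal_mass c v v"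
    "v \<in> Vh M X \<Longrightarrow> diagonal_mass c v v \<le> cell_const * mass c v v"
proof -
  obtain S T where ST: "c = (S, T)" by (cases c)
  have T: "(S, T) \<in> cells M X" using c ST by simp
  have "psd_form (Vh M X) (mass c) \<and> psd_form (Vh M X) (diagonal_mass c) \<and>
    (\<forall>v\<in>Vh M X. mass c v v \<le> (DIM('a) + 1) * diagonal_mass c v v \<and> diagonal_mass c v v \<le> cell_const * mass c v v)"
  proof (cases "1 \<le> aff_dim S")
    case False
    have zero: "v c = 0" if "v \<in> Vh M X" for v using Vh_cell(2)[OF that, of c] False ST by simp
    have dimT: "aff_dim T = 0" using aff_dim_simplex[OF cell(2)[OF T]] cell(7)[OF T] False by simp
    have "\<not> f facet_of T" for f
    proof
      assume f: "f facet_of T"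
      then have "aff_dim f < 0" unfolding facet_of_def dimT by linarith
      then show False using f unfolding facet_of_def aff_dim_negative_iff by blast
    qed
    then have d0: "diagonal_mass c u v = 0" for u v by (simp add: diagonal_mass_def ST)
    have m0: "mass c u v = 0" if "v \<in> Vh M X" for u v
      by (simp add: mass_def zero[OF that] set_lebesgue_integral_def)
    have "psd_form (Vh M X) (mass c)" "psd_form (Vh M X) (diagonal_mass c)"
      using m0 d0 by (auto intro: psd_form_zero subspace_Vh)
    then show ?thesis by (simp add: m0 d0)
  next
    case dim: True
    obtain L k where L: "linear L" "k > 0" "\<And>y. y \<in> tangent S \<Longrightarrow> perm_inv P S y = L y"
      "psd_form (tangent S) (\<lambda>x y. L x \<bullet> y)"
      "\<And>y. y \<in> tangent S \<Longrightarrow> k * (L y \<bullet> y) \<le> (norm y)\<^sup>2"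
      "\<And>y. y \<in> tangent S \<Longrightarrow> (norm y)\<^sup>2 \<le> \<theta> * k * (L y \<bullet> y)"
      using perm_inverse[OF cell(1)[OF T]] by blast
    interpret L: psd_form "tangent S" "\<lambda>x y. L x \<bullet> y" by (rule L(4))
    let ?F = "flat_measure S"
    note simp = cell(2)[OF T] and hull = cell(4)[OF T]
    note RT = VhD(1)[OF _ T dim] and tan = RT0_tangent[OF simp dim hull L(1,4)]
    note int = set_integrable_RT0[OF simp dim hull L(1,4)]
    have Tb: "T \<in> sets borel" using simplex_compact[OF simp dim] by (rule borel_compact)
    have perm_L: "(LINT x:T|?F. perm_inv P S (u x) \<bullet> v x) = (LINT x:T|?F. L (u x) \<bullet> v x)" if "u \<in> RT0 T" for u v
      using L(3) tan[OF that] Tb by (intro set_lebesgue_integral_cong) auto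
    have mass: "mass c u v = (LINT x:T|?F. L (u c x) \<bullet> v c x)" if "u \<in> Vh M X" for u v
      unfolding mass_def ST using perm_L[OF RT[OF that]] by simp
    have nn: "0 \<le> (LINT x:T|?F. L (u x) \<bullet> u x)" if "u \<in> RT0 T" for u
      unfolding set_lebesgue_integral_def using L.nonneg[OF tan[OF that]]
      by (intro integral_nonneg_AE) (auto simp: indicator_def)
    define m where "m f = (LINT x:T|?F. L (RT0_basis T f x) \<bullet> RT0_basis T f x)" for f
    have diag: "diagonal_mass c u v = (\<Sum>f | f facet_of T. nflux (u c) T f * nflux (v c) T f * m f)" for u v
      unfolding diagonal_mass_def ST m_def using perm_L[OF RT0_basis_in[OF simp dim]] by (auto intro!: sum.cong)
    have m: "0 \<le> m f" if "f facet_of T" for f unfolding m_def by (intro nn RT0_basis_in[OF simp dim] that)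
    have "psd_form (Vh M X) (mass c)"
    proof
      show "subspace (Vh M X)" by (rule subspace_Vh)
      fix u v w :: "'a cell \<Rightarrow> 'a \<Rightarrow> 'a" and k :: real assume u: "u \<in> Vh M X" and v: "v \<in> Vh M X"
      show "mass c u v = mass c v u"
        unfolding mass[OF u] mass[OF v] using L.sym tan[OF RT[OF u]] tan[OF RT[OF v]] Tb ST
        by (intro set_lebesgue_integral_cong) auto
      have ku: "k *\<^sub>R u \<in> Vh M X" using u subspace_Vh by (rule_tac subspace_scale)
      show "mass c (k *\<^sub>R u) v = k * mass c u v"
        unfolding mass[OF ku] mass[OF u] by (simp add: scaleR_fun_def linear_scale[OF L(1)])
      have uv: "u + v \<in> Vh M X" using u v subspace_Vh by (rule_tac subspace_add)
      show "mass c (u + v) w = mass c u w + mass c v w" if w: "w \<in> Vh M X"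
      proof -
        have "(LINT x:T|?F. L (u c x) \<bullet> w c x + L (v c x) \<bullet> w c x) =
          (LINT x:T|?F. L (u c x) \<bullet> w c x) + (LINT x:T|?F. L (v c x) \<bullet> w c x)"
          unfolding ST by (rule set_integral_add(2)[OF int[OF RT[OF u] RT[OF w]] int[OF RT[OF v] RT[OF w]]])
        then show ?thesis
          unfolding mass[OF uv] mass[OF u] mass[OF v] by (simp add: linear_add[OF L(1)] inner_add_left)
      qed
      show "0 \<le> mass c u u" unfolding mass[OF u] using nn[OF RT[OF u]] ST by simp
    qed
    moreover have "psd_form (Vh M X) (diagonal_mass c)"
      unfolding diag[abs_def]
    proof (rule psd_form_sum[OF subspace_Vh])
      fix f assume "f \<in> {f. f facet_of T}"
      then have f: "f facet_of T" by simp
      have nf: "nflux ((u + v) c) T f = nflux (u c) T f + nflux (v c) T f" if "u \<in> Vh M X" "v \<in> Vh M X" for u v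
        using nflux_Vh(1)[of u c f v] that c dim f unfolding ST by (simp del: plus_fun_apply)
      have nk: "nflux ((k *\<^sub>R u) c) T f = k * nflux (u c) T f" if "u \<in> Vh M X" for u k
        using nflux_Vh(2)[of u c f k] that c dim f unfolding ST by simp
      show "psd_form (Vh M X) (\<lambda>u v. nflux (u c) T f * nflux (v c) T f * m f)"
        using subspace_Vh m[OF f]
        by unfold_locales (simp_all add: nf nk algebra_simps del: plus_fun_apply)
    qed
    moreover have "mass c v v \<le> (DIM('a) + 1) * diagonal_mass c v v \<and> diagonal_mass c v v \<le> cell_const * mass c v v"
      if v: "v \<in> Vh M X" for v
    proof
      have d: "diagonal_mass c v v = (\<Sum>f | f facet_of T. (nflux (v c) T f)\<^sup>2 * m f)"
        unfolding diag by (simp add: power2_eq_square)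
      have d0: "0 \<le> diagonal_mass c v v" unfolding d using m by (intro sum_nonneg) auto
      have m0: "0 \<le> mass c v v" unfolding mass[OF v] using nn[OF RT[OF v]] ST by simp
      have nD: "real_of_int (aff_dim S + 1) \<le> DIM('a) + 1" using cell(8)[OF T] by linarith
      have dD: "dim (tangent S) \<le> DIM('a)" by (rule dim_subset_UNIV)
      have "mass c v v \<le> (aff_dim S + 1) * diagonal_mass c v v"
        using mass_le_diagonal[OF simp dim hull L(1,4) RT[OF v]] ST unfolding mass[OF v] d m_def by simp
      also have "\<dots> \<le> (DIM('a) + 1) * diagonal_mass c v v" using nD d0 by (rule mult_right_mono)
      finally show "mass c v v \<le> (DIM('a) + 1) * diagonal_mass c v v" by simp
      have "diagonal_mass c v v \<le> (aff_dim S + 1) * ((8 * 2 ^ dim (tangent S) + 2) * \<sigma>\<^sup>2 * \<bar>\<theta>\<bar>) * mass c v v"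
        using diagonal_le_mass[OF simp dim hull L(1,4) RT[OF v] L(2) cell(5)[OF T] L(5,6)] ST
        unfolding mass[OF v] d m_def by simp
      also have "\<dots> \<le> cell_const * mass c v v"
      proof (rule mult_right_mono[OF _ m0])
        have "(2::real) ^ dim (tangent S) \<le> 2 ^ DIM('a)" using dD by (rule power_increasing) simp
        then have "(8 * 2 ^ dim (tangent S) + 2) * \<sigma>\<^sup>2 * \<bar>\<theta>\<bar> \<le> (8 * 2 ^ DIM('a) + 2) * \<sigma>\<^sup>2 * \<bar>\<theta>\<bar>"
          by (intro mult_right_mono) auto
        then show "(aff_dim S + 1) * ((8 * 2 ^ dim (tangent S) + 2) * \<sigma>\<^sup>2 * \<bar>\<theta>\<bar>) \<le> cell_const"
          unfolding cell_const_def
            using nD by (rule_tac mult_mono) auto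
      qed
      finally show "diagonal_mass c v v \<le> cell_const * mass c v v" .
    qed
    ultimately show ?thesis by blast
  qed
  then show "psd_form (Vh M X) (mass c)" "psd_form (Vh M X) (diagonal_mass c)"
    "v \<in> Vh M X \<Longrightarrow> mass c v v \<le> (DIM('a) + 1) * diagonal_mass c v v"
    "v \<in> Vh M X \<Longrightarrow> diagonal_mass c v v \<le> cell_const * mass c v v"
    by blast+
qed

lemma psd_ipK: "psd_form (Vh M X) (ipK M X P)"
  and psd_ipKD: "psd_form (Vh M X) (ipKD M X P)"
  unfolding ipK_eq ipKD_eq using cell_forms(1,2) by (auto intro!: psd_form_sum subspace_Vh)

lemma ipK_le_ipKD: "v \<in> Vh M X \<Longrightarrow> ipK M X P v v \<le> (DIM('a) + 1) * ipKD M X P v v"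
  and ipKD_le_ipK: "v \<in> Vh M X \<Longrightarrow> ipKD M X P v v \<le> cell_const * ipK M X P v v"
  unfolding ipK_eq ipKD_eq sum_distrib_left using cell_forms(3,4) by (auto intro!: sum_mono)

lemma psd_mortar: "psd_form (Lamh M X) (ip_mortar M X P)"
proof
  show "subspace (Lamh M X)" by (rule subspace_Lamh)
  let ?\<kappa> = "\<lambda>g. gap P g * inverse (nperm P g)"
  have \<kappa>: "0 \<le> ?\<kappa> g" if "g \<in> ifaces M" for g
    using params that unfolding admissible_params_def by (simp add: less_imp_le)
  note bb = bounded_borel_intros bounded_borel_mortar_fun
  fix l \<mu> \<nu> :: "'a mcell \<Rightarrow> real" and k :: real
  show "ip_mortar M X P l \<mu> = ip_mortar M X P \<mu> l"
    unfolding ip_mortar_def ip_Gamma_def by (simp add: ac_simps)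
  have "(\<lambda>g x. ?\<kappa> g * mortar_fun X (k *\<^sub>R l) g x) = (\<lambda>g x. k * (?\<kappa> g * mortar_fun X l g x))"
    by (simp add: mortar_fun_linear ac_simps)
  then show "ip_mortar M X P (k *\<^sub>R l) \<mu> = k * ip_mortar M X P l \<mu>"
    unfolding ip_mortar_def by (simp only:) (rule ip_Gamma_linear(2), (intro bb)+)
  have "(\<lambda>g x. ?\<kappa> g * mortar_fun X (l + \<mu>) g x) = (\<lambda>g x. ?\<kappa> g * mortar_fun X l g x + ?\<kappa> g * mortar_fun X \<mu> g x)"
    by (simp add: mortar_fun_linear distrib_left)
  then show "ip_mortar M X P (l + \<mu>) \<nu> = ip_mortar M X P l \<nu> + ip_mortar M X P \<mu> \<nu>"
    unfolding ip_mortar_def by (simp only:) (rule ip_Gamma_linear(1), (intro bb)+)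
  show "0 \<le> ip_mortar M X P l l"
    unfolding ip_mortar_def ip_Gamma_def set_lebesgue_integral_def
  proof (intro sum_nonneg integral_nonneg_AE AE_I2)
    fix g x assume g: "g \<in> ifaces M"
    have "0 \<le> indicat_real (fst g) x * (?\<kappa> g * (mortar_fun X l g x * mortar_fun X l g x))"
      by (rule mult_nonneg_nonneg[OF indicator_pos_le mult_nonneg_nonneg[OF \<kappa>[OF g] zero_le_square]])
    then show "0 \<le> indicat_real (fst g) x *\<^sub>R (?\<kappa> g * mortar_fun X l g x * mortar_fun X l g x)"
      by (simp add: mult.assoc)
  qed
qed

lemma psd_form_a: "psd_form (Wh M X) (form_a M X P)"
  and psd_form_aD: "psd_form (Wh M X) (form_aD M X P)"
proof -
  have mortar: "psd_form (Wh M X) (\<lambda>w r. ip_mortar M X P (snd w) (snd r))"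
    by (rule psd_form_pullback[OF psd_mortar subspace_Wh]) (auto simp: Wh_def)
  have "psd_form (Wh M X) (\<lambda>w r. a (total_flux w) (total_flux r))" if "psd_form (Vh M X) a" for a
    using that subspace_Wh total_flux_in total_flux_linear by (rule psd_form_pullback)
  from psd_form_add[OF this[OF psd_ipK] mortar] psd_form_add[OF this[OF psd_ipKD] mortar]
  show "psd_form (Wh M X) (form_a M X P)" "psd_form (Wh M X) (form_aD M X P)"
    unfolding form_a_def[abs_def] form_aD_def[abs_def] total_flux_def .
qed

lemma form_a_le_form_aD:
  assumes w: "w \<in> Wh M X"
  shows "form_a M X P w w \<le> (DIM('a) + 1) * form_aD M X P w w"
    and "form_aD M X P w w \<le> max 1 cell_const * form_a M X P w w"
proof -
  let ?u = "total_flux w" and ?m = "ip_mortar M X P (snd w) (snd w)"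
  have u: "?u \<in> Vh M X" using total_flux_in w .
  have m: "0 \<le> ?m" using psd_form.nonneg[OF psd_mortar] w by (auto simp: Wh_def)
  have K: "0 \<le> ipK M X P ?u ?u" using psd_form.nonneg[OF psd_ipK u] .
  have "?m \<le> real (DIM('a) + 1) * ?m" using m mult_right_mono[of 1 "real (DIM('a) + 1)" ?m] by simp
  then show "form_a M X P w w \<le> (DIM('a) + 1) * form_aD M X P w w"
    using ipK_le_ipKD[OF u] unfolding form_a_def form_aD_def total_flux_def distrib_left by linarith
  have "?m \<le> max 1 cell_const * ?m" using m mult_right_mono[of 1 "max 1 cell_const" ?m] by simp
  moreover have "ipKD M X P ?u ?u \<le> max 1 cell_const * ipK M X P ?u ?u"
    using ipKD_le_ipK[OF u] mult_right_mono[OF _ K, of cell_const "max 1 cell_const"] by simp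
  ultimately show "form_aD M X P w w \<le> max 1 cell_const * form_a M X P w w"
    unfolding form_a_def form_aD_def total_flux_def distrib_left by linarith
qed

text \<open>Since \<^const>\<open>MU_inv\<close> is injective, \<^const>\<open>MU\<close> recovers \<open>x\<close> from \<open>x'\<close>, and the quotients become those of
  \<open>field_of_values\<close>.\<close>

lemma preconditioned_bounds:
  fixes C1 C2 :: real
  assumes spd: "spd_op (Wh M X) Hw" "spd_op (Qh M X) Hp"
    and c: "c1w > 0" "c2w > 0" "c1p > 0" "c2p > 0" and \<rho>: "\<rho> < 1"
    and w_bounds: "\<forall>r\<in>dual (Wh M X). c1w * r (Hw r) \<le> r (A_inv M X P r) \<and> r (A_inv M X P r) \<le> c2w * r (Hw r)"
    and p_bounds: "\<forall>q\<in>dual (Qh M X). c1p * q (Hp q) \<le> q (Schur_inv M X P q) \<and> q (Schur_inv M X P q) \<le> c2p * q (Hp q)"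
    and contr: "A_onorm M X P (\<lambda>w. w - Hw (A_op M X P w)) \<le> \<rho>"
    and x: "x \<in> Wh M X \<times> Qh M X" "x \<noteq> 0" and x': "x' = MU_inv M X Hw Hp x"
    and CC: "C1 = DIM('a) + 1" "C2 = max 1 cell_const"
  shows "1 / (4 * (2 * c2w + 2 + c2p * C1 * c2w)) \<le>
      op_inner (MD Hw Hp) (calA M X P (MU M X Hw Hp x')) x' / op_inner (MD Hw Hp) x' x'"
    and "op_norm (MD Hw Hp) (calA M X P (MU M X Hw Hp x')) / op_norm (MD Hw Hp) x' \<le>
      sqrt ((4 + C2 / c1p) * (2 / c1w * (1 + C2 / (c1w * c1p)) + C2 / (c1w * c1p)))"
proof -
  obtain FV where FV: "finite FV" "Wh M X \<subseteq> span FV" using Wh_finite_span by blast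
  obtain FQ where FQ: "finite FQ" "Qh M X \<subseteq> span FQ" using Qh_finite_span by blast
  interpret a: psd_form "Wh M X" "form_a M X P" by (rule psd_form_a)
  interpret d: psd_form "Wh M X" "form_aD M X P" by (rule psd_form_aD)
  interpret saddle_point "Wh M X" "form_a M X P" Hw c1w c2w FV "form_aD M X P" "Qh M X" "form_b M X" C1 C2 Hp c1p c2p FQ \<rho>
  proof
    show "finite FV" "Wh M X \<subseteq> span FV" "finite FQ" "Qh M X \<subseteq> span FQ" by fact+
    show "subspace (Qh M X)" by (rule subspace_Qh)
    show "form_a M X P u u \<le> C1 * form_aD M X P u u" "form_aD M X P u u \<le> C2 * form_a M X P u u"
      if "u \<in> Wh M X" for u using form_a_le_form_aD[OF that] CC by simp_all
    show "C1 > 0" "C2 > 0" using CC by auto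
    show "\<rho> \<le> 1" using \<rho> by simp
    show "(SUP u\<in>Wh M X. sqrt (form_op (Wh M X) (form_a M X P) (u - Hw (form_op (Wh M X) (form_a M X P) u))
        (u - Hw (form_op (Wh M X) (form_a M X P) u))) / sqrt (form_op (Wh M X) (form_a M X P) u u)) \<le> \<rho>"
      using contr unfolding A_onorm_def A_norm_def A_op_def .
  qed (use spd c w_bounds p_bounds form_b_linear in
    \<open>auto simp: A_inv_def A_op_def Schur_inv_def B_op_def BT_op_def DA_inv_def DA_op_def\<close>)
  obtain u p where up: "x = (u, p)" by (cases x)
  have u: "u \<in> Wh M X" and p: "p \<in> Qh M X" and nz: "u \<noteq> 0 \<or> p \<noteq> 0"
    using x up by (auto simp: zero_prod_def)
  have MU_inv_eq: "MU_inv M X Hw Hp (u, p) = (w.Hi u + BT p, p.Hi p)" for u p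
    by (simp add: MU_inv_def BT_op_def w.Hi_def p.Hi_def)
  have "inj_on (MU_inv M X Hw Hp) (Wh M X \<times> Qh M X)"
  proof (rule inj_onI)
    fix y z assume y: "y \<in> Wh M X \<times> Qh M X" and z: "z \<in> Wh M X \<times> Qh M X"
      and eq: "MU_inv M X Hw Hp y = MU_inv M X Hw Hp z"
    obtain u p where up: "y = (u, p)" by (cases y)
    obtain u' p' where up': "z = (u', p')" by (cases z)
    have "p.Hi p = p.Hi p'" using eq unfolding up up' MU_inv_eq by simp
    then have pp: "p = p'" using p.H_Hi y z up up' by (metis mem_Sigma_iff)
    then have "w.Hi u = w.Hi u'" using eq unfolding up up' MU_inv_eq by simp
    then have "u = u'" using w.H_Hi y z up up' by (metis mem_Sigma_iff)
    then show "y = z" using pp up up' by simp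
  qed
  then have MU: "MU M X Hw Hp x' = (u, p)"
    unfolding MU_def x' using x(1) up by simp
  have calA: "calA M X P (u, p) = (A u + BT p, - B u)"
    by (simp add: calA_def A_op_def BT_op_def B_op_def)
  have x'_eq: "x' = (w.Hi u + BT p, p.Hi p)" unfolding x' up MU_inv_eq ..
  have inner: "op_inner (MD Hw Hp) (r, s) (r', s') = r (Hw r') + s (Hp s')" for r s r' s'
    by (simp add: op_inner_def MD_def)
  show "1 / (4 * (2 * c2w + 2 + c2p * C1 * c2w)) \<le>
      op_inner (MD Hw Hp) (calA M X P (MU M X Hw Hp x')) x' / op_inner (MD Hw Hp) x' x'"
    unfolding MU calA unfolding x'_eq inner by (rule field_of_values(1)[OF u p nz])
  show "op_norm (MD Hw Hp) (calA M X P (MU M X Hw Hp x')) / op_norm (MD Hw Hp) x' \<le>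
      sqrt ((4 + C2 / c1p) * (2 / c1w * (1 + C2 / (c1w * c1p)) + C2 / (c1w * c1p)))"
    unfolding MU calA op_norm_def unfolding x'_eq inner by (rule field_of_values(2)[OF u p nz])
qed

end

theorem theorem4p9:
  fixes M :: "(real ^ 'n) medium"
    and \<sigma> \<theta> \<rho> c1w c2w c1p c2p :: real
  assumes "CARD('n) \<in> {2, 3}"
    and "fractured_medium M"
    and "c1w > 0" "c2w > 0" "c1p > 0" "c2p > 0"
    and "0 \<le> \<rho>" "\<rho> < 1"
  shows "\<exists>\<xi>1>0. \<exists>\<xi>2>0. \<forall>X P Hw Hp.
    admissible_mesh M \<sigma> X \<longrightarrow>
    admissible_params M \<theta> P \<longrightarrow>
    spd_op (Wh M X) Hw \<longrightarrow>
    spd_op (Qh M X) Hp \<longrightarrow>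
    (\<forall>r\<in>dual (Wh M X). c1w * r (Hw r) \<le> r (A_inv M X P r) \<and> r (A_inv M X P r) \<le> c2w * r (Hw r)) \<longrightarrow>
    (\<forall>q\<in>dual (Qh M X). c1p * q (Hp q) \<le> q (Schur_inv M X P q) \<and> q (Schur_inv M X P q) \<le> c2p * q (Hp q)) \<longrightarrow>
    A_onorm M X P (\<lambda>w. w - Hw (A_op M X P w)) \<le> \<rho> \<longrightarrow>
    (\<forall>x\<in>Wh M X \<times> Qh M X. \<forall>x'. x \<noteq> 0 \<and> x' = MU_inv M X Hw Hp x \<longrightarrow>
       \<xi>1 \<le> op_inner (MD Hw Hp) (calA M X P (MU M X Hw Hp x')) x' / op_inner (MD Hw Hp) x' x' \<and>
       op_norm (MD Hw Hp) (calA M X P (MU M X Hw Hp x')) / op_norm (MD Hw Hp) x' \<le> \<xi>2)"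
proof -
  define C1 :: real where "C1 = DIM(real ^ 'n) + 1"
  define C2 where "C2 = max 1 ((DIM(real ^ 'n) + 1) * ((8 * 2 ^ DIM(real ^ 'n) + 2) * \<sigma>\<^sup>2 * \<bar>\<theta>\<bar>))"
  define \<xi>1 where "\<xi>1 = 1 / (4 * (2 * c2w + 2 + c2p * C1 * c2w))"
  define \<xi>2 where "\<xi>2 = sqrt ((4 + C2 / c1p) * (2 / c1w * (1 + C2 / (c1w * c1p)) + C2 / (c1w * c1p)))"
  have C: "C1 > 0" "C2 > 0" by (simp_all add: C1_def C2_def)
  have pos: "\<xi>1 > 0" "\<xi>2 > 0"
    using assms(3-6) C unfolding \<xi>1_def \<xi>2_def by (simp_all add: add_pos_pos)
  show ?thesis
  proof (rule exI[of _ \<xi>1], intro conjI pos, rule exI[of _ \<xi>2], intro conjI pos allI impI ballI)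
    fix X P Hw Hp and x :: "(real ^ 'n) state" and x' :: "(real ^ 'n) dstate"
    assume mesh: "admissible_mesh M \<sigma> X" and par: "admissible_params M \<theta> P"
      and *: "spd_op (Wh M X) Hw" "spd_op (Qh M X) Hp"
        "\<forall>r\<in>dual (Wh M X). c1w * r (Hw r) \<le> r (A_inv M X P r) \<and> r (A_inv M X P r) \<le> c2w * r (Hw r)"
        "\<forall>q\<in>dual (Qh M X). c1p * q (Hp q) \<le> q (Schur_inv M X P q) \<and> q (Schur_inv M X P q) \<le> c2p * q (Hp q)"
        "A_onorm M X P (\<lambda>w. w - Hw (A_op M X P w)) \<le> \<rho>"
      and x: "x \<in> Wh M X \<times> Qh M X" and x': "x \<noteq> 0 \<and> x' = MU_inv M X Hw Hp x"
    interpret fracture_problem M X \<sigma> P \<theta>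
      using assms(2) mesh par by unfold_locales
    note bounds = preconditioned_bounds[OF *(1,2) assms(3-6,8) *(3-5) x, of x' C1 C2]
    show "\<xi>1 \<le> op_inner (MD Hw Hp) (calA M X P (MU M X Hw Hp x')) x' / op_inner (MD Hw Hp) x' x'"
      unfolding \<xi>1_def using x' by (intro bounds) (simp_all add: C1_def C2_def cell_const_def)
    show "op_norm (MD Hw Hp) (calA M X P (MU M X Hw Hp x')) / op_norm (MD Hw Hp) x' \<le> \<xi>2"
      unfolding \<xi>2_def using x' by (intro bounds) (simp_all add: C1_def C2_def cell_const_def)
  qed
qed

end
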